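(* Let $N\ge1$ and let $(G_t)_{t\ge0}$ be the Brownian motion on $\mathrm{U}(N)$ issued from $\mathrm{Id}$. For all integers $n,m\ge1$ and all $t\ge0$, $$\mathbb{E}\big[G_t^{\otimes n}\otimes\overline{G_t}^{\otimes m}\big]=e^{t\Delta_U(n,m)}\in\mathrm{End}\big((\mathbb{C}^N)^{\otimes(n+m)}\big),$$ where $$-\Delta_U(n,m)=\rho_+\Big(\frac{n+m}{2}+\frac1N\sum_{1\le i<j\le n+m}\big(\mathbf 1_{\{i,j\le n\text{ or }i,j>n\}}\,(i\,j)-\mathbf 1_{\{i\le n<j\}}\,\langle i\,j\rangle\big)\Big).$$
   Context: $\overline{G_t}$ is the entrywise complex conjugate. Brownian motion on $\mathrm{U}(N)$: let $\mathfrak u(N)=\{X\in M_N(\mathbb{C}):X+X^*=0\}$ with scalar product $\langle x,y\rangle=-N\,\mathrm{Tr}(xy)$, let $(K_t)_{t\ge0}$ be the standard Brownian motion on this Euclidean space (centered Gaussian process with $\mathbb{E}[\langle x,K_t\rangle\langle y,K_s\rangle]=\min(t,s)\langle x,y\rangle$), and $C=\sum_ix_i^2$ for any orthonormal basis $(x_i)$ of $\mathfrak u(N)$. Then $(G_t)$ is the solution of the Itô equation $dG_t=G_t\,dK_t+\frac12C\,G_t\,dt$, $G_0=\mathrm{Id}$. The linear map $\rho_+$ is determined on the elements used here by: $\rho_+(c)=c\,\mathrm{Id}$ for scalars $c$; for $1\le i<j\le n+m$, $\rho_+((i\,j))$ is the operator on $(\mathbb{C}^N)^{\otimes(n+m)}$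 exchanging the $i$-th and $j$-th tensor factors; $\rho_+(\langle i\,j\rangle)$ acts as $\sum_{1\le k,l\le N}E_{k,l}\otimes E_{k,l}$ on the $i$-th and $j$-th tensor factors and as the identity on the other factors, where $E_{k,l}$ are the elementary matrices. *)

theory Defs
  imports "HOL-Probability.Probability"
begin

section \<open>Brownian motion on the unitary Lie algebra\<close>

text \<open>Matrices of size \<open>N\<close> are elements of \<^typ>\<open>complex^'n^'n\<close> with \<open>N = CARD('n)\<close>;
  \<open>norm\<close> on this type is the Frobenius (Hilbert-Schmidt) norm.\<close>

definition mat_cnj :: "complex^'n^'m \<Rightarrow> complex^'n^'m" where
  "mat_cnj A = map_matrix cnj A"

definition conj_transpose :: "complex^'n^'m \<Rightarrow> complex^'m^'n" where
  "conj_transpose A = mat_cnj (Finite_Cartesian_Product.transpose A)"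

definition u_algebra :: "(complex^'n^'n) set" where
  "u_algebra = {X. X + conj_transpose X = 0}"

text \<open>On \<^const>\<open>u_algebra\<close> the trace of a product is real, so taking the real part below only
  turns the complex number \<open>- N Tr(xy)\<close> into an element of type \<^typ>\<open>real\<close>.\<close>

definition u_inner :: "complex^'n^'n \<Rightarrow> complex^'n^'n \<Rightarrow> real" where
  "u_inner x y = - real CARD('n) * Re (trace (x ** y))"

text \<open>\<open>span\<close> is the real linear span.\<close>

definition u_orthonormal_basis :: "(complex^'n^'n) set \<Rightarrow> bool" where
  "u_orthonormal_basis B \<longleftrightarrow> finite B \<and> B \<subseteq> u_algebra \<and> span B = u_algebra \<and>
     (\<forall>x\<in>B. \<forall>y\<in>B. u_inner x y = (if x = y then 1 else 0))"

text \<open>The sum does not depend on the orthonormal basis.\<close>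

definition u_casimir :: "complex^'n^'n" where
  "u_casimir = (\<Sum>x\<in>(SOME B. u_orthonormal_basis B). x ** x)"

text \<open>Degenerate (almost surely zero) variables are Gaussian as well.\<close>

definition centered_gaussian :: "'w measure \<Rightarrow> ('w \<Rightarrow> real) \<Rightarrow> bool" where
  "centered_gaussian M X \<longleftrightarrow> X \<in> borel_measurable M \<and>
     ((AE \<omega> in M. X \<omega> = 0) \<or> (\<exists>\<sigma>>0. distributed M lborel X (normal_density 0 \<sigma>)))"

text \<open>Only the indices \<open>t \<ge> 0\<close> of \<^term>\<open>F :: real \<Rightarrow> 'w measure\<close> matter.\<close>

definition nonneg_filtration :: "'w measure \<Rightarrow> (real \<Rightarrow> 'w measure) \<Rightarrow> bool" where
  "nonneg_filtration M F \<longleftrightarrow> (\<forall>t\<ge>0. subalgebra M (F t)) \<and>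
     (\<forall>s t. 0 \<le> s \<longrightarrow> s \<le> t \<longrightarrow> subalgebra (F t) (F s))"

text \<open>Standard Brownian motion on \<open>u(N)\<close>, relative to a filtration \<open>F\<close>: a centered Gaussian process
  with the prescribed covariance and continuous paths, whose increments after time \<open>s\<close> are
  independent of \<open>F s\<close>. For the filtration generated by \<open>K\<close>, and for its completion,
  this independence follows from the other conditions.\<close>

definition u_brownian_motion ::
  "'w measure \<Rightarrow> (real \<Rightarrow> 'w measure) \<Rightarrow> (real \<Rightarrow> 'w \<Rightarrow> complex^'n^'n) \<Rightarrow> bool" where
  "u_brownian_motion M F K \<longleftrightarrow>
     (\<forall>t\<ge>0. K t \<in> borel_measurable (F t) \<and> (\<forall>\<omega>\<in>space M. K t \<omega> \<in> u_algebra)) \<and>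
     (\<forall>S c. finite S \<and> S \<subseteq> {0..} \<times> u_algebra \<longrightarrow>
        centered_gaussian M (\<lambda>\<omega>. \<Sum>p\<in>S. c p * u_inner (snd p) (K (fst p) \<omega>))) \<and>
     (\<forall>x\<in>u_algebra. \<forall>y\<in>u_algebra. \<forall>t\<ge>0. \<forall>s\<ge>0.
        (\<integral>\<omega>. u_inner x (K t \<omega>) * u_inner y (K s \<omega>) \<partial>M) = min t s * u_inner x y) \<and>
     (AE \<omega> in M. continuous_on {0..} (\<lambda>t. K t \<omega>)) \<and>
     (\<forall>s t. 0 \<le> s \<longrightarrow> s \<le> t \<longrightarrow> prob_space.indep_set M (sets (F s))
        {(\<lambda>\<omega>. K t \<omega> - K s \<omega>) -` A \<inter> space M | A. A \<in> sets borel})"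


section \<open>Ito integral and Brownian motion on the unitary group\<close>

text \<open>The triple \<open>k, \<tau>, \<xi>\<close> encodes the simple process
  \<open>s \<mapsto> \<Sum>i<k. \<xi> i 1(\<tau> i < s \<le> \<tau> (i + 1))\<close> on \<open>[0, t]\<close>.\<close>

definition simple_process ::
  "'w measure \<Rightarrow> (real \<Rightarrow> 'w measure) \<Rightarrow> real \<Rightarrow> nat \<Rightarrow> (nat \<Rightarrow> real) \<Rightarrow>
   (nat \<Rightarrow> 'w \<Rightarrow> complex^'n^'n) \<Rightarrow> bool" where
  "simple_process M F t k \<tau> \<xi> \<longleftrightarrow> \<tau> 0 = 0 \<and> \<tau> k = t \<and> (\<forall>i<k. \<tau> i \<le> \<tau> (Suc i)) \<and>
     (\<forall>i<k. \<xi> i \<in> borel_measurable (F (\<tau> i)) \<and> (\<exists>b. \<forall>\<omega>\<in>space M. norm (\<xi> i \<omega>) \<le> b))"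

definition simple_value ::
  "nat \<Rightarrow> (nat \<Rightarrow> real) \<Rightarrow> (nat \<Rightarrow> 'w \<Rightarrow> complex^'n^'n) \<Rightarrow> real \<Rightarrow> 'w \<Rightarrow> complex^'n^'n" where
  "simple_value k \<tau> \<xi> s \<omega> = (\<Sum>i<k. indicator {\<tau> i<..\<tau> (Suc i)} s *\<^sub>R \<xi> i \<omega>)"

definition simple_integral ::
  "(real \<Rightarrow> 'w \<Rightarrow> complex^'n^'n) \<Rightarrow> nat \<Rightarrow> (nat \<Rightarrow> real) \<Rightarrow> (nat \<Rightarrow> 'w \<Rightarrow> complex^'n^'n) \<Rightarrow>
   'w \<Rightarrow> complex^'n^'n" where
  "simple_integral K k \<tau> \<xi> \<omega> = (\<Sum>i<k. \<xi> i \<omega> ** (K (\<tau> (Suc i)) \<omega> - K (\<tau> i) \<omega>))"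

text \<open>\<open>Y\<close> is (a version of) the Ito integral of \<open>H dK\<close> over \<open>[0, t]\<close>, for \<open>H\<close> in the usual
  class of square integrable integrands: simple processes converge to \<open>H\<close> in
  \<open>L\<^sup>2(P \<otimes> ds)\<close> while their integrals converge to \<open>Y\<close> in \<open>L\<^sup>2(P)\<close>.\<close>

definition has_ito_integral ::
  "'w measure \<Rightarrow> (real \<Rightarrow> 'w measure) \<Rightarrow> (real \<Rightarrow> 'w \<Rightarrow> complex^'n^'n) \<Rightarrow>
   (real \<Rightarrow> 'w \<Rightarrow> complex^'n^'n) \<Rightarrow> real \<Rightarrow> ('w \<Rightarrow> complex^'n^'n) \<Rightarrow> bool" where
  "has_ito_integral M F K H t Y \<longleftrightarrow> Y \<in> borel_measurable M \<and>
     (\<exists>k \<tau> \<xi>. (\<forall>r::nat. simple_process M F t (k r) (\<tau> r) (\<xi> r)) \<and>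
        (\<lambda>r. \<integral>\<^sup>+\<omega>. (\<integral>\<^sup>+s\<in>{0..t}.
            ennreal ((norm (simple_value (k r) (\<tau> r) (\<xi> r) s \<omega> - H s \<omega>))\<^sup>2) \<partial>lborel) \<partial>M)
          \<longlonglongrightarrow> 0 \<and>
        (\<lambda>r. \<integral>\<^sup>+\<omega>. ennreal ((norm (simple_integral K (k r) (\<tau> r) (\<xi> r) \<omega> - Y \<omega>))\<^sup>2) \<partial>M)
          \<longlonglongrightarrow> 0)"

text \<open>\<open>G\<close> is the solution of \<open>dG = G dK + C/2 G dt\<close>, \<open>G 0 = Id\<close>. That \<open>G\<close> takes its values
  in the unitary group is not part of the definition.\<close>

definition unitary_brownian_motion ::
  "'w measure \<Rightarrow> (real \<Rightarrow> 'w measure) \<Rightarrow> (real \<Rightarrow> 'w \<Rightarrow> complex^'n^'n) \<Rightarrow>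
   (real \<Rightarrow> 'w \<Rightarrow> complex^'n^'n) \<Rightarrow> bool" where
  "unitary_brownian_motion M F K G \<longleftrightarrow>
     (\<forall>t\<ge>0. G t \<in> borel_measurable (F t)) \<and>
     (AE \<omega> in M. continuous_on {0..} (\<lambda>t. G t \<omega>)) \<and>
     (AE \<omega> in M. G 0 \<omega> = mat 1) \<and>
     (\<forall>t\<ge>0. \<exists>Y. has_ito_integral M F K G t Y \<and>
        (AE \<omega> in M. G t \<omega> = G 0 \<omega> + Y \<omega>
            + integral {0..t} (\<lambda>s. (1/2) *\<^sub>R (u_casimir ** G s \<omega>))))"


section \<open>Operators on tensor powers\<close>

text \<open>The canonical basis of the \<open>d\<close>-th tensor power of \<open>\<complex>\<^sup>N\<close> is indexed by
  the words \<open>I : {1..d} \<rightarrow> 'n\<close>, and an endomorphism is given by its matrix \<open>A I J\<close> (row \<open>I\<close>,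
  column \<open>J\<close>) in this basis. Only entries with \<open>I\<close> and \<open>J\<close> words of length \<open>d\<close> are meaningful.\<close>

type_synonym 'n tensor_op = "(nat \<Rightarrow> 'n) \<Rightarrow> (nat \<Rightarrow> 'n) \<Rightarrow> complex"

definition words :: "nat \<Rightarrow> (nat \<Rightarrow> 'n) set" where
  "words d = {1..d} \<rightarrow>\<^sub>E UNIV"

text \<open>The matrix of \<open>A 1 \<otimes> \<dots> \<otimes> A d\<close>.\<close>

definition tensor :: "nat \<Rightarrow> (nat \<Rightarrow> complex^'n^'n) \<Rightarrow> 'n tensor_op" where
  "tensor d A I J = (\<Prod>i\<in>{1..d}. A i $ I i $ J i)"

definition op_id :: "nat \<Rightarrow> 'n::finite tensor_op" where
  "op_id d = tensor d (\<lambda>_. mat 1)"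

definition op_mult :: "nat \<Rightarrow> 'n tensor_op \<Rightarrow> 'n tensor_op \<Rightarrow> 'n tensor_op" where
  "op_mult d A B I J = (\<Sum>L\<in>words d. A I L * B L J)"

primrec op_power :: "nat \<Rightarrow> 'n::finite tensor_op \<Rightarrow> nat \<Rightarrow> 'n tensor_op" where
  "op_power d A 0 = op_id d"
| "op_power d A (Suc r) = op_mult d A (op_power d A r)"

definition op_exp :: "nat \<Rightarrow> 'n::finite tensor_op \<Rightarrow> 'n tensor_op" where
  "op_exp d A I J = (\<Sum>r. op_power d A r I J / fact r)"

definition elementary_mat :: "'n \<Rightarrow> 'n \<Rightarrow> complex^'n^'n" where
  "elementary_mat a b = (\<chi> i j. if i = a \<and> j = b then 1 else 0)"


section \<open>The generator\<close>

text \<open>The values of \<open>\<rho>\<^sub>+\<close> on scalars, on transpositions \<open>(i j)\<close> and on contractions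
  \<open>\<langle>i j\<rangle>\<close>. Exchanging the factors \<open>i\<close> and \<open>j\<close> sends the basis vector with index \<open>J\<close> to the
  one with index \<open>J \<circ> (i j)\<close>.\<close>

definition rho_scalar :: "nat \<Rightarrow> complex \<Rightarrow> 'n::finite tensor_op" where
  "rho_scalar d c I J = c * op_id d I J"

definition rho_transposition :: "nat \<Rightarrow> nat \<Rightarrow> 'n tensor_op" where
  "rho_transposition i j I J = (if I = J \<circ> Transposition.transpose i j then 1 else 0)"

definition rho_contraction :: "nat \<Rightarrow> nat \<Rightarrow> nat \<Rightarrow> 'n::finite tensor_op" where
  "rho_contraction d i j I J =
     (\<Sum>a\<in>UNIV. \<Sum>b\<in>UNIV. tensor d (\<lambda>r. if r = i \<or> r = j then elementary_mat a b else mat 1) I J)"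

text \<open>By linearity of \<open>\<rho>\<^sub>+\<close>, \<open>- Delta_U n m\<close> is the image of
  \<open>(n + m)/2 + 1/N \<Sum>i<j. (1(i,j \<le> n or i,j > n) (i j) - 1(i \<le> n < j) \<langle>i j\<rangle>)\<close>.\<close>

definition Delta_U :: "nat \<Rightarrow> nat \<Rightarrow> 'n::finite tensor_op" where
  "Delta_U n m I J = - (rho_scalar (n + m) ((of_nat n + of_nat m) / 2) I J
     + 1 / of_nat CARD('n) * (\<Sum>(i,j)\<in>{(i,j). 1 \<le> i \<and> i < j \<and> j \<le> n + m}.
         of_bool ((i \<le> n \<and> j \<le> n) \<or> (i > n \<and> j > n)) * rho_transposition i j I J
       - of_bool (i \<le> n \<and> n < j) * rho_contraction (n + m) i j I J))"

end

theory Submission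
  imports Defs
begin

text \<open>
  Let \<open>P\<close> be the Euler scheme \<open>P (k + 1) = P k (1 - h/2 + dK)\<close> with \<open>r\<close> steps of length \<open>h = t/r\<close>; the
  drift is \<open>- G/2\<close> because the Casimir element is \<open>- Id\<close>. The Ito isometry and a discrete Gronwall
  inequality give \<open>P r \<rightarrow> G t\<close> in \<open>L\<^sup>2\<close>, using second moments of \<open>G\<close> only. As the increments are
  independent, the expectation of a mixed tensor power of \<open>P r\<close> is a product of \<open>r\<close> one-step
  operators, each equal to \<open>1 + h \<Delta> + O(h\<^sup>3\<^sup>/\<^sup>2)\<close> by the Gaussian covariances, and the product tends to
  \<open>exp (t \<Delta>)\<close>. Applied to \<open>(n + m, n + m)\<close>, the same computation bounds the second moments of
  the tensors, so the expectations converge too. Neither Ito's formula nor the unitarity of \<open>G\<close> is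
  needed.
\<close>

section \<open>The Lie algebra\<close>

text \<open>Euler iterates are polynomials in independent Gaussian increments, so all their moments
  exist and can be computed. The two parts of the generator are the two terms of one step. The drift
  contributes -1/2 for each of the n + m slots. Each pair of slots contributes the covariance
  E[dK_ab dK_cd] = -(h/N) 1(a = d, b = c), which is minus a transposition when both slots are of the
  same kind. Conjugating one slot replaces dK_cd by cnj dK_cd = -dK_dc, which reverses the sign and
  turns the transposition into a contraction. The order 3/2 of the local error is what absolute
  moments of three increments give; it suffices because r h^(3/2) = t sqrt h tends to 0. Mean square
  convergence of matrices does not control products of n + m entries. It is used only to extract an
  almost surely convergent subsequence; the uniform L2 bound on the tensors then provides the
  uniform integrability.\<close>

lemma conj_transpose_nth [simp]: "conj_transpose A $ i $ j = cnj (A $ j $ i)"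
  by (simp add: conj_transpose_def mat_cnj_def map_matrix_def Finite_Cartesian_Product.transpose_def)

lemma mat_cnj_nth [simp]: "mat_cnj A $ i $ j = cnj (A $ i $ j)"
  by (simp add: mat_cnj_def map_matrix_def)

lemma u_algebra_iff: "X \<in> u_algebra \<longleftrightarrow> (\<forall>a b. cnj (X $ a $ b) = - X $ b $ a)"
  by (auto simp: u_algebra_def vec_eq_iff add_eq_0_iff)

lemma u_algebraD: "X \<in> u_algebra \<Longrightarrow> cnj (X $ a $ b) = - X $ b $ a"
  by (simp add: u_algebra_iff)

lemma trace_mult: "trace (x ** y) = (\<Sum>i\<in>UNIV. \<Sum>j\<in>UNIV. x $ i $ j * y $ j $ i)"
  by (simp add: trace_def matrix_matrix_mult_def)

text \<open>Skew-Hermitian symmetry turns \<open>y $ j $ i\<close> into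
  \<open>- cnj (y $ i $ j)\<close>, so the trace form is N times the real Frobenius product.
  Positivity and orthonormal bases are inherited from there.\<close>

lemma u_inner_eq_inner:
  fixes x y :: "complex^'n^'n"
  assumes "y \<in> u_algebra"
  shows "u_inner x y = real CARD('n) * (x \<bullet> y)"
proof -
  have "x $ i $ j * y $ j $ i = - (x $ i $ j * cnj (y $ i $ j))" for i j
    using u_algebraD[OF assms, of i j] by simp
  then show ?thesis
    by (simp add: u_inner_def trace_mult inner_vec_def inner_complex_def sum_negf)
qed

lemma subspace_u_algebra: "subspace (u_algebra :: (complex^'n^'n) set)"
  by (auto simp: subspace_def u_algebra_iff)

section \<open>Skew-Hermitian test matrices and the entries of an element of u(N)\<close>

lemma elementary_mat_nth: "elementary_mat a b $ i $ j = of_bool (i = a \<and> j = b)"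
  by (simp add: elementary_mat_def)

text \<open>Test matrices that read off one entry: up to the factors -2N and 2N, pairing
  \<open>X\<close> with \<open>u_real a b\<close> and \<open>u_imag a b\<close> gives the real and
  the imaginary part of \<open>X $ a $ b\<close>. On the diagonal \<open>u_real a a\<close> is 0 and
  \<open>u_imag a a\<close> is 2i times a matrix unit.\<close>

abbreviation u_real :: "'n \<Rightarrow> 'n \<Rightarrow> complex^'n^'n" where
  "u_real a b \<equiv> elementary_mat b a - elementary_mat a b"

abbreviation u_imag :: "'n \<Rightarrow> 'n \<Rightarrow> complex^'n^'n" where
  "u_imag a b \<equiv> \<chi> i j. \<i> * (elementary_mat b a + elementary_mat a b) $ i $ j"

lemma sum_of_bool_pair:
  fixes f :: "'a::finite \<Rightarrow> 'b::finite \<Rightarrow> complex"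
  shows "(\<Sum>i\<in>UNIV. \<Sum>j\<in>UNIV. of_bool (i = a \<and> j = b) * f i j) = f a b"
proof -
  have "(\<Sum>j\<in>UNIV. of_bool (i = a \<and> j = b) * f i j) = (if i = a then f a b else 0)" for i
    by (cases "i = a") (simp_all add: of_bool_def if_distrib[of "\<lambda>x. x * _"] cong: if_cong)
  then show ?thesis by simp
qed

lemma u_inner_u_real:
  fixes X :: "complex^'n^'n"
  assumes "X \<in> u_algebra"
  shows "u_inner (u_real a b) X = - 2 * real CARD('n) * Re (X $ a $ b)"
proof -
  have "trace (u_real a b ** X) = X $ a $ b - X $ b $ a"
    by (simp add: trace_mult elementary_mat_nth left_diff_distrib sum_subtractf sum_of_bool_pair
        del: sum_of_bool_mult_eq)
  also have "X $ b $ a = - cnj (X $ a $ b)"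
    using u_algebraD[OF assms, of a b] by simp
  finally show ?thesis
    by (simp add: u_inner_def)
qed

lemma u_inner_u_imag:
  fixes X :: "complex^'n^'n"
  assumes "X \<in> u_algebra"
  shows "u_inner (u_imag a b) X = 2 * real CARD('n) * Im (X $ a $ b)"
proof -
  have "trace (u_imag a b ** X) = \<i> * (X $ a $ b + X $ b $ a)"
    by (simp add: trace_mult elementary_mat_nth distrib_right distrib_left sum.distrib mult.assoc
        sum_of_bool_pair del: sum_of_bool_mult_eq flip: sum_distrib_left)
  also have "X $ b $ a = - cnj (X $ a $ b)"
    using u_algebraD[OF assms, of a b] by simp
  finally show ?thesis
    by (simp add: u_inner_def)
qed

lemma u_real_in_u: "u_real a b \<in> u_algebra"
  unfolding u_algebra_iff
proof (intro allI)
  fix i j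
  show "cnj (u_real a b $ i $ j)
      = - u_real a b $ j $ i"
    unfolding elementary_mat_nth vector_minus_component vector_uminus_component
    by (cases "i = b"; cases "j = a"; cases "i = a"; cases "j = b") simp_all
qed

lemma u_imag_in_u: "u_imag a b \<in> u_algebra"
  unfolding u_algebra_iff
proof (intro allI)
  fix i j
  show "cnj (u_imag a b $ i $ j)
      = - u_imag a b $ j $ i"
    unfolding elementary_mat_nth vector_add_component vector_uminus_component vec_lambda_beta
    by (cases "i = b"; cases "j = a"; cases "i = a"; cases "j = b") simp_all
qed

text \<open>The probabilistic hypotheses on \<open>K\<close> concern the pairings
  \<open>u_inner x (K t)\<close>, while tensors are made of entries. This formula carries means,
  covariances and moments from the former to the latter.\<close>

lemma entry_from_u_inner:
  fixes X :: "complex^'n^'n"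
  assumes "X \<in> u_algebra"
  shows "X $ a $ b = (\<i> * of_real (u_inner (u_imag a b) X)
      - of_real (u_inner (u_real a b) X)) / (2 * of_nat CARD('n))"
proof -
  have scal: "of_real u + \<i> * of_real v = (\<i> * of_real (2 * r * v) - of_real (- 2 * r * u)) / (2
    * of_real r)"
    if "r \<noteq> 0" for r u v :: real
    using that by (simp add: divide_simps) (simp add: algebra_simps)
  from scal[of "real CARD('n)" "Re (X $ a $ b)" "Im (X $ a $ b)"] show ?thesis
    unfolding u_inner_u_imag[OF assms] u_inner_u_real[OF assms] by (simp flip: complex_eq)
qed

text \<open>Used both for a Brownian increment and, with counting measure, for an orthonormal basis.\<close>

lemma entry_covariance:
  fixes X :: "'w \<Rightarrow> complex^'n^'n"
  assumes X: "\<And>w. w \<in> space M \<Longrightarrow> X w \<in> u_algebra"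
    and int: "\<And>x y. x \<in> u_algebra \<Longrightarrow> y \<in> u_algebra \<Longrightarrow> integrable M (\<lambda>w. u_inner x (X w) * u_inner y (X w))"
    and cov: "\<And>x y. x \<in> u_algebra \<Longrightarrow> y \<in> u_algebra \<Longrightarrow>
      (\<integral>w. u_inner x (X w) * u_inner y (X w) \<partial>M) = c * u_inner x y"
  shows "has_bochner_integral M (\<lambda>w. X w $ a $ b * X w $ a' $ b')
    (- of_real c / of_nat CARD('n) * of_bool (a = b' \<and> b = a'))"
proof -
  let ?P = "\<lambda>a b. u_real a b :: complex^'n^'n"
  let ?Q = "\<lambda>a b. (u_imag a b) :: complex^'n^'n"
  let ?N = "of_nat CARD('n) :: complex"
  let ?p = "\<lambda>x y w. complex_of_real (u_inner x (X w) * u_inner y (X w))"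
  have hbi: "has_bochner_integral M (?p x y) (of_real (c * u_inner x y))"
    if "x \<in> u_algebra" "y \<in> u_algebra" for x y
    using has_bochner_integral_of_real[of M "\<lambda>w. u_inner x (X w) * u_inner y (X w)"
      "c * u_inner x y", where 'a = complex]
      int[OF that] cov[OF that] by (simp add: has_bochner_integral_iff)
  note u = u_real_in_u u_imag_in_u
  have eq: "X w $ a $ b * X w $ a' $ b' =
     (?p (?P a b) (?P a' b') w - \<i> * ?p (?P a b) (?Q a' b') w - \<i> * ?p (?Q a b) (?P a' b') w
       - ?p (?Q a b) (?Q a' b') w) / (4 * ?N^2)" if "w \<in> space M" for w
  proof -
    have "(\<i> * q - p) / (2 * n) * ((\<i> * q' - p') / (2 * n)) =
      (p * p' - \<i> * (p * q') - \<i> * (q * p') - q * q') / (4 * n^2)" for p q p' q' n :: complex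
      by (simp add: power2_eq_square algebra_simps)
    then show ?thesis
      unfolding of_real_mult
      by (subst entry_from_u_inner[OF X[OF that], of a b], subst entry_from_u_inner[OF X[OF that],
        of a' b'])
  qed
  have "has_bochner_integral M (\<lambda>w. (?p (?P a b) (?P a' b') w - \<i> * ?p (?P a b) (?Q a' b') w - \<i>
    * ?p (?Q a b) (?P a' b') w
       - ?p (?Q a b) (?Q a' b') w) / (4 * ?N^2)) ((of_real (c * u_inner (?P a b) (?P a' b'))
          - \<i> * of_real (c * u_inner (?P a b) (?Q a' b')) - \<i> * of_real (c * u_inner (?Q a b) (?P a' b'))
       - of_real (c * u_inner (?Q a b) (?Q a' b'))) / (4 * ?N^2))"
    by (intro has_bochner_integral_divide_zero has_bochner_integral_diff
      has_bochner_integral_mult_right hbi u)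
  \<comment> \<open>The mixed pairings of \<open>u_real\<close> with \<open>u_imag\<close> vanish.
    The terms with a = a', b = b' cancel between the real and the imaginary pairing, and those with
    a = b', b = a' add up to -4N.\<close>
  also have "((of_real (c * u_inner (?P a b) (?P a' b'))
          - \<i> * of_real (c * u_inner (?P a b) (?Q a' b')) - \<i> * of_real (c * u_inner (?Q a b) (?P a' b'))
       - of_real (c * u_inner (?Q a b) (?Q a' b'))) / (4 * ?N^2)) =
       - of_real c / of_nat CARD('n) * of_bool (a = b' \<and> b = a')"
    unfolding u_inner_u_real[OF u_real_in_u] u_inner_u_real[OF u_imag_in_u]
       u_inner_u_imag[OF u_real_in_u] u_inner_u_imag[OF u_imag_in_u]
    by (cases "a = b'"; cases "b = a'"; cases "a = a'"; cases "b = b'")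
      (simp_all add: elementary_mat_nth power2_eq_square)
  finally show ?thesis
    by (subst has_bochner_integral_cong[OF refl eq refl])
qed

text \<open>As \<open>u_inner\<close> is N times the Frobenius product, a Frobenius orthonormal
  basis divided by sqrt N will do.\<close>

lemma exists_u_orthonormal_basis: "\<exists>B :: (complex^'n^'n) set. u_orthonormal_basis B"
proof -
  let ?r = "sqrt (real CARD('n))"
  obtain B :: "(complex^'n^'n) set" where B: "B \<subseteq> u_algebra" "pairwise orthogonal B"
    "\<And>x. x \<in> B \<Longrightarrow> norm x = 1" "independent B" "span B = u_algebra"
    using orthonormal_basis_subspace[OF subspace_u_algebra] by metis
  let ?B = "(\<lambda>x. x /\<^sub>R ?r) ` B"
  have "span ?B = u_algebra"
    using span_image_scale[of B "\<lambda>_. inverse ?r"] B(5) finiteI_independent[OF B(4)] by auto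
  moreover have "?B \<subseteq> u_algebra"
    using B(1) subspace_u_algebra subspace_mul by blast
  moreover have "u_inner x y = (if x = y then 1 else 0)" if "x \<in> ?B" "y \<in> ?B" for x y
  proof -
    from that obtain x' y' where xy: "x' \<in> B" "y' \<in> B" "x = x' /\<^sub>R ?r" "y = y' /\<^sub>R ?r" by auto
    have "y \<in> u_algebra" using that(2) \<open>?B \<subseteq> u_algebra\<close> by auto
    then have "u_inner x y = x' \<bullet> y'"
      by (simp add: u_inner_eq_inner xy(3,4) field_simps flip: real_sqrt_mult)
    also have "\<dots> = (if x' = y' then 1 else 0)"
      using B(2,3) xy(1,2) by (auto simp: pairwise_def orthogonal_def norm_eq_1)
    finally show ?thesis using xy(3,4) by auto
  qed
  ultimately show ?thesis
    unfolding u_orthonormal_basis_def using finiteI_independent[OF B(4)]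
    by (intro exI[of _ ?B]) simp
qed

text \<open>Parseval's identity says that counting measure on an orthonormal basis has the
  covariance of a Brownian increment over unit time. Hence the sum of x_ab x_cd is -1/N when a = d
  and b = c, and summing over b = c gives -Id, whichever basis \<open>SOME\<close> selects.\<close>

lemma u_casimir_eq: "u_casimir = - (mat 1 :: complex^'n^'n)"
proof -
  define B where "B = (SOME B :: (complex^'n^'n) set. u_orthonormal_basis B)"
  have "u_orthonormal_basis B"
    unfolding B_def using exists_u_orthonormal_basis by (rule someI_ex)
  then have B: "finite B" "B \<subseteq> u_algebra" "span B = u_algebra"
    "\<And>x y. x \<in> B \<Longrightarrow> y \<in> B \<Longrightarrow> u_inner x y = (if x = y then 1 else 0)"
    by (auto simp: u_orthonormal_basis_def)
  \<comment> \<open>Parseval's identity, proved by expanding \<open>Y\<close> in the basis and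
    identifying its coefficients as \<open>u_inner Y x\<close>.\<close>
  have comb: "(\<Sum>x\<in>B. u_inner X x * u_inner Y x) = u_inner X Y"
    if XY: "X \<in> u_algebra" "Y \<in> u_algebra" for X Y :: "complex^'n^'n"
  proof -
    obtain r where r: "Y = (\<Sum>x\<in>B. r x *\<^sub>R x)"
      using XY(2) unfolding B(3)[symmetric] span_finite[OF B(1)] by auto
    have sym: "u_inner Z y = u_inner y Z" if "Z \<in> u_algebra" "y \<in> u_algebra" for Z y :: "complex^'n^'n"
      using that by (simp add: u_inner_eq_inner inner_commute)
    have lin: "u_inner Z Y = (\<Sum>x\<in>B. r x * u_inner Z x)" if Z: "Z \<in> u_algebra" for Z
    proof -
      have "u_inner Z Y = (\<Sum>x\<in>B. r x * (real CARD('n) * (Z \<bullet> x)))"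
        by (simp add: u_inner_eq_inner \<open>Y \<in> u_algebra\<close>)
          (simp add: r inner_sum_right sum_distrib_left algebra_simps)
      also have "\<dots> = (\<Sum>x\<in>B. r x * u_inner Z x)"
        using B(2) by (intro sum.cong refl) (auto simp: u_inner_eq_inner)
      finally show ?thesis .
    qed
    have "u_inner Y x = r x" if "x \<in> B" for x
    proof -
      have "u_inner Y x = u_inner x Y" using that B(2) \<open>Y \<in> u_algebra\<close> sym by auto
      also have "\<dots> = (\<Sum>y\<in>B. if y = x then r x else 0)"
        using that B(2) by (subst lin) (auto intro!: sum.cong simp: B(4))
      finally show ?thesis using that B(1) by simp
    qed
    then show ?thesis
      using lin[OF XY(1)] by (simp add: mult.commute)
  qed
  have sum: "(\<Sum>x\<in>B. x $ a $ b * x $ c $ d) = - 1 / of_nat CARD('n) * of_bool (a = d \<and> b = c)" for a b c d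
  proof -
    have "has_bochner_integral (count_space B) (\<lambda>w. w $ a $ b * w $ c $ d)
         (- of_real 1 / of_nat CARD('n) * of_bool (a = d \<and> b = c))"
      by (rule entry_covariance)
        (use B comb in \<open>auto simp: integrable_count_space lebesgue_integral_count_space_finite\<close>)
    then show ?thesis
      by (simp add: has_bochner_integral_iff lebesgue_integral_count_space_finite B(1))
  qed
  have "(\<Sum>x\<in>B. x ** x) $ a $ d = - mat 1 $ a $ d" for a d
  proof -
    have "(\<Sum>x\<in>B. x ** x) $ a $ d = (\<Sum>b\<in>UNIV. \<Sum>x\<in>B. x $ a $ b * x $ b $ d)"
      by (simp add: matrix_matrix_mult_def sum_component) (rule sum.swap)
    also have "\<dots> = - of_bool (a = d)"
      by (simp add: sum)
    finally show ?thesis by (simp add: mat_def)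
  qed
  then show ?thesis
    unfolding u_casimir_def B_def[symmetric] by (simp add: vec_eq_iff)
qed

section \<open>Gaussian moments\<close>

abbreviation square_integrable :: "'w measure \<Rightarrow> ('w \<Rightarrow> 'b::real_normed_vector) \<Rightarrow> bool" where
  "square_integrable M f \<equiv> integrable M (\<lambda>w. (norm (f w))\<^sup>2)"

lemma square_integrable_mult:
  fixes f g :: "'w \<Rightarrow> complex"
  assumes [measurable]: "f \<in> borel_measurable M" "g \<in> borel_measurable M"
    and "square_integrable M f" "square_integrable M g"
  shows "integrable M (\<lambda>w. f w * g w)"
proof (rule Bochner_Integration.integrable_bound)
  show "integrable M (\<lambda>w. (cmod (f w))\<^sup>2 + (cmod (g w))\<^sup>2)"
    using assms by simp
  show "AE w in M. norm (f w * g w) \<le> norm ((cmod (f w))\<^sup>2 + (cmod (g w))\<^sup>2)"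
  proof (rule AE_I2)
    fix w
    have "2 * (cmod (f w) * cmod (g w)) \<le> (cmod (f w))\<^sup>2 + (cmod (g w))\<^sup>2"
      using sum_squares_bound[of "cmod (f w)" "cmod (g w)"] by (simp add: mult.assoc)
    moreover have "0 \<le> cmod (f w) * cmod (g w)" by simp
    ultimately show "norm (f w * g w) \<le> norm ((cmod (f w))\<^sup>2 + (cmod (g w))\<^sup>2)"
      unfolding norm_mult real_norm_def by linarith
  qed
qed simp

definition abs_normal_moment :: "nat \<Rightarrow> real" where
  "abs_normal_moment k = (\<integral>x. std_normal_density x * \<bar>x\<bar> ^ k \<partial>lborel)"

lemma abs_normal_moment_nonneg: "0 \<le> abs_normal_moment k"
  unfolding abs_normal_moment_def by (intro integral_nonneg_AE AE_I2) (simp add: normal_density_nonneg)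

text \<open>The standard deviation is expressed through the second moment, so that one formula
  covers the degenerate and the nondegenerate case and known covariances can be inserted
  directly.\<close>

lemma centered_gaussian_moments:
  assumes "prob_space M" and X: "centered_gaussian M X"
  shows "integrable M (\<lambda>w. \<bar>X w\<bar> ^ k)" "integrable M X" "(\<integral>w. X w \<partial>M) = 0"
    "(\<integral>w. \<bar>X w\<bar> ^ k \<partial>M) = abs_normal_moment k * sqrt (\<integral>w. (X w)\<^sup>2 \<partial>M) ^ k"
proof -
  interpret prob_space M by fact
  have [measurable]: "X \<in> borel_measurable M"
    using X by (simp add: centered_gaussian_def)
  have "integrable M (\<lambda>w. \<bar>X w\<bar> ^ k) \<and> integrable M X \<and> (\<integral>w. X w \<partial>M) = 0 \<and>
    (\<integral>w. \<bar>X w\<bar> ^ k \<partial>M) = abs_normal_moment k * sqrt (\<integral>w. (X w)\<^sup>2 \<partial>M) ^ k"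
  proof (cases "AE w in M. X w = 0")
    case True
    have 1: "has_bochner_integral M (\<lambda>w. \<bar>X w\<bar> ^ j) (0 ^ j)" for j
    proof -
      have "AE w in M. \<bar>X w\<bar> ^ j = 0 ^ j" using True by eventually_elim simp
      moreover have "has_bochner_integral M (\<lambda>w. 0 ^ j :: real) (0 ^ j)"
        by (simp add: has_bochner_integral_iff prob_space)
      ultimately show ?thesis
        by (subst has_bochner_integral_cong_AE) auto
    qed
    have 2: "has_bochner_integral M X 0"
      using True by (subst has_bochner_integral_cong_AE[where g = "\<lambda>_. 0"]) auto
    \<comment> \<open>For an almost surely zero variable and k = 0, both sides are 1 because
      \<open>0 ^ 0 = 1\<close>; this uses the normalisation of the density.\<close>
    have "abs_normal_moment 0 = 1"
      using integral_normal_density[of 1 0] by (simp add: abs_normal_moment_def)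
    with 1[of k] 1[of 2] 2 show ?thesis
      by (cases k) (auto simp: has_bochner_integral_iff)
  next
    case False
    then obtain \<sigma> where s: "\<sigma> > 0" "distributed M lborel X (normal_density 0 \<sigma>)"
      using X by (auto simp: centered_gaussian_def)
    then have d: "distributed M lborel (\<lambda>w. X w / \<sigma>) std_normal_density"
      using normal_standard_normal_convert[of \<sigma> X 0] by simp
    have i: "integrable M (\<lambda>w. \<bar>X w / \<sigma>\<bar> ^ j) \<and> (\<integral>w. \<bar>X w / \<sigma>\<bar> ^ j \<partial>M) = abs_normal_moment j" for j
      using integrable_normal_moment_abs[of 1 0 j] distributed_integrable[OF d, of "\<lambda>x. \<bar>x\<bar> ^ j"]
        distributed_integral[OF d, of "\<lambda>x. \<bar>x\<bar> ^ j"]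
      by (simp add: abs_normal_moment_def normal_density_nonneg)
    have eq: "\<bar>X w\<bar> ^ j = \<sigma> ^ j * \<bar>X w / \<sigma>\<bar> ^ j" for w j
      using s(1) by (simp add: power_divide)
    have j: "integrable M (\<lambda>w. \<bar>X w\<bar> ^ j) \<and> (\<integral>w. \<bar>X w\<bar> ^ j \<partial>M) = \<sigma> ^ j * abs_normal_moment j" for j
      unfolding eq using i[of j] by simp
    have "abs_normal_moment 2 = 1"
      unfolding abs_normal_moment_def using integral_std_normal_moment_even[of 1]
        by (simp add: fact_numeral)
    with j[of 2] have "(\<integral>w. (X w)\<^sup>2 \<partial>M) = \<sigma>\<^sup>2" by simp
    with s(1) have "sqrt (\<integral>w. (X w)\<^sup>2 \<partial>M) = \<sigma>" by simp
    moreover have "integrable M X"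
      using normal_moment_nz_1[OF s(1), of 0] distributed_integrable[OF s(2), of "\<lambda>x. x"]
        by (simp add: has_bochner_integral_iff)
    moreover have "(\<integral>w. X w \<partial>M) = 0"
      using normal_moment_nz_1[OF s(1), of 0] distributed_integral[OF s(2), of "\<lambda>x. x"]
        by (simp add: has_bochner_integral_iff)
    ultimately show ?thesis using j[of k] by simp
  qed
  then show "integrable M (\<lambda>w. \<bar>X w\<bar> ^ k)" "integrable M X" "(\<integral>w. X w \<partial>M) = 0"
    "(\<integral>w. \<bar>X w\<bar> ^ k \<partial>M) = abs_normal_moment k * sqrt (\<integral>w. (X w)\<^sup>2 \<partial>M) ^ k"
    by auto
qed

section \<open>Increments of Brownian motion\<close>

lemma u_inner_diff_right: "u_inner x (a - b) = u_inner x a - u_inner x b"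
  by (simp add: u_inner_def trace_mult right_diff_distrib sum_subtractf)

lemma u_inner_zero_right [simp]: "u_inner x 0 = 0"
  by (simp add: u_inner_def trace_def)

lemma borel_measurable_entry [measurable (raw)]:
  fixes f :: "'w \<Rightarrow> complex^'n^'m"
  assumes "f \<in> borel_measurable M"
  shows "(\<lambda>w. f w $ a $ b) \<in> borel_measurable M"
proof -
  have "(\<lambda>A :: complex^'n^'m. A $ a $ b) \<in> borel_measurable borel"
    by (intro borel_measurable_continuous_onI continuous_intros)
  from measurable_compose[OF assms this] show ?thesis .
qed

text \<open>The value 4N is attained by \<open>u_imag a a\<close>; off the diagonal both pairings
  are 2N. A bound uniform in a, b is what makes the moment constant below independent of the
  entry.\<close>

lemma u_inner_diag_bound:
  "u_inner (u_real a b :: complex^'n^'n) (u_real a b) \<le> 4 * real CARD('n)"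
  "u_inner (u_imag a b) (u_imag a b :: complex^'n^'n) \<le> 4 * real CARD('n)"
  unfolding u_inner_u_real[OF u_real_in_u] u_inner_u_imag[OF u_imag_in_u]
  by (auto simp: elementary_mat_nth of_bool_def)

locale u_bm = prob_space M for M :: "'w measure" +
  fixes F :: "real \<Rightarrow> 'w measure" and K :: "real \<Rightarrow> 'w \<Rightarrow> complex^'n^'n"
  assumes filtration: "nonneg_filtration M F"
    and bm: "u_brownian_motion M F K"
begin

definition incr :: "real \<Rightarrow> real \<Rightarrow> 'w \<Rightarrow> complex^'n^'n" where
  "incr s t w = K t w - K s w"

lemma subalg: "0 \<le> s \<Longrightarrow> subalgebra M (F s)"
  using filtration by (simp add: nonneg_filtration_def)

lemma subalg_mono: "0 \<le> s \<Longrightarrow> s \<le> t \<Longrightarrow> subalgebra (F t) (F s)"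
  using filtration by (simp add: nonneg_filtration_def)

lemma measurable_F_M: "0 \<le> s \<Longrightarrow> f \<in> borel_measurable (F s) \<Longrightarrow> f \<in> borel_measurable M"
  by (rule measurable_from_subalg[OF subalg])

lemma measurable_F_mono: "0 \<le> s \<Longrightarrow> s \<le> t \<Longrightarrow> f \<in> borel_measurable (F s) \<Longrightarrow> f \<in> borel_measurable (F t)"
  by (rule measurable_from_subalg[OF subalg_mono])

lemma K_measurable_F: "0 \<le> s \<Longrightarrow> s \<le> t \<Longrightarrow> K s \<in> borel_measurable (F t)"
  using bm measurable_F_mono[of s t] by (auto simp: u_brownian_motion_def)

lemma incr_measurable_F: "0 \<le> r \<Longrightarrow> r \<le> s \<Longrightarrow> s \<le> t \<Longrightarrow> incr r s \<in> borel_measurable (F t)"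
  unfolding incr_def[abs_def] using K_measurable_F[of r t] K_measurable_F[of s t] by simp

lemma incr_measurable: "0 \<le> r \<Longrightarrow> r \<le> s \<Longrightarrow> incr r s \<in> borel_measurable M"
  using incr_measurable_F[of r s s] measurable_F_M[of s] by simp

lemma K_in_u: "0 \<le> t \<Longrightarrow> w \<in> space M \<Longrightarrow> K t w \<in> u_algebra"
  using bm by (auto simp: u_brownian_motion_def)

lemma incr_in_u: "0 \<le> s \<Longrightarrow> s \<le> t \<Longrightarrow> w \<in> space M \<Longrightarrow> incr s t w \<in> u_algebra"
  unfolding incr_def by (intro subspace_diff[OF subspace_u_algebra] K_in_u) auto

lemma gaussian_combination:
  "finite S \<Longrightarrow> S \<subseteq> {0..} \<times> u_algebra \<Longrightarrow>
    centered_gaussian M (\<lambda>w. \<Sum>p\<in>S. c p * u_inner (snd p) (K (fst p) w))"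
  using bm unfolding u_brownian_motion_def by blast

lemma K_gaussian:
  assumes "0 \<le> t" "x \<in> u_algebra"
  shows "centered_gaussian M (\<lambda>w. u_inner x (K t w))"
  using gaussian_combination[of "{(t, x)}" "\<lambda>_. 1"] assms by simp

lemma incr_gaussian:
  assumes "0 \<le> s" "s \<le> t" "x \<in> u_algebra"
  shows "centered_gaussian M (\<lambda>w. u_inner x (incr s t w))"
\<comment> \<open>For s = t the index set {(t, x), (s, x)} has a single element, with coefficient 1,
  and would not represent the difference; the empty sum gives the zero variable instead.\<close>
proof (cases "s = t")
  case True
  then show ?thesis
    using gaussian_combination[of "{}"] by (simp add: incr_def u_inner_diff_right)
next
  case False
  then show ?thesis
    using gaussian_combination[of "{(t, x), (s, x)}" "\<lambda>p. if fst p = t then 1 else - 1"] assms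
    by (simp add: incr_def u_inner_diff_right)
qed

text \<open>The covariance condition on \<open>K\<close> gives the value of a Bochner integral,
  which by itself says nothing about integrability. Integrability comes from the Gaussian second
  moments.\<close>

lemma K_product_integrable:
  assumes "0 \<le> s" "0 \<le> t" "x \<in> u_algebra" "y \<in> u_algebra"
  shows "integrable M (\<lambda>w. u_inner x (K s w) * u_inner y (K t w))"
proof -
  have g: "(\<lambda>w. u_inner x (K s w)) \<in> borel_measurable M" "integrable M (\<lambda>w. (u_inner x (K s w))\<^sup>2)"
    if "0 \<le> s" "x \<in> u_algebra" for x s
    using K_gaussian[OF that] centered_gaussian_moments(1)[OF prob_space_axioms K_gaussian[OF that], of 2]
    by (auto simp: centered_gaussian_def)
  have "integrable M (\<lambda>w. complex_of_real (u_inner x (K s w)) * of_real (u_inner y (K t w)))"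
    by (rule square_integrable_mult) (use g assms in auto)
  then show ?thesis
    unfolding of_real_mult[symmetric] by (subst (asm) complex_of_real_integrable_eq)
qed

lemma incr_product:
  assumes st: "0 \<le> s" "s \<le> t" and xy: "x \<in> u_algebra" "y \<in> u_algebra"
  shows "integrable M (\<lambda>w. u_inner x (incr s t w) * u_inner y (incr s t w))"
    "(\<integral>w. u_inner x (incr s t w) * u_inner y (incr s t w) \<partial>M) = (t - s) * u_inner x y"
proof -
  have eq: "u_inner x (incr s t w) * u_inner y (incr s t w) =
      u_inner x (K t w) * u_inner y (K t w) - u_inner x (K t w) * u_inner y (K s w)
    - u_inner x (K s w) * u_inner y (K t w) + u_inner x (K s w) * u_inner y (K s w)" for w
    by (simp add: incr_def u_inner_diff_right algebra_simps)
  have cov: "(\<integral>w. u_inner x (K t w) * u_inner y (K s w) \<partial>M) = min t s * u_inner x y"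
    if "0 \<le> s" "0 \<le> t" for s t
    using bm that xy unfolding u_brownian_motion_def by blast
  show "integrable M (\<lambda>w. u_inner x (incr s t w) * u_inner y (incr s t w))"
    unfolding eq using st xy by (intro Bochner_Integration.integrable_add
      Bochner_Integration.integrable_diff K_product_integrable) auto
  show "(\<integral>w. u_inner x (incr s t w) * u_inner y (incr s t w) \<partial>M) = (t - s) * u_inner x y"
    unfolding eq using st xy
    by (simp add: cov K_product_integrable algebra_simps)
qed

lemma incr_covariance:
  assumes "0 \<le> s" "s \<le> t"
  shows "has_bochner_integral M (\<lambda>w. incr s t w $ a $ b * incr s t w $ a' $ b')
    (- of_real (t - s) / of_nat CARD('n) * of_bool (a = b' \<and> b = a'))"
  by (rule entry_covariance) (use assms incr_in_u incr_product in auto)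

lemma incr_cnj:
  assumes "0 \<le> s" "s \<le> t" "w \<in> space M"
  shows "cnj (incr s t w $ a $ b) = - incr s t w $ b $ a"
  using incr_in_u[OF assms] by (rule u_algebraD)

lemma incr_entry_measurable:
  assumes "0 \<le> s" "s \<le> t"
  shows "(\<lambda>w. incr s t w $ a $ b) \<in> borel_measurable M"
  using incr_measurable[OF assms] by (rule borel_measurable_entry)

lemma incr_mean:
  assumes "0 \<le> s" "s \<le> t"
  shows "has_bochner_integral M (\<lambda>w. incr s t w $ a $ b) 0"
proof -
  let ?P = "u_real a b :: complex^'n^'n"
  let ?Q = "u_imag a b :: complex^'n^'n"
  have g: "has_bochner_integral M (\<lambda>w. complex_of_real (u_inner x (incr s t w))) 0" if "x \<in> u_algebra" for x
    using centered_gaussian_moments(2,3)[OF prob_space_axioms incr_gaussian[OF assms that]]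
      has_bochner_integral_of_real[of M "\<lambda>w. u_inner x (incr s t w)" 0, where 'a = complex]
    by (simp add: has_bochner_integral_iff)
  have "has_bochner_integral M (\<lambda>w. (\<i> * of_real (u_inner ?Q (incr s t w))
      - of_real (u_inner ?P (incr s t w))) / (2 * of_nat CARD('n))) ((\<i> * 0 - 0) / (2 * of_nat CARD('n)))"
    by (intro has_bochner_integral_divide_zero has_bochner_integral_diff has_bochner_integral_mult_right g
        u_real_in_u u_imag_in_u)
  then show ?thesis
    by (subst has_bochner_integral_cong[OF refl entry_from_u_inner[OF incr_in_u[OF assms]] refl]) auto
qed

text \<open>Brownian scaling: the pairings are Gaussian with variance proportional to t - s, so
  their k-th absolute moments scale as \<open>sqrt (t - s) ^ k\<close>. The constant is uniform in
  the interval and in the entry.\<close>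

lemma incr_abs_moment:
  obtains C where "\<And>s t a b. 0 \<le> s \<Longrightarrow> s \<le> t \<Longrightarrow>
    integrable M (\<lambda>w. cmod (incr s t w $ a $ b) ^ k) \<and>
    (\<integral>w. cmod (incr s t w $ a $ b) ^ k \<partial>M) \<le> C * sqrt (t - s) ^ k"
proof
  fix s t :: real and a b :: 'n
  assume st: "0 \<le> s" "s \<le> t"
  let ?N = "real CARD('n)"
  let ?P = "u_real a b :: complex^'n^'n"
  let ?Q = "u_imag a b :: complex^'n^'n"
  define p where "p w = \<bar>u_inner ?P (incr s t w)\<bar>" for w
  define q where "q w = \<bar>u_inner ?Q (incr s t w)\<bar>" for w
  have int: "integrable M (\<lambda>w. \<bar>u_inner x (incr s t w)\<bar> ^ k)"
    and le: "(\<integral>w. \<bar>u_inner x (incr s t w)\<bar> ^ k \<partial>M) \<le> abs_normal_moment k * (sqrt (4 * ?N) ^ k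
      * sqrt (t - s) ^ k)"
    if "x \<in> u_algebra" "u_inner x x \<le> 4 * ?N" for x
  proof -
    note m = centered_gaussian_moments[OF prob_space_axioms incr_gaussian[OF st that(1)]]
    show "integrable M (\<lambda>w. \<bar>u_inner x (incr s t w)\<bar> ^ k)" by (rule m)
    have pos: "0 \<le> u_inner x x" using that(1) by (simp add: u_inner_eq_inner)
    have "sqrt ((t - s) * u_inner x x) \<le> sqrt (4 * ?N) * sqrt (t - s)"
      unfolding real_sqrt_mult[symmetric] using st that(2)
      by (subst mult.commute) (intro real_sqrt_le_mono mult_right_mono; simp)
    then have "sqrt ((t - s) * u_inner x x) ^ k \<le> sqrt (4 * ?N) ^ k * sqrt (t - s) ^ k"
      unfolding power_mult_distrib[symmetric] using st pos by (intro power_mono) auto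
    then show "(\<integral>w. \<bar>u_inner x (incr s t w)\<bar> ^ k \<partial>M) \<le> abs_normal_moment k * (sqrt (4 * ?N) ^ k
      * sqrt (t - s) ^ k)"
      unfolding m(4) using incr_product(2)[OF st that(1) that(1)]
      by (intro mult_left_mono abs_normal_moment_nonneg) (simp add: power2_eq_square)
  qed
  have b: "cmod (incr s t w $ a $ b) ^ k \<le> 2 ^ k * (p w ^ k + q w ^ k)" if "w \<in> space M" for w
  proof -
    have N: "2 * ?N \<ge> 1" using zero_less_card_finite[where 'a = 'n] by linarith
    have nn: "0 \<le> p w" "0 \<le> q w" by (auto simp: p_def q_def)
    have "cmod (incr s t w $ a $ b) \<le> (q w + p w) / (2 * ?N)"
      unfolding entry_from_u_inner[OF incr_in_u[OF st that], of a b] norm_divide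
      using norm_triangle_ineq4[of "\<i> * of_real (u_inner ?Q (incr s t w))"
        "of_real (u_inner ?P (incr s t w))"]
      by (auto simp: p_def q_def norm_mult intro!: divide_right_mono)
    also have "\<dots> \<le> (q w + p w) / 1"
      using N nn by (intro divide_left_mono) auto
    also have "\<dots> \<le> 2 * max (p w) (q w)" by simp
    finally have "cmod (incr s t w $ a $ b) ^ k \<le> (2 * max (p w) (q w)) ^ k"
      by (intro power_mono) auto
    also have "\<dots> = 2 ^ k * max (p w) (q w) ^ k" by (simp add: power_mult_distrib)
    also have "\<dots> \<le> 2 ^ k * (p w ^ k + q w ^ k)"
      using nn by (intro mult_left_mono) (auto simp: max_def)
    finally show ?thesis .
  qed
  have i: "integrable M (\<lambda>w. 2 ^ k * (p w ^ k + q w ^ k))"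
    unfolding p_def q_def
    by (intro integrable_mult_right Bochner_Integration.integrable_add int u_real_in_u u_imag_in_u
      u_inner_diag_bound)
  have I: "integrable M (\<lambda>w. cmod (incr s t w $ a $ b) ^ k)"
    using b incr_entry_measurable[OF st] by (intro Bochner_Integration.integrable_bound[OF i]) (auto
      intro!: AE_I2 intro: order_trans[OF _ abs_ge_self])
  have "(\<integral>w. cmod (incr s t w $ a $ b) ^ k \<partial>M) \<le> (\<integral>w. 2 ^ k * (p w ^ k + q w ^ k) \<partial>M)"
    using b by (intro integral_mono I i)
  also have "\<dots> = 2 ^ k * ((\<integral>w. p w ^ k \<partial>M) + (\<integral>w. q w ^ k \<partial>M))"
    unfolding p_def q_def
    by (subst integral_mult_right_zero, subst Bochner_Integration.integral_add) (intro int
      u_real_in_u u_imag_in_u u_inner_diag_bound refl)+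
  also have "\<dots> \<le> 2 ^ k * (abs_normal_moment k * (sqrt (4 * ?N) ^ k * sqrt (t - s) ^ k)
    + abs_normal_moment k * (sqrt (4 * ?N) ^ k * sqrt (t - s) ^ k))"
    unfolding p_def q_def
    by (intro mult_left_mono add_mono le u_real_in_u u_imag_in_u u_inner_diag_bound) simp
  also have "\<dots> = (2 ^ k * (2 * abs_normal_moment k * sqrt (4 * ?N) ^ k)) * sqrt (t - s) ^ k"
    by (simp add: algebra_simps)
  \<comment> \<open>The constant \<open>C\<close> of the \<open>obtains\<close> is left schematic
    until this goal instantiates it.\<close>
  finally show "integrable M (\<lambda>w. cmod (incr s t w $ a $ b) ^ k) \<and>
    (\<integral>w. cmod (incr s t w $ a $ b) ^ k \<partial>M) \<le> (2 ^ k * (2 * abs_normal_moment k * sqrt (4 * ?N) ^ k))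
      * sqrt (t - s) ^ k"
    using I by blast
qed

text \<open>The preimage families of \<open>f\<close> and of \<open>g\<close> composed with the
  increment lie inside the two independent families supplied by the definition of Brownian motion,
  so independence is inherited. Every later use of independence goes through this
  factorisation.\<close>

lemma indep_incr:
  fixes f :: "'w \<Rightarrow> complex"
  assumes st: "0 \<le> s" "s \<le> t" and f: "f \<in> borel_measurable (F s)"
    and [measurable]: "g \<in> borel_measurable borel"
    and int: "integrable M f" "integrable M (\<lambda>w. g (incr s t w))"
  shows "integrable M (\<lambda>w. f w * g (incr s t w))"
    "(\<integral>w. f w * g (incr s t w) \<partial>M) = (\<integral>w. f w \<partial>M) * (\<integral>w. g (incr s t w) \<partial>M)"
proof -
  note [measurable] = incr_measurable[OF st]
  have ind: "indep_set (sets (F s)) {incr s t -` A \<inter> space M | A. A \<in> sets borel}"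
    using bm st unfolding u_brownian_motion_def incr_def[abs_def] by blast
  have 1: "{f -` A \<inter> space M |A. A \<in> sets borel} \<subseteq> sets (F s)"
    using f subalg[OF st(1)] by (auto simp: subalgebra_def dest: measurable_sets)
  have 2: "{(\<lambda>w. g (incr s t w)) -` A \<inter> space M |A. A \<in> sets borel} \<subseteq> {incr s t -` A \<inter> space M | A.
    A \<in> sets borel}"
  proof safe
    fix A :: "complex set" assume "A \<in> sets borel"
    then have "g -` A \<in> sets borel" using measurable_sets[of g borel borel A] by simp
    then show "\<exists>B. (\<lambda>w. g (incr s t w)) -` A \<inter> space M = incr s t -` B \<inter> space M \<and> B \<in> sets borel"
      by (intro exI[of _ "g -` A"]) auto
  qed
  have "indep_var borel f borel (\<lambda>w. g (incr s t w))"
    unfolding indep_var_def indep_vars_def2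
  proof (intro conjI ballI)
    fix i show "random_variable (case_bool borel borel i) (case_bool f (\<lambda>w. g (incr s t w)) i)"
      using measurable_F_M[OF st(1) f] by (cases i) auto
  next
    show "indep_sets (\<lambda>i. {case_bool f (\<lambda>w. g (incr s t w)) i -` A \<inter> space M |A. A \<in> sets (case_bool
      borel borel i)}) UNIV"
      by (rule indep_sets_mono_sets[OF ind[unfolded indep_set_def]]) (use 1 2 in \<open>auto split: bool.split\<close>)
  qed
  then show "integrable M (\<lambda>w. f w * g (incr s t w))"
    "(\<integral>w. f w * g (incr s t w) \<partial>M) = (\<integral>w. f w \<partial>M) * (\<integral>w. g (incr s t w) \<partial>M)"
    using indep_var_integrable indep_var_lebesgue_integral int by blast+
qed

end

section \<open>The Ito isometry\<close>

text \<open>Measurability for Fubini only. Adaptedness is recorded separately, in the coefficients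
  of elementary integrands.\<close>

abbreviation jointly_measurable :: "'w measure \<Rightarrow> (real \<Rightarrow> 'w \<Rightarrow> 'b::topological_space) \<Rightarrow> bool" where
  "jointly_measurable M H \<equiv> (\<lambda>(s, w). H s w) \<in> borel_measurable (lborel \<Otimes>\<^sub>M M)"

text \<open>Values in \<open>ennreal\<close> make the estimates meaningful before finiteness is
  known.\<close>

abbreviation L2_sq :: "'w measure \<Rightarrow> ('w \<Rightarrow> 'b::real_normed_vector) \<Rightarrow> ennreal" where
  "L2_sq M f \<equiv> \<integral>\<^sup>+w. ennreal ((norm (f w))\<^sup>2) \<partial>M"

abbreviation cell :: "real \<Rightarrow> nat \<Rightarrow> real set" where
  "cell h i \<equiv> {real i * h<..real (Suc i) * h}"

lemma norm_add_sq_le: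
  fixes x y :: "'a::real_normed_vector"
  shows "(norm (x + y))\<^sup>2 \<le> 2 * (norm x)\<^sup>2 + 2 * (norm y)\<^sup>2"
proof -
  have "(norm (x + y))\<^sup>2 \<le> (norm x + norm y)\<^sup>2"
    by (intro power_mono norm_triangle_ineq) simp
  also have "\<dots> \<le> 2 * (norm x)\<^sup>2 + 2 * (norm y)\<^sup>2"
    using sum_squares_bound[of "norm x" "norm y"] by (simp add: power2_sum)
  finally show ?thesis .
qed

lemma ennreal_norm_add_sq_le:
  fixes x y :: "'a::real_normed_vector"
  shows "ennreal ((norm (x + y))\<^sup>2) \<le> 2 * ennreal ((norm x)\<^sup>2) + 2 * ennreal ((norm y)\<^sup>2)"
proof -
  have "ennreal ((norm (x + y))\<^sup>2) \<le> ennreal (2 * (norm x)\<^sup>2 + 2 * (norm y)\<^sup>2)"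
    by (intro ennreal_leI norm_add_sq_le)
  also have "\<dots> = 2 * ennreal ((norm x)\<^sup>2) + 2 * ennreal ((norm y)\<^sup>2)"
    by (simp add: ennreal_plus ennreal_mult)
  finally show ?thesis .
qed

lemma borel_measurable_cnj [measurable (raw)]:
  assumes "f \<in> borel_measurable M"
  shows "(\<lambda>w. cnj (f w)) \<in> borel_measurable M"
  by (rule measurable_compose[OF assms]) (intro borel_measurable_continuous_onI continuous_intros)

lemma has_bochner_integral_cong':
  assumes "has_bochner_integral M f x" "\<And>w. w \<in> space M \<Longrightarrow> g w = f w" "y = x"
  shows "has_bochner_integral M g y"
  using assms has_bochner_integral_cong[of M M g f y x] by simp

lemma cnj_of_bool [simp]: "cnj (of_bool P) = of_bool P"
  by (cases P) auto

lemma inner_matrix: "A \<bullet> B = Re (\<Sum>i\<in>UNIV. \<Sum>j\<in>UNIV. A $ i $ j * cnj (B $ i $ j))"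
  for A B :: "complex^'n^'m"
  by (simp add: inner_vec_def inner_complex_def)

lemma norm_entry_le: "cmod (A $ i $ j) \<le> norm A" for A :: "complex^'n^'m"
  using Finite_Cartesian_Product.norm_nth_le[of A i] Finite_Cartesian_Product.norm_nth_le[of "A $ i"
    j] by linarith

lemma borel_measurable_matrix:
  fixes f :: "'w \<Rightarrow> complex^'n^'m"
  assumes "\<And>a b. (\<lambda>w. f w $ a $ b) \<in> borel_measurable M"
  shows "f \<in> borel_measurable M"
proof (subst borel_measurable_euclidean_space, intro ballI)
  fix B :: "complex^'n^'m" assume "B \<in> Basis"
  show "(\<lambda>x. f x \<bullet> B) \<in> borel_measurable M"
    unfolding inner_matrix using assms by measurable
qed

lemma borel_measurable_matrix_mult [measurable (raw)]:
  fixes f :: "'w \<Rightarrow> complex^'n^'m" and g :: "'w \<Rightarrow> complex^'k^'n"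
  assumes [measurable]: "f \<in> borel_measurable M" "g \<in> borel_measurable M"
  shows "(\<lambda>w. f w ** g w) \<in> borel_measurable M"
  by (rule borel_measurable_matrix) (simp add: matrix_matrix_mult_def)

section \<open>Covariance of weighted increments over arbitrary intervals\<close>

context u_bm
begin

text \<open>The length of the intersection of \<open>{a<..b}\<close> and
  \<open>{c<..d}\<close>.\<close>

definition overlap :: "real \<Rightarrow> real \<Rightarrow> real \<Rightarrow> real \<Rightarrow> real" where
  "overlap a b c d = max 0 (min b d - max a c)"

text \<open>Independence replaces a fourth moment assumption: \<open>|\<xi>|^2\<close> and the
  squared modulus of the increment are integrable and independent, hence so is their product
  integrable.\<close>

lemma mult_incr_square_integrable:
  fixes \<xi> :: "'w \<Rightarrow> complex"
  assumes "0 \<le> a" "a \<le> b" and \<xi>: "\<xi> \<in> borel_measurable (F a)" "square_integrable M \<xi>"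
  shows "square_integrable M (\<lambda>w. \<xi> w * incr a b w $ j $ k)"
proof -
  obtain C where "square_integrable M (\<lambda>w. incr a b w $ j $ k)"
    using incr_abs_moment[of 2] assms by metis
  then have "integrable M (\<lambda>w. complex_of_real ((cmod (\<xi> w))\<^sup>2)
    * complex_of_real ((cmod (incr a b w $ j $ k))\<^sup>2))"
    using assms by (intro indep_incr[where g = "\<lambda>x. complex_of_real ((cmod (x $ j $ k))\<^sup>2)"])
      (auto simp del: of_real_power)
  then show ?thesis
    unfolding of_real_mult[symmetric] by (subst (asm) complex_of_real_integrable_eq) (simp add:
      norm_mult power_mult_distrib)
qed

lemma incr_add: "incr a b w + incr b c w = incr a c w"
  by (simp add: incr_def)

lemma product_integrable:
  fixes \<xi> \<eta> :: "'w \<Rightarrow> complex"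
  assumes ab: "0 \<le> a" and \<xi>: "\<xi> \<in> borel_measurable (F a)" "square_integrable M \<xi>"
    and cd: "0 \<le> c" and \<eta>: "\<eta> \<in> borel_measurable (F c)" "square_integrable M \<eta>"
  shows "integrable M (\<lambda>w. \<xi> w * cnj (\<eta> w))"
  by (rule square_integrable_mult) (use assms measurable_F_M[OF ab \<xi>(1)] measurable_F_M[OF cd \<eta>(1)]
    in \<open>auto\<close>)

text \<open>All factors except the last increment are measurable at time c, and that increment is
  centered and independent of \<open>F c\<close>.\<close>

lemma disjoint_increments:
  fixes \<xi> \<eta> :: "'w \<Rightarrow> complex"
  assumes ab: "0 \<le> a" "a \<le> b" "b \<le> c" "c \<le> d"
    and \<xi>: "\<xi> \<in> borel_measurable (F a)" "square_integrable M \<xi>"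
    and \<eta>: "\<eta> \<in> borel_measurable (F c)" "square_integrable M \<eta>"
  shows "has_bochner_integral M (\<lambda>w. \<xi> w * incr a b w $ j $ k * cnj (\<eta> w * incr c d w $ l $ m)) 0"
proof -
  have m: "(\<lambda>w. \<xi> w * incr a b w $ j $ k) \<in> borel_measurable (F c)"
    using measurable_F_mono[OF _ _ \<xi>(1), of c] incr_measurable_F[of a b c] ab
    by (intro borel_measurable_times borel_measurable_entry) auto
  have "integrable M (\<lambda>w. (\<xi> w * incr a b w $ j $ k) * cnj (\<eta> w))"
    by (rule product_integrable[OF _ m _ _ \<eta>]) (use mult_incr_square_integrable ab \<xi> in auto)
  moreover have "has_bochner_integral M (\<lambda>w. cnj (incr c d w $ l $ m)) (cnj 0)"
    using incr_mean[of c d l m] ab by (intro has_bochner_integral_cnj) auto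
  moreover have "(\<lambda>w. (\<xi> w * incr a b w $ j $ k) * cnj (\<eta> w)) \<in> borel_measurable (F c)"
    using m \<eta> by measurable
  ultimately have "has_bochner_integral M (\<lambda>w. ((\<xi> w * incr a b w $ j $ k) * cnj (\<eta> w))
    * cnj (incr c d w $ l $ m)) 0"
    using indep_incr[of c d "\<lambda>w. (\<xi> w * incr a b w $ j $ k) * cnj (\<eta> w)" "\<lambda>x. cnj (x $ l $ m)"] ab
    by (auto simp add: has_bochner_integral_iff)
  then show ?thesis by (simp add: mult.assoc)
qed

text \<open>The longer increment is split at b. Over the common interval the coefficients factor out
  by independence and leave the covariance of the entries; the rest is a product of disjoint
  increments.\<close>

lemma common_start_increments:
  fixes \<xi> \<eta> :: "'w \<Rightarrow> complex"
  assumes ab: "0 \<le> c" "c \<le> b" "b \<le> d"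
    and \<xi>: "\<xi> \<in> borel_measurable (F c)" "square_integrable M \<xi>"
    and \<eta>: "\<eta> \<in> borel_measurable (F c)" "square_integrable M \<eta>"
  shows "has_bochner_integral M (\<lambda>w. \<xi> w * incr c b w $ j $ k * cnj (\<eta> w * incr c d w $ l $ m))
     (of_real (b - c) * (\<integral>w. \<xi> w * cnj (\<eta> w) \<partial>M) * of_bool (j = l \<and> k = m) / of_nat CARD('n))"
proof -
  have cov: "has_bochner_integral M (\<lambda>w. incr c b w $ j $ k * cnj (incr c b w $ l $ m))
      (of_real (b - c) * of_bool (j = l \<and> k = m) / of_nat CARD('n))"
  proof -
    have "has_bochner_integral M (\<lambda>w. - (incr c b w $ j $ k * incr c b w $ m $ l))
        (- (- of_real (b - c) / of_nat CARD('n) * of_bool (j = l \<and> k = m)))"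
      by (intro has_bochner_integral_minus incr_covariance ab)
    then show ?thesis
      by (rule has_bochner_integral_cong') (simp_all add: incr_cnj ab diff_divide_distrib)
  qed
  have 1: "has_bochner_integral M (\<lambda>w. (\<xi> w * cnj (\<eta> w)) * (incr c b w $ j $ k * cnj (incr c b w $ l $ m)))
     (of_real (b - c) * (\<integral>w. \<xi> w * cnj (\<eta> w) \<partial>M) * of_bool (j = l \<and> k = m) / of_nat CARD('n))"
  proof -
    have "(\<lambda>x. x $ j $ k * cnj (x $ l $ m)) \<in> borel_measurable (borel :: (complex^'n^'n) measure)"
      by measurable
    note ind = indep_incr[OF ab(1,2) _ this product_integrable[OF ab(1) \<xi> ab(1) \<eta>]]
    have "(\<lambda>w. \<xi> w * cnj (\<eta> w)) \<in> borel_measurable (F c)"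
      using \<xi>(1) \<eta>(1) by measurable
    note m = this
    have c: "integrable M (\<lambda>w. incr c b w $ j $ k * cnj (incr c b w $ l $ m))"
      "(\<integral>w. incr c b w $ j $ k * cnj (incr c b w $ l $ m) \<partial>M) = of_real (b - c) * of_bool (j = l \<and> k
        = m) / of_nat CARD('n)"
      using cov by (auto simp only: has_bochner_integral_iff)
    from ind[OF m c(1)] c(2) have "has_bochner_integral M (\<lambda>w. (\<xi> w * cnj (\<eta> w))
      * (incr c b w $ j $ k * cnj (incr c b w $ l $ m)))
      ((\<integral>w. \<xi> w * cnj (\<eta> w) \<partial>M) * (of_real (b - c) * of_bool (j = l \<and> k = m) / of_nat CARD('n)))"
      unfolding has_bochner_integral_iff by simp
    then show ?thesis
      by (rule has_bochner_integral_cong') (simp_all only: mult_ac times_divide_eq_right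
        times_divide_eq_left)
  qed
  have 2: "has_bochner_integral M (\<lambda>w. \<xi> w * incr c b w $ j $ k * cnj (\<eta> w * incr b d w $ l $ m)) 0"
    by (rule disjoint_increments) (use ab \<xi> \<eta> measurable_F_mono in auto)
  show ?thesis
    using has_bochner_integral_add[OF 1 2]
    by (rule has_bochner_integral_cong') (simp_all add: incr_add[of c b _ d, symmetric] algebra_simps)
qed

lemma has_bochner_integral_swap_cnj:
  assumes "has_bochner_integral M (\<lambda>w. f w * cnj (g w)) z"
  shows "has_bochner_integral M (\<lambda>w. g w * cnj (f w)) (cnj z)"
  using has_bochner_integral_cnj[OF assms] by (simp add: mult.commute)

lemma integral_swap_cnj: "(\<integral>w. g w * cnj (f w) \<partial>M) = cnj (\<integral>w. f w * cnj (g w) \<partial>M)"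
  by (subst Bochner_Integration.integral_cnj[symmetric]) (simp add: mult.commute)

text \<open>The polarised Ito isometry at the level of entries. Two arbitrary intervals are reduced
  to a disjoint pair and a pair with a common left end by cutting at the later left end; exchanging
  the two factors costs one conjugation.\<close>

lemma increment_pairing:
  fixes \<xi> \<eta> :: "'w \<Rightarrow> complex"
  assumes ab: "0 \<le> a" "a \<le> b"
    and \<xi>: "\<xi> \<in> borel_measurable (F a)" "square_integrable M \<xi>"
    and cd: "0 \<le> c" "c \<le> d"
    and \<eta>: "\<eta> \<in> borel_measurable (F c)" "square_integrable M \<eta>"
  shows "has_bochner_integral M (\<lambda>w. \<xi> w * incr a b w $ j $ k * cnj (\<eta> w * incr c d w $ l $ m))
     (of_real (overlap a b c d) * (\<integral>w. \<xi> w * cnj (\<eta> w) \<partial>M) * of_bool (j = l \<and> k = m) / of_nat CARD('n))"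
proof -
  \<comment> \<open>Common left end, with either interval the longer one; the case d < b follows
    from the other by exchanging the factors.\<close>
  have same: "has_bochner_integral M (\<lambda>w. \<xi> w * incr c b w $ j $ k * cnj (\<eta> w * incr c d w $ l $ m))
     (of_real (min b d - c) * (\<integral>w. \<xi> w * cnj (\<eta> w) \<partial>M) * of_bool (j = l \<and> k = m) / of_nat CARD('n))"
    if c: "0 \<le> c" "c \<le> b" "c \<le> d"
    and \<xi>: "\<xi> \<in> borel_measurable (F c)" "square_integrable M \<xi>"
    and \<eta>: "\<eta> \<in> borel_measurable (F c)" "square_integrable M \<eta>"
    for b c d j k l m and \<xi> \<eta> :: "'w \<Rightarrow> complex"
  proof (cases "b \<le> d")
    case True
    then show ?thesis using common_start_increments[of c b d \<xi> \<eta>] c \<xi> \<eta> by (simp add: min_def)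
  next
    case False
    have e: "(l = j \<and> m = k) = (j = l \<and> k = m)" by auto
    show ?thesis
      using False c \<xi> \<eta>
      by (intro has_bochner_integral_cong'[OF has_bochner_integral_swap_cnj[OF
        common_start_increments[of c d b \<eta> \<xi> l m j k]]])
        (simp_all only: min_def e refl complex_cnj_mult complex_cnj_divide cnj_of_bool
          complex_cnj_complex_of_real
          complex_cnj_of_nat if_False integral_swap_cnj[of \<xi> \<eta>, symmetric])
  qed
  \<comment> \<open>Now a \<le> c: the part of the first increment before c is orthogonal to the
    second term, and the part after c starts together with it.\<close>
  have main: "has_bochner_integral M (\<lambda>w. \<xi> w * incr a b w $ j $ k * cnj (\<eta> w * incr c d w $ l $ m))
     (of_real (overlap a b c d) * (\<integral>w. \<xi> w * cnj (\<eta> w) \<partial>M) * of_bool (j = l \<and> k = m) / of_nat CARD('n))"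
    if ab: "0 \<le> a" "a \<le> b" "c \<le> d" "a \<le> c"
    and \<xi>: "\<xi> \<in> borel_measurable (F a)" "square_integrable M \<xi>"
    and \<eta>: "\<eta> \<in> borel_measurable (F c)" "square_integrable M \<eta>"
    for a b c d j k l m and \<xi> \<eta> :: "'w \<Rightarrow> complex"
  proof (cases "b \<le> c")
    case True
    then show ?thesis
      using ab \<xi> \<eta>
      by (intro has_bochner_integral_cong'[OF disjoint_increments[of a b c d \<xi> \<eta> j k l m]]) (auto
        simp: overlap_def)
  next
    case False
    have 1: "has_bochner_integral M (\<lambda>w. \<xi> w * incr a c w $ j $ k * cnj (\<eta> w * incr c d w $ l $ m)) 0"
      by (rule disjoint_increments) (use ab \<xi> \<eta> in auto)
    have 2: "has_bochner_integral M (\<lambda>w. \<xi> w * incr c b w $ j $ k * cnj (\<eta> w * incr c d w $ l $ m))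
     (of_real (min b d - c) * (\<integral>w. \<xi> w * cnj (\<eta> w) \<partial>M) * of_bool (j = l \<and> k = m) / of_nat CARD('n))"
      by (rule same) (use ab False \<xi> \<eta> measurable_F_mono[of a c] in auto)
    have ov: "overlap a b c d = min b d - c" using False ab by (auto simp: overlap_def)
    then show ?thesis
      by (intro has_bochner_integral_cong'[OF has_bochner_integral_add[OF 1 2]])
        (simp_all add: incr_add[of a c _ b, symmetric] ov distrib_left distrib_right mult.assoc)
  qed
  show ?thesis
  proof (cases "a \<le> c")
    case True
    then show ?thesis using main assms by blast
  next
    case False
    have e: "(l = j \<and> m = k) = (j = l \<and> k = m)" by auto
    have o: "overlap c d a b = overlap a b c d" by (simp add: overlap_def min.commute max.commute)
    show ?thesis
      using False assms
      by (intro has_bochner_integral_cong'[OF has_bochner_integral_swap_cnj[OF main[of c d a b \<eta> \<xi> l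
        m j k]]])
        (simp_all only: o e refl complex_cnj_mult complex_cnj_divide cnj_of_bool complex_cnj_complex_of_real
          complex_cnj_of_nat integral_swap_cnj[of \<xi> \<eta>, symmetric])
  qed
qed

end

section \<open>The polarised isometry for elementary integrands\<close>

context u_bm
begin

text \<open>An integrand is generated together with its stochastic integral, so no well-definedness
  of the integral has to be shown. The intervals may overlap, which makes sums and differences
  immediate without a common refinement. The coefficients are square integrable rather than bounded
  because the Euler iterates are unbounded.\<close>

inductive elementary :: "(real \<Rightarrow> 'w \<Rightarrow> complex^'n^'n) \<Rightarrow> ('w \<Rightarrow> complex^'n^'n) \<Rightarrow> bool" where
  zero: "elementary (\<lambda>s w. 0) (\<lambda>w. 0)"
| step: "elementary H S \<Longrightarrow> 0 \<le> a \<Longrightarrow> a \<le> b \<Longrightarrow> \<xi> \<in> borel_measurable (F a) \<Longrightarrow>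
    square_integrable M \<xi> \<Longrightarrow>
    elementary (\<lambda>s w. indicator {a<..b} s *\<^sub>R \<xi> w + H s w) (\<lambda>w. \<xi> w ** incr a b w + S w)"

lemma elementary_add:
  assumes "elementary H S" "elementary H' S'"
  shows "elementary (\<lambda>s w. H s w + H' s w) (\<lambda>w. S w + S' w)"
  using assms(1)
proof induction
  case zero
  then show ?case using assms(2) by simp
next
  case (step H S a b \<xi>)
  then show ?case using elementary.step[of _ _ a b \<xi>] by (simp add: add.assoc)
qed

lemma matrix_minus_mult: "- A ** B = - (A ** B)" for A :: "complex^'n^'m" and B :: "complex^'k^'n"
  by (simp add: vec_eq_iff matrix_matrix_mult_def sum_negf)

lemma elementary_minus:
  assumes "elementary H S"
  shows "elementary (\<lambda>s w. - H s w) (\<lambda>w. - S w)"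
  using assms
proof induction
  case zero
  then show ?case using elementary.zero by simp
next
  case (step H S a b \<xi>)
  then show ?case using elementary.step[of "\<lambda>s w. - H s w" "\<lambda>w. - S w" a b "\<lambda>w. - \<xi> w"]
    by (simp add: matrix_minus_mult)
qed

lemma elementary_diff:
  assumes "elementary H S" "elementary H' S'"
  shows "elementary (\<lambda>s w. H s w - H' s w) (\<lambda>w. S w - S' w)"
  using elementary_add[OF assms(1) elementary_minus[OF assms(2)]] by simp

lemma elementary_sum:
  fixes k :: nat
  assumes "\<And>i. i < k \<Longrightarrow> 0 \<le> a i \<and> a i \<le> b i \<and> \<xi> i \<in> borel_measurable (F (a i)) \<and> square_integrable M (\<xi> i)"
  shows "elementary (\<lambda>s w. \<Sum>i<k. indicator {a i<..b i} s *\<^sub>R \<xi> i w) (\<lambda>w. \<Sum>i<k. \<xi> i w ** incr (a i) (b i) w)"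
  using assms
proof (induction k)
  case 0
  then show ?case using zero by simp
next
  case (Suc k)
  then show ?case
    using step[of "\<lambda>s w. \<Sum>i<k. indicator {a i<..b i} s *\<^sub>R \<xi> i w"
        "\<lambda>w. \<Sum>i<k. \<xi> i w ** incr (a i) (b i) w" "a k" "b k" "\<xi> k"]
    by (simp add: add.commute)
qed

lemma elementary_measurable:
  assumes "elementary H S"
  shows "jointly_measurable M H" "S \<in> borel_measurable M"
proof -
  have "jointly_measurable M H \<and> S \<in> borel_measurable M"
    using assms
  proof induction
    case (step H S a b \<xi>)
    note [measurable] = measurable_F_M[OF step(2,4)] incr_measurable[OF step(2,3)] conjunct1[OF
      step.IH] conjunct2[OF step.IH]
    have "(\<lambda>x. indicator {a<..b} (fst x) *\<^sub>R \<xi> (snd x) + (\<lambda>(s,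
      w). H s w) x) \<in> borel_measurable (lborel \<Otimes>\<^sub>M M)"
      by measurable
    then show ?case by (simp add: case_prod_beta')
  qed simp
  then show "jointly_measurable M H" "S \<in> borel_measurable M" by auto
qed

text \<open>The isometry in bilinear form, bundled with the integrability that makes it additive in
  each argument; this is the form that survives an induction over both integrands.\<close>

definition isometric_pair where
  "isometric_pair H S H' S' \<longleftrightarrow> integrable M (\<lambda>w. S w \<bullet> S' w) \<and>
     (\<forall>w. integrable lborel (\<lambda>s. H s w \<bullet> H' s w)) \<and>
     integrable M (\<lambda>w. \<integral>s. H s w \<bullet> H' s w \<partial>lborel) \<and>
     (\<integral>w. S w \<bullet> S' w \<partial>M) = (\<integral>w. (\<integral>s. H s w \<bullet> H' s w \<partial>lborel) \<partial>M)"
  for H H' :: "real \<Rightarrow> 'w \<Rightarrow> complex^'n^'n" and S S' :: "'w \<Rightarrow> complex^'n^'n"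

lemma isometric_pair_add:
  assumes "isometric_pair H S H' S'" "isometric_pair H1 S1 H' S'"
  shows "isometric_pair (\<lambda>s w. H s w + H1 s w) (\<lambda>w. S w + S1 w) H' S'"
  using assms unfolding isometric_pair_def by (auto simp: inner_add_left)

lemma isometric_pair_commute: "isometric_pair H S H' S' \<Longrightarrow> isometric_pair H' S' H S"
  unfolding isometric_pair_def by (simp add: inner_commute)

lemma square_integrable_entry:
  fixes \<xi> :: "'w \<Rightarrow> complex^'n^'n"
  assumes "\<xi> \<in> borel_measurable M" "square_integrable M \<xi>"
  shows "square_integrable M (\<lambda>w. \<xi> w $ i $ j)"
proof (rule Bochner_Integration.integrable_bound[OF assms(2)])
  show "(\<lambda>w. (cmod (\<xi> w $ i $ j))\<^sup>2) \<in> borel_measurable M"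
    using assms(1) by measurable
qed (auto intro!: AE_I2 power_mono norm_entry_le)

text \<open>Expanding the Frobenius product into entries reduces the claim to
  \<open>increment_pairing\<close>. Each pairing carries a factor 1/N, and the sum over the free
  column index removes it, so the isometry has constant 1.\<close>

lemma isometric_pair_step:
  assumes ab: "0 \<le> a" "a \<le> b"
    and \<xi>: "\<xi> \<in> borel_measurable (F a)" "square_integrable M \<xi>"
    and cd: "0 \<le> c" "c \<le> d"
    and \<eta>: "\<eta> \<in> borel_measurable (F c)" "square_integrable M \<eta>"
  shows "isometric_pair (\<lambda>s w. indicator {a<..b} s *\<^sub>R \<xi> w) (\<lambda>w. \<xi> w ** incr a b w)
    (\<lambda>s w. indicator {c<..d} s *\<^sub>R \<eta> w) (\<lambda>w. \<eta> w ** incr c d w)"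
proof -
  note \<xi>e = borel_measurable_entry[OF \<xi>(1)] square_integrable_entry[OF measurable_F_M[OF ab(1) \<xi>(1)] \<xi>(2)]
  note \<eta>e = borel_measurable_entry[OF \<eta>(1)] square_integrable_entry[OF measurable_F_M[OF cd(1) \<eta>(1)] \<eta>(2)]
  let ?E = "\<lambda>i j l. (\<integral>w. \<xi> w $ i $ j * cnj (\<eta> w $ i $ l) \<partial>M)"
  let ?l = "overlap a b c d"
  have "has_bochner_integral M (\<lambda>w. \<Sum>i\<in>UNIV. \<Sum>k\<in>UNIV. \<Sum>j\<in>UNIV. \<Sum>l\<in>UNIV.
        \<xi> w $ i $ j * incr a b w $ j $ k * cnj (\<eta> w $ i $ l * incr c d w $ l $ k))
      (\<Sum>i\<in>UNIV. \<Sum>k\<in>(UNIV :: 'n set). \<Sum>j\<in>UNIV. \<Sum>l\<in>UNIV. of_real ?l * ?E i j l * of_bool (j = l \<and> k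
        = k) / of_nat CARD('n))"
    by (intro has_bochner_integral_sum increment_pairing ab cd \<xi>e \<eta>e)
  \<comment> \<open>The sum over l keeps the term l = j, and the sum over k of the constant 1/N is
    1.\<close>
  also have "(\<Sum>i\<in>UNIV. \<Sum>k\<in>(UNIV :: 'n set). \<Sum>j\<in>UNIV. \<Sum>l\<in>UNIV. of_real ?l * ?E i j l * of_bool (j
    = l \<and> k = k) / of_nat CARD('n))
     = (\<Sum>i\<in>UNIV. \<Sum>j\<in>UNIV. of_real ?l * ?E i j j)"
  proof -
    have "(\<Sum>l\<in>UNIV. of_real ?l * ?E i j l * of_bool (j = l \<and> k = k) / of_nat CARD('n))
      = of_real ?l * ?E i j j / of_nat CARD('n)"
      for i j and k :: 'n
    proof -
      have "(\<Sum>l\<in>UNIV. of_real ?l * ?E i j l * of_bool (j = l \<and> k = k) / of_nat CARD('n)) =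
        (\<Sum>l\<in>UNIV. if l = j then of_real ?l * ?E i j j / of_nat CARD('n) else 0)"
        by (intro sum.cong) auto
      then show ?thesis by simp
    qed
    then show ?thesis by (simp flip: sum_divide_distrib)
  qed
  finally have 1: "has_bochner_integral M (\<lambda>w. \<Sum>i\<in>UNIV. \<Sum>k\<in>UNIV. \<Sum>j\<in>UNIV. \<Sum>l\<in>UNIV.
        \<xi> w $ i $ j * incr a b w $ j $ k * cnj (\<eta> w $ i $ l * incr c d w $ l $ k))
     (\<Sum>i\<in>UNIV. \<Sum>j\<in>UNIV. of_real ?l * ?E i j j)" .
  have eq: "(\<xi> w ** incr a b w) \<bullet> (\<eta> w ** incr c d w) = Re (\<Sum>i\<in>UNIV. \<Sum>k\<in>UNIV. \<Sum>j\<in>UNIV. \<Sum>l\<in>UNIV.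
        \<xi> w $ i $ j * incr a b w $ j $ k * cnj (\<eta> w $ i $ l * incr c d w $ l $ k))" for w
    by (simp add: inner_matrix matrix_matrix_mult_def sum_product)
  have 2: "has_bochner_integral M (\<lambda>w. (\<xi> w ** incr a b w) \<bullet> (\<eta> w ** incr c d w))
     (Re (\<Sum>i\<in>UNIV. \<Sum>j\<in>UNIV. of_real ?l * ?E i j j))"
    unfolding eq by (rule has_bochner_integral_Re[OF 1])
  have "has_bochner_integral M (\<lambda>w. ?l * (\<xi> w \<bullet> \<eta> w)) (?l * Re (\<Sum>i\<in>UNIV. \<Sum>j\<in>UNIV. ?E i j j))"
    unfolding inner_matrix using product_integrable[OF ab(1) \<xi>e cd(1) \<eta>e]
    by (intro has_bochner_integral_mult_right has_bochner_integral_Re has_bochner_integral_sum)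
      (auto simp: has_bochner_integral_iff)
  also have "?l * Re (\<Sum>i\<in>UNIV. \<Sum>j\<in>UNIV. ?E i j j) = Re (\<Sum>i\<in>UNIV. \<Sum>j\<in>UNIV. of_real ?l * ?E i j j)"
    by (simp add: sum_distrib_left)
  finally have 3: "has_bochner_integral M (\<lambda>w. ?l * (\<xi> w \<bullet> \<eta> w)) (Re (\<Sum>i\<in>UNIV. \<Sum>j\<in>UNIV. of_real ?l
    * ?E i j j))" .
  have 4: "has_bochner_integral lborel (\<lambda>s. (indicator {a<..b} s *\<^sub>R \<xi> w) \<bullet> (indicator {c<..d} s *\<^sub>R
    \<eta> w)) (?l * (\<xi> w \<bullet> \<eta> w))" for w
  proof -
    have "has_bochner_integral lborel (indicator ({max a c<..min b d}) :: real \<Rightarrow> real) ?l"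
      using has_bochner_integral_real_indicator[of "{max a c<..min b d}" lborel]
      by (cases "max a c \<le> min b d") (auto simp: overlap_def)
    from has_bochner_integral_mult_left[OF this, of "\<xi> w \<bullet> \<eta> w"] show ?thesis
      by (rule has_bochner_integral_cong') (auto simp: indicator_def)
  qed
  show ?thesis
    unfolding isometric_pair_def has_bochner_integral_integral_eq[OF 4]
    using 2 3 4 by (auto simp: has_bochner_integral_iff)
qed

lemma isometric_pair_zero: "isometric_pair (\<lambda>s w. 0) (\<lambda>w. 0) H S"
  by (simp add: isometric_pair_def)

lemma elementary_isometric_pair:
  assumes "elementary H S" "elementary H' S'"
  shows "isometric_pair H S H' S'"
  using assms(1)
proof induction
  case (step H S a b \<xi>)
  note outer = step.hyps
  have "isometric_pair (\<lambda>s w. indicator {a<..b} s *\<^sub>R \<xi> w) (\<lambda>w. \<xi> w ** incr a b w) H' S'"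
    using assms(2)
  proof induction
    case zero
    then show ?case by (rule isometric_pair_commute[OF isometric_pair_zero])
  next
    case (step H' S' c d \<eta>)
    from isometric_pair_step[OF outer(2-5) step.hyps(2-5),
      THEN isometric_pair_commute] step.IH[THEN isometric_pair_commute]
    show ?case
      by (intro isometric_pair_commute[OF isometric_pair_add])
  qed
  from isometric_pair_add[OF this step.IH] show ?case .
qed (rule isometric_pair_zero)

end

section \<open>Energy of an integrand and the L2 closure of the elementary integrals\<close>

lemma ennreal_numeral_mult: "0 \<le> x \<Longrightarrow> numeral n * ennreal x = ennreal (numeral n * x)"
  by (simp add: ennreal_mult)

text \<open>The squared norm in L2 of P times ds. Time runs over the whole line, so integrands carry
  their own indicator of the interval of integration.\<close>

definition energy :: "'w measure \<Rightarrow> (real \<Rightarrow> 'w \<Rightarrow> 'b::real_normed_vector) \<Rightarrow> ennreal" where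
  "energy M H = (\<integral>\<^sup>+w. L2_sq lborel (\<lambda>s. H s w) \<partial>M)"

lemma measurable_energy_inner:
  fixes H :: "real \<Rightarrow> 'w \<Rightarrow> 'b::euclidean_space"
  assumes [measurable]: "jointly_measurable M H"
  shows "(\<lambda>w. L2_sq lborel (\<lambda>s. H s w)) \<in> borel_measurable M"
  by measurable

lemma energy_add_le:
  fixes H :: "real \<Rightarrow> 'w \<Rightarrow> 'b::euclidean_space"
  assumes [measurable]: "jointly_measurable M H"
    "jointly_measurable M H'"
  shows "energy M (\<lambda>s w. H s w + H' s w) \<le> 2 * energy M H + 2 * energy M H'"
proof -
  note [measurable] = measurable_energy_inner[OF assms(1)] measurable_energy_inner[OF assms(2)]
  have "energy M (\<lambda>s w. H s w + H' s w) \<le>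
     (\<integral>\<^sup>+w. (\<integral>\<^sup>+s. 2 * ennreal ((norm (H s w))\<^sup>2) + 2 * ennreal ((norm (H' s w))\<^sup>2) \<partial>lborel) \<partial>M)"
    unfolding energy_def by (intro nn_integral_mono ennreal_norm_add_sq_le)
  also have "\<dots> = (\<integral>\<^sup>+w. 2 * L2_sq lborel (\<lambda>s. H s w) + 2 * L2_sq lborel (\<lambda>s. H' s w) \<partial>M)"
    by (intro nn_integral_cong) (simp add: nn_integral_add nn_integral_cmult)
  also have "\<dots> = 2 * energy M H + 2 * energy M H'"
    unfolding energy_def by (subst nn_integral_add) (simp_all add: nn_integral_cmult)
  finally show ?thesis .
qed

lemma energy_minus: "energy M (\<lambda>s w. - H s w) = energy M H"
  by (simp add: energy_def)

lemma energy_diff_le: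
  fixes H :: "real \<Rightarrow> 'w \<Rightarrow> 'b::euclidean_space"
  assumes "jointly_measurable M H"
    and [measurable]: "jointly_measurable M H'"
  shows "energy M (\<lambda>s w. H s w - H' s w) \<le> 2 * energy M H + 2 * energy M H'"
  using energy_add_le[OF assms(1), of "\<lambda>s w. - H' s w"] by (simp add: energy_minus case_prod_beta')

lemma nn_integral_diff_sq_le:
  fixes f g :: "'w \<Rightarrow> 'b::euclidean_space"
  assumes [measurable]: "f \<in> borel_measurable M" "g \<in> borel_measurable M"
  shows "L2_sq M (\<lambda>w. f w - g w) \<le>
    2 * L2_sq M f + 2 * L2_sq M g"
proof -
  have "L2_sq M (\<lambda>w. f w - g w) \<le> (\<integral>\<^sup>+w. 2 * ennreal ((norm (f w))\<^sup>2) + 2 * ennreal ((norm (g w))\<^sup>2) \<partial>M)"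
    using ennreal_norm_add_sq_le[of "f _" "- g _"] by (intro nn_integral_mono) simp
  also have "\<dots> = 2 * L2_sq M f + 2 * L2_sq M g"
    by (subst nn_integral_add) (simp_all add: nn_integral_cmult)
  finally show ?thesis .
qed

context u_bm
begin

lemma ito_isometry:
  assumes "elementary H S"
  shows "L2_sq M S = energy M H" "energy M H < \<infinity>"
proof -
  have iso: "isometric_pair H S H S" using elementary_isometric_pair assms by blast
  have "L2_sq lborel (\<lambda>s. H s w) = ennreal (\<integral>s. H s w \<bullet> H s w \<partial>lborel)" for w
    using iso unfolding isometric_pair_def power2_norm_eq_inner
    by (intro nn_integral_eq_integral) auto
  then have "energy M H = (\<integral>\<^sup>+w. ennreal (\<integral>s. H s w \<bullet> H s w \<partial>lborel) \<partial>M)"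
    by (simp add: energy_def)
  also have "\<dots> = ennreal (\<integral>w. (\<integral>s. H s w \<bullet> H s w \<partial>lborel) \<partial>M)"
    using iso unfolding isometric_pair_def by (intro nn_integral_eq_integral) auto
  finally have e: "energy M H = ennreal (\<integral>w. (\<integral>s. H s w \<bullet> H s w \<partial>lborel) \<partial>M)" .
  then show "energy M H < \<infinity>" by simp
  have "L2_sq M S = ennreal (\<integral>w. S w \<bullet> S w \<partial>M)"
    using iso unfolding isometric_pair_def power2_norm_eq_inner by (intro nn_integral_eq_integral) auto
  then show "L2_sq M S = energy M H"
    using iso e unfolding isometric_pair_def by simp
qed

text \<open>The closure, in L2(P times ds) times L2(P), of the graph formed by elementary integrands
  and their integrals. No time horizon and no particular partition are attached to it, so integrals
  over different intervals can be subtracted from one another and from the Euler sums.\<close>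

definition ito_L2 :: "(real \<Rightarrow> 'w \<Rightarrow> complex^'n^'n) \<Rightarrow> ('w \<Rightarrow> complex^'n^'n) \<Rightarrow> bool" where
  "ito_L2 H Y \<longleftrightarrow> jointly_measurable M H \<and> Y \<in> borel_measurable M \<and>
     (\<forall>e>0. \<exists>H' S'. elementary H' S' \<and> energy M (\<lambda>s w. H s w - H' s w) \<le> ennreal e \<and>
        L2_sq M (\<lambda>w. Y w - S' w) \<le> ennreal e)"

lemma elementary_ito_L2: "elementary H S \<Longrightarrow> ito_L2 H S"
  unfolding ito_L2_def by (auto simp: elementary_measurable energy_def intro!: exI[of _ H] exI[of _ S])

lemma ito_L2_diff:
  assumes "ito_L2 H Y" "ito_L2 H' Y'"
  shows "ito_L2 (\<lambda>s w. H s w - H' s w) (\<lambda>w. Y w - Y' w)"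
proof -
  have [measurable]: "jointly_measurable M H" "jointly_measurable M H'"
    "Y \<in> borel_measurable M" "Y' \<in> borel_measurable M"
    using assms by (auto simp: ito_L2_def)
  have "\<exists>H'' S''. elementary H'' S'' \<and> energy M (\<lambda>s w. (H s w - H' s w) - H'' s w) \<le> ennreal e \<and>
        L2_sq M (\<lambda>w. Y w - Y' w - S'' w) \<le> ennreal e" if "e > 0" for e
  proof -
    \<comment> \<open>The bound |x - y|^2 \<le> 2|x|^2 + 2|y|^2 is applied to two errors of size
      e/4.\<close>
    from that have "e / 4 > 0" by simp
    with assms obtain H1 S1 H2 S2 where 1: "elementary H1 S1" "elementary H2 S2"
      and 2: "energy M (\<lambda>s w. H s w - H1 s w) \<le> ennreal (e / 4)" "L2_sq M (\<lambda>w. Y w - S1 w)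
        \<le> ennreal (e / 4)"
        "energy M (\<lambda>s w. H' s w - H2 s w) \<le> ennreal (e / 4)" "L2_sq M (\<lambda>w. Y' w - S2 w) \<le> ennreal (e / 4)"
      unfolding ito_L2_def by meson
    have four: "2 * a + 2 * b \<le> ennreal e" if "a \<le> ennreal (e / 4)" "b \<le> ennreal (e / 4)" for a b
    proof -
      have "2 * a + 2 * b \<le> 2 * ennreal (e / 4) + 2 * ennreal (e / 4)"
        by (intro add_mono mult_left_mono that) auto
      also have "\<dots> = ennreal (2 * (e / 4) + 2 * (e / 4))"
        using \<open>e > 0\<close> by (simp add: ennreal_numeral_mult flip: ennreal_plus)
      finally show ?thesis by simp
    qed
    note [measurable] = elementary_measurable[OF 1(1)] elementary_measurable[OF 1(2)]
    have "energy M (\<lambda>s w. (H s w - H1 s w) - (H' s w - H2 s w)) \<le> ennreal e"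
      by (rule order_trans[OF energy_diff_le four[OF 2(1,3)]]) (simp_all add: case_prod_beta')
    moreover have "L2_sq M (\<lambda>w. (Y w - S1 w) - (Y' w - S2 w)) \<le> ennreal e"
      by (rule order_trans[OF nn_integral_diff_sq_le four[OF 2(2,4)]]) simp_all
    ultimately show ?thesis
      by (intro exI[of _ "\<lambda>s w. H1 s w - H2 s w"] exI[of _ "\<lambda>w. S1 w - S2 w"] conjI elementary_diff 1)
        (simp_all add: algebra_simps)
  qed
  then show ?thesis unfolding ito_L2_def by (simp add: case_prod_beta')
qed

text \<open>Passing through an elementary approximant uses the squared triangle inequality twice,
  hence the constant 4 in place of the isometry constant 1. For a Gronwall argument any constant
  serves. The tolerance e/6 is chosen so that 2e/6 + 4e/6 = e.\<close>

lemma ito_L2_bound: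
  assumes "ito_L2 H Y"
  shows "L2_sq M Y \<le> 4 * energy M H"
proof (rule ennreal_le_epsilon)
  fix e :: real assume "e > 0"
  have [measurable]: "jointly_measurable M H" "Y \<in> borel_measurable M"
    using assms by (auto simp: ito_L2_def)
  from \<open>e > 0\<close> have "e / 6 > 0" by simp
  with assms obtain H1 S1 where 1: "elementary H1 S1"
      and 2: "energy M (\<lambda>s w. H s w - H1 s w) \<le> ennreal (e / 6)" "L2_sq M (\<lambda>w. Y w - S1 w)
        \<le> ennreal (e / 6)"
      unfolding ito_L2_def by meson
  note [measurable] = elementary_measurable[OF 1]
  have "energy M H1 = energy M (\<lambda>s w. H s w - (H s w - H1 s w))" by simp
  also have "\<dots> \<le> 2 * energy M H + 2 * energy M (\<lambda>s w. H s w - H1 s w)"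
    by (rule energy_diff_le) (simp_all add: case_prod_beta')
  also have "\<dots> \<le> 2 * energy M H + 2 * ennreal (e / 6)"
    by (intro add_mono mult_left_mono 2 order_refl) simp_all
  finally have H1: "energy M H1 \<le> 2 * energy M H + 2 * ennreal (e / 6)" .
  have "L2_sq M Y = L2_sq M (\<lambda>w. (Y w - S1 w) - (- S1 w))" by simp
  also have "\<dots> \<le> 2 * L2_sq M (\<lambda>w. Y w - S1 w) + 2 * L2_sq M (\<lambda>w. - S1 w)"
    by (rule nn_integral_diff_sq_le) simp_all
  also have "L2_sq M (\<lambda>w. - S1 w) = energy M H1"
    using ito_isometry[OF 1] by simp
  also have "2 * L2_sq M (\<lambda>w. Y w - S1 w) + 2 * energy M H1 \<le>
      2 * ennreal (e / 6) + 2 * (2 * energy M H + 2 * ennreal (e / 6))"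
    by (intro add_mono mult_left_mono 2 H1) simp_all
  also have "\<dots> = 4 * energy M H + (2 * ennreal (e / 6) + 4 * ennreal (e / 6))"
    by (simp add: distrib_left mult.assoc[symmetric] add_ac)
  also have "2 * ennreal (e / 6) + 4 * ennreal (e / 6) = ennreal (2 * (e / 6) + 4 * (e / 6))"
    using \<open>e > 0\<close> by (simp add: ennreal_numeral_mult flip: ennreal_plus)
  finally show "L2_sq M Y \<le> 4 * energy M H + ennreal e" by simp
qed

end

section \<open>Strong convergence of the Euler scheme\<close>

text \<open>Integrating the square |T f - m|^2 over the interval, with m the integral of f, gives T
  (T I - |m|^2) \<ge> 0, where I is the integral of |f|^2. An infinite right-hand side is treated
  apart.\<close>

lemma ennreal_Cauchy_Schwarz_interval:
  fixes f :: "real \<Rightarrow> 'b::euclidean_space"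
  assumes T: "0 \<le> T" and f: "integrable lborel f" and supp: "\<And>s. s \<notin> {0<..T} \<Longrightarrow> f s = 0"
  shows "ennreal ((norm (\<integral>s. f s \<partial>lborel))\<^sup>2) \<le> ennreal T * L2_sq lborel f"
proof (cases "T = 0")
  case True
  then have "f = (\<lambda>_. 0)" using supp by auto
  then show ?thesis by simp
next
  case False
  with T have T: "T > 0" by simp
  have [measurable]: "f \<in> borel_measurable lborel" using f by simp
  show ?thesis
  proof (cases "L2_sq lborel f = \<infinity>")
    case True
    then show ?thesis using T by (simp add: ennreal_mult_top)
  next
    case False
    have sq: "integrable lborel (\<lambda>s. (norm (f s))\<^sup>2)"
      using False by (intro integrableI_bounded) (auto simp: less_top)
    define m where "m = (\<integral>s. f s \<partial>lborel)"
    define I where "I = (\<integral>s. (norm (f s))\<^sup>2 \<partial>lborel)"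
    have eq: "indicator {0<..T} s * (norm (T *\<^sub>R f s - m))\<^sup>2 =
        T\<^sup>2 * (norm (f s))\<^sup>2 - 2 * T * (f s \<bullet> m) + (norm m)\<^sup>2 * indicator {0<..T} s" for s
    proof -
      have "(norm (T *\<^sub>R f s - m))\<^sup>2 = T\<^sup>2 * (norm (f s))\<^sup>2 - 2 * T * (f s \<bullet> m) + (norm m)\<^sup>2"
        by (simp add: power2_norm_eq_inner inner_diff_left inner_diff_right inner_commute)
          (simp add: power2_eq_square algebra_simps)
      then show ?thesis using supp[of s] by (cases "s \<in> {0<..T}") auto
    qed
    have "0 \<le> (\<integral>s. indicator {0<..T} s * (norm (T *\<^sub>R f s - m))\<^sup>2 \<partial>lborel)"
      by (intro integral_nonneg_AE AE_I2) simp
    also have "\<dots> = T\<^sup>2 * I - 2 * T * (m \<bullet> m) + (norm m)\<^sup>2 * T"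
      unfolding eq using T f sq by (simp add: I_def m_def)
    also have "\<dots> = T * (T * I - (norm m)\<^sup>2)"
      by (simp add: dot_square_norm power2_eq_square algebra_simps)
    finally have "(norm m)\<^sup>2 \<le> T * I"
      using T by (simp add: zero_le_mult_iff)
    then have "ennreal ((norm m)\<^sup>2) \<le> ennreal (T * I)" by (rule ennreal_leI)
    also have "\<dots> = ennreal T * L2_sq lborel f"
      using T sq by (simp add: I_def ennreal_mult' nn_integral_eq_integral)
    finally show ?thesis by (simp add: m_def)
  qed
qed

text \<open>The comparison sequence \<open>A * (1 + B) ^ k\<close> satisfies the recursion with
  equality. All manipulations are valid in \<open>ennreal\<close>, so the errors may be compared
  without first proving them finite.\<close>

lemma ennreal_discrete_gronwall:
  fixes a :: "nat \<Rightarrow> ennreal"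
  assumes "\<And>k. k \<le> n \<Longrightarrow> a k \<le> A + B * (\<Sum>i<k. a i)" "k \<le> n"
  shows "a k \<le> A * (1 + B) ^ k"
  using assms(2)
proof (induction k rule: less_induct)
  case (less k)
  have geo: "A + B * (\<Sum>i<k. A * (1 + B) ^ i) = A * (1 + B) ^ k" for k
  proof (induction k)
    case (Suc k)
    have "A + B * (\<Sum>i<Suc k. A * (1 + B) ^ i) = (A + B * (\<Sum>i<k. A * (1 + B) ^ i)) + B * (A * (1 + B) ^ k)"
      by (simp add: distrib_left add.assoc)
    then show ?case unfolding Suc by (simp add: distrib_right distrib_left mult_ac)
  qed simp
  have "a k \<le> A + B * (\<Sum>i<k. a i)" using assms(1) less.prems by simp
  also have "\<dots> \<le> A + B * (\<Sum>i<k. A * (1 + B) ^ i)"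
    using less by (intro add_mono mult_left_mono sum_mono order_refl) auto
  finally show ?case unfolding geo .
qed

text \<open>Rounding time down to multiples of 1/(n + 1) leaves countably many values of the index,
  where measurability is immediate; path continuity gives the pointwise limit.\<close>

lemma measurable_continuous_process:
  fixes X :: "real \<Rightarrow> 'w \<Rightarrow> 'b::{metric_space, second_countable_topology}"
  assumes X: "\<And>s. X s \<in> borel_measurable M" and cont: "\<And>w. continuous_on UNIV (\<lambda>s. X s w)"
  shows "jointly_measurable M X"
proof (rule borel_measurable_LIMSEQ_metric)
  fix n :: nat
  show "(\<lambda>x. X (of_int \<lfloor>real (Suc n) * fst x\<rfloor> / real (Suc n)) (snd x)) \<in> borel_measurable (lborel \<Otimes>\<^sub>M M)"
    by (rule measurable_compose_countable[where f = "\<lambda>i x. X (of_int i / real (Suc n)) (snd x)"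
        and g = "\<lambda>x. \<lfloor>real (Suc n) * fst x\<rfloor>"])
      (use measurable_compose[OF measurable_snd X] in \<open>measurable\<close>)
next
  fix x :: "real \<times> 'w"
  have "(\<lambda>n. of_int \<lfloor>real (Suc n) * fst x\<rfloor> / real (Suc n)) \<longlonglongrightarrow> fst x"
  proof (rule tendsto_sandwich)
    show "\<forall>\<^sub>F n in sequentially. fst x - 1 / real (Suc n) \<le> of_int \<lfloor>real (Suc n) * fst x\<rfloor> / real (Suc n)"
    proof (intro always_eventually allI)
      fix n
      have "real (Suc n) * fst x - 1 \<le> of_int \<lfloor>real (Suc n) * fst x\<rfloor>" by linarith
      then have "(real (Suc n) * fst x - 1) / real (Suc n) \<le> of_int \<lfloor>real (Suc n) * fst x\<rfloor> / real (Suc n)"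
        by (rule divide_right_mono) simp
      then show "fst x - 1 / real (Suc n) \<le> of_int \<lfloor>real (Suc n) * fst x\<rfloor> / real (Suc n)"
        by (simp add: diff_divide_distrib)
    qed
    show "\<forall>\<^sub>F n in sequentially. of_int \<lfloor>real (Suc n) * fst x\<rfloor> / real (Suc n) \<le> fst x"
    proof (intro always_eventually allI)
      fix n
      have "of_int \<lfloor>real (Suc n) * fst x\<rfloor> \<le> real (Suc n) * fst x" by linarith
      then show "of_int \<lfloor>real (Suc n) * fst x\<rfloor> / real (Suc n) \<le> fst x"
        by (simp add: divide_le_eq mult.commute)
    qed
    show "(\<lambda>n. fst x - 1 / real (Suc n)) \<longlonglongrightarrow> fst x"
      using tendsto_diff[OF tendsto_const LIMSEQ_Suc[OF lim_1_over_n], of "fst x"] by simp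
  qed simp
  then have "(\<lambda>n. X (of_int \<lfloor>real (Suc n) * fst x\<rfloor> / real (Suc n)) (snd x)) \<longlonglongrightarrow> X (fst x) (snd x)"
    using cont[of "snd x"] by (auto simp: continuous_on_eq_continuous_at intro: isCont_tendsto_compose)
  then show "(\<lambda>n. X (of_int \<lfloor>real (Suc n) * fst x\<rfloor> / real (Suc n)) (snd x)) \<longlonglongrightarrow> (case x of (s, w) \<Rightarrow> X s w)"
    by (simp add: case_prod_beta')
qed

section \<open>A priori bounds for an Ito integral with linear drift\<close>

context u_bm
begin

text \<open>A single approximant at distance 1 suffices, since elementary integrands have finite
  energy. Applied to the solution, this is the only moment information about \<open>G\<close> that
  the error analysis uses.\<close>

lemma ito_L2_energy_finite:
  assumes "ito_L2 H Y"
  shows "energy M H < \<infinity>"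
proof -
  have [measurable]: "jointly_measurable M H"
    using assms by (auto simp: ito_L2_def)
  obtain H' S' where 1: "elementary H' S'" and 2: "energy M (\<lambda>s w. H s w - H' s w) \<le> ennreal 1"
    using assms zero_less_one unfolding ito_L2_def by meson
  note [measurable] = elementary_measurable(1)[OF 1]
  have "energy M (\<lambda>s w. (H s w - H' s w) + H' s w) \<le> 2 * energy M (\<lambda>s w. H s w - H' s w) + 2 * energy M H'"
    by (rule energy_add_le) (simp_all add: case_prod_beta')
  also have "\<dots> < \<infinity>"
    using ito_isometry(2)[OF 1] 2 by (auto simp: ennreal_mult_less_top intro: le_less_trans)
  finally show ?thesis by simp
qed

text \<open>Increments of the solution and errors of the scheme are both of the form
  \<open>\<integral>H dK - (1/2) \<integral>H ds\<close>, so one estimate treats both. In the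
  constant, 8 is 2 times the 4 of \<open>ito_L2_bound\<close>, and T/2 is 2 times (1/2)^2 times the
  T of Cauchy-Schwarz.\<close>

lemma ito_drift_bound:
  assumes ito: "ito_L2 H Y" and T: "0 \<le> T" and int: "\<And>w. w \<in> space M \<Longrightarrow> integrable lborel (\<lambda>s. H s w)"
    and supp: "\<And>s w. s \<notin> {0<..T} \<Longrightarrow> H s w = 0"
    and Z: "AE w in M. Z w = Y w - (1/2) *\<^sub>R (\<integral>s. H s w \<partial>lborel)"
  shows "L2_sq M Z \<le> ennreal (8 + T / 2) * energy M H"
proof -
  have H[measurable]: "jointly_measurable M H" "Y \<in> borel_measurable M"
    using ito by (auto simp: ito_L2_def)
  note [measurable] = measurable_energy_inner[OF H(1)]
  have "L2_sq M Z \<le> (\<integral>\<^sup>+w. 2 * ennreal ((norm (Y w))\<^sup>2) +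
      ennreal (T / 2) * L2_sq lborel (\<lambda>s. H s w) \<partial>M)"
  proof (rule nn_integral_mono_AE)
    show "AE w in M. ennreal ((norm (Z w))\<^sup>2) \<le> 2 * ennreal ((norm (Y w))\<^sup>2) +
      ennreal (T / 2) * L2_sq lborel (\<lambda>s. H s w)"
      using Z AE_space
    proof eventually_elim
      case (elim w)
      let ?m = "\<integral>s. H s w \<partial>lborel"
      have "ennreal ((norm (Z w))\<^sup>2) \<le> 2 * ennreal ((norm (Y w))\<^sup>2) + 2 * ennreal ((norm ((1/2) *\<^sub>R ?m))\<^sup>2)"
        using ennreal_norm_add_sq_le[of "Y w" "- ((1/2) *\<^sub>R ?m)"] elim by simp
      also have "2 * ennreal ((norm ((1/2) *\<^sub>R ?m))\<^sup>2) = ennreal (1/2) * ennreal ((norm ?m)\<^sup>2)"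
        by (subst ennreal_mult'[symmetric]) (simp_all add: ennreal_numeral_mult power_mult_distrib
          power_divide)
      also have "\<dots> \<le> ennreal (1/2) * (ennreal T * L2_sq lborel (\<lambda>s. H s w))"
        by (intro mult_left_mono ennreal_Cauchy_Schwarz_interval T int supp) (use elim in auto)
      also have "\<dots> = ennreal (T / 2) * L2_sq lborel (\<lambda>s. H s w)"
        by (subst mult.assoc[symmetric], subst ennreal_mult'[symmetric]) simp_all
      finally show ?case by (simp add: add_left_mono)
    qed
  qed
  also have "\<dots> = 2 * L2_sq M Y + ennreal (T / 2) * energy M H"
    unfolding energy_def by (subst nn_integral_add) (simp_all add: nn_integral_cmult)
  also have "\<dots> \<le> 2 * (4 * energy M H) + ennreal (T / 2) * energy M H"
    by (intro add_mono mult_left_mono ito_L2_bound ito) simp_all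
  also have "\<dots> = ennreal (8 + T / 2) * energy M H"
    using T by (simp add: ennreal_plus distrib_right mult.assoc[symmetric])
  finally show ?thesis .
qed

lemma simple_process_elementary:
  assumes "simple_process M F t k \<tau> \<xi>"
  shows "elementary (simple_value k \<tau> \<xi>) (simple_integral K k \<tau> \<xi>)"
    and "s \<notin> {0<..t} \<Longrightarrow> simple_value k \<tau> \<xi> s w = 0"
proof -
  have \<tau>: "\<tau> 0 = 0" "\<tau> k = t" "\<And>i. i < k \<Longrightarrow> \<tau> i \<le> \<tau> (Suc i)"
    and \<xi>: "\<And>i. i < k \<Longrightarrow> \<xi> i \<in> borel_measurable (F (\<tau> i)) \<and> (\<exists>b. \<forall>w\<in>space M. norm (\<xi> i w) \<le> b)"
    using assms by (auto simp: simple_process_def)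
  have mono: "\<tau> i \<le> \<tau> j" if "i \<le> j" "j \<le> k" for i j
    using that(1,2) by (induction rule: dec_induct) (auto intro: order_trans[OF _ \<tau>(3)])
  have ge: "0 \<le> \<tau> i" "\<tau> i \<le> t" if "i \<le> k" for i
    using mono[of 0 i] mono[of i k] that \<tau>(1,2) by auto
  have int: "square_integrable M (\<xi> i)" if i: "i < k" for i
  proof -
    from \<xi>[OF i] obtain b where b: "\<And>w. w \<in> space M \<Longrightarrow> norm (\<xi> i w) \<le> b" by auto
    have [measurable]: "\<xi> i \<in> borel_measurable M" using \<xi>[OF i] ge[of i] i
      by (intro measurable_F_M[of "\<tau> i"]) simp_all
    show ?thesis
      by (rule integrable_const_bound[where B = "b\<^sup>2"]) (auto intro!: AE_I2 power_mono b)
  qed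
  show "elementary (simple_value k \<tau> \<xi>) (simple_integral K k \<tau> \<xi>)"
    using elementary_sum[of k \<tau> "\<lambda>i. \<tau> (Suc i)" \<xi>] \<xi> int ge \<tau>(3)
    by (simp add: simple_value_def[abs_def] simple_integral_def[abs_def] incr_def)
  show "simple_value k \<tau> \<xi> s w = 0" if "s \<notin> {0<..t}"
    unfolding simple_value_def
  proof (rule sum.neutral, intro ballI)
    fix i assume "i \<in> {..<k}"
    then have "0 \<le> \<tau> i" "\<tau> (Suc i) \<le> t" using ge by auto
    then show "indicator {\<tau> i<..\<tau> (Suc i)} s *\<^sub>R \<xi> i w = 0" using that by (auto simp: indicator_def)
  qed
qed

text \<open>The integrand is exchanged for a version that agrees with it at all times almost surely
  and is jointly measurable, as Fubini will require. The approximating simple processes stay the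
  same.\<close>

lemma has_ito_integral_ito_L2:
  assumes ito: "has_ito_integral M F K H t Y"
    and H': "AE w in M. \<forall>s. H' s w = H s w"
    and meas: "jointly_measurable M (\<lambda>s w. indicator {0<..t} s *\<^sub>R H' s w)"
  shows "ito_L2 (\<lambda>s w. indicator {0<..t} s *\<^sub>R H' s w) Y"
proof -
  from ito obtain k \<tau> \<xi> where Y: "Y \<in> borel_measurable M"
    and sp: "\<And>r::nat. simple_process M F t (k r) (\<tau> r) (\<xi> r)"
    and lim1: "(\<lambda>r. \<integral>\<^sup>+w. (\<integral>\<^sup>+s\<in>{0..t}.
            ennreal ((norm (simple_value (k r) (\<tau> r) (\<xi> r) s w - H s w))\<^sup>2) \<partial>lborel) \<partial>M) \<longlonglongrightarrow> 0"
    and lim2: "(\<lambda>r. L2_sq M (\<lambda>w. simple_integral K (k r) (\<tau> r) (\<xi> r) w - Y w)) \<longlonglongrightarrow> 0"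
    unfolding has_ito_integral_def by blast
  have "\<exists>H'' S. elementary H'' S \<and> energy M (\<lambda>s w. indicator {0<..t} s *\<^sub>R H' s w - H'' s w) \<le> ennreal e \<and>
        L2_sq M (\<lambda>w. Y w - S w) \<le> ennreal e" if "e > 0" for e
  proof -
    from that have e: "ennreal e > 0" by simp
    from eventually_happens'[OF _ eventually_conj[OF order_tendstoD(2)[OF lim1 e]
      order_tendstoD(2)[OF lim2 e]]]
    obtain r where r: "(\<integral>\<^sup>+w. (\<integral>\<^sup>+s\<in>{0..t}.
            ennreal ((norm (simple_value (k r) (\<tau> r) (\<xi> r) s w - H s w))\<^sup>2) \<partial>lborel) \<partial>M) < ennreal e"
      "L2_sq M (\<lambda>w. simple_integral K (k r) (\<tau> r) (\<xi> r) w - Y w) < ennreal e"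
      by auto
    have "energy M (\<lambda>s w. indicator {0<..t} s *\<^sub>R H' s w - simple_value (k r) (\<tau> r) (\<xi> r) s w) \<le>
       (\<integral>\<^sup>+w. (\<integral>\<^sup>+s\<in>{0..t}. ennreal ((norm (simple_value (k r) (\<tau> r) (\<xi> r) s w - H s w))\<^sup>2) \<partial>lborel) \<partial>M)"
      unfolding energy_def
    proof (rule nn_integral_mono_AE)
      show "AE w in M. L2_sq lborel (\<lambda>s. indicator {0<..t} s *\<^sub>R H' s w
        - simple_value (k r) (\<tau> r) (\<xi> r) s w)
         \<le> (\<integral>\<^sup>+s\<in>{0..t}. ennreal ((norm (simple_value (k r) (\<tau> r) (\<xi> r) s w - H s w))\<^sup>2) \<partial>lborel)"
        using H'
      proof eventually_elim
        case (elim w)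
        show ?case
        proof (rule nn_integral_mono)
          fix s
          \<comment> \<open>At s = 0 and outside [0, t] the left side is 0, because simple processes
            live on (0, t]; this reconciles the half-open with the closed interval.\<close>
          show "ennreal ((norm (indicator {0<..t} s *\<^sub>R H' s w - simple_value (k r) (\<tau> r) (\<xi> r) s w))\<^sup>2)
            \<le> ennreal ((norm (simple_value (k r) (\<tau> r) (\<xi> r) s w - H s w))\<^sup>2) * indicator {0..t} s"
            using simple_process_elementary(2)[OF sp, of s r w] elim
            by (cases "s \<in> {0<..t}") (auto simp: norm_minus_commute)
        qed
      qed
    qed
    then show ?thesis
      using r simple_process_elementary(1)[OF sp[of r]]
      by (intro exI[of _ "simple_value (k r) (\<tau> r) (\<xi> r)"] exI[of _ "simple_integral K (k r) (\<tau> r) (\<xi> r)"])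
        (auto simp: norm_minus_commute)
  qed
  then show ?thesis unfolding ito_L2_def using Y meas by auto
qed

end

section \<open>The Euler iterates as discrete stochastic integrals\<close>

context u_bm
begin

definition euler_factor :: "real \<Rightarrow> nat \<Rightarrow> 'w \<Rightarrow> complex^'n^'n" where
  "euler_factor h k w = (1 - h / 2) *\<^sub>R mat 1 + incr (real k * h) (real (Suc k) * h) w"

primrec euler :: "real \<Rightarrow> nat \<Rightarrow> 'w \<Rightarrow> complex^'n^'n" where
  "euler h 0 w = mat 1"
| "euler h (Suc k) w = euler h k w ** euler_factor h k w"

lemma grid_mono: "0 \<le> h \<Longrightarrow> real k * h \<le> real (Suc k) * h"
  by (simp add: mult_right_mono)

lemma euler_measurable_F:
  assumes h: "0 \<le> h"
  shows "euler h k \<in> borel_measurable (F (real k * h))"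
proof (induction k)
  case 0
  have "(\<lambda>_. mat 1) \<in> borel_measurable (F (real 0 * h))" by simp
  then show ?case by (simp add: fun_eq_iff[THEN iffD2])
next
  case (Suc k)
  note g = grid_mono[OF h, of k]
  have [measurable]: "euler h k \<in> borel_measurable (F (real (Suc k) * h))"
    using measurable_F_mono[OF _ g Suc] h by simp
  have [measurable]: "incr (real k * h) (real (Suc k) * h) \<in> borel_measurable (F (real (Suc k) * h))"
    using h g by (intro incr_measurable_F) auto
  have "(\<lambda>w. euler h k w ** euler_factor h k w) \<in> borel_measurable (F (real (Suc k) * h))"
    unfolding euler_factor_def by measurable
  then show ?case by (simp add: fun_eq_iff[THEN iffD2])
qed

lemma euler_measurable: "0 \<le> h \<Longrightarrow> euler h k \<in> borel_measurable M"
  using measurable_F_M[OF _ euler_measurable_F[of h k]] by simp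

lemma scaleR_matrix_mult: "A ** (c *\<^sub>R B) = c *\<^sub>R (A ** B)" "(c *\<^sub>R A) ** B = c *\<^sub>R (A ** B)"
  for A :: "complex^'n^'m" and B :: "complex^'k^'n"
  by (simp_all add: vec_eq_iff matrix_matrix_mult_def scaleR_sum_right)

lemma euler_Suc: "euler h (Suc k) w = euler h k w + euler h k w ** incr (real k * h) (real (Suc k)
  * h) w - (h / 2) *\<^sub>R euler h k w"
  proof -
  have "euler_factor h k w = mat 1 + incr (real k * h) (real (Suc k) * h) w + (- h / 2) *\<^sub>R mat 1"
    by (simp add: euler_factor_def scaleR_left_diff_distrib)
  then show ?thesis
    by (simp only: euler.simps matrix_add_ldistrib scaleR_matrix_mult) simp
qed

text \<open>The stochastic equation with a piecewise constant integrand; in this form it can be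
  subtracted from the equation for \<open>G\<close>.\<close>

lemma euler_sum:
  "euler h k w = mat 1 + (\<Sum>i<k. euler h i w ** incr (real i * h) (real (Suc i) * h) w)
    - (h / 2) *\<^sub>R (\<Sum>i<k. euler h i w)"
  by (induction k) (simp_all add: euler_Suc scaleR_right_distrib algebra_simps del: euler.simps(2)
    of_nat_Suc)

lemma square_integrable_add:
  fixes f g :: "'w \<Rightarrow> complex"
  assumes [measurable]: "f \<in> borel_measurable M" "g \<in> borel_measurable M"
    and "square_integrable M f" "square_integrable M g"
  shows "square_integrable M (\<lambda>w. f w + g w)"
proof (rule Bochner_Integration.integrable_bound)
  show "integrable M (\<lambda>w. 2 * (cmod (f w))\<^sup>2 + 2 * (cmod (g w))\<^sup>2)"
    using assms by simp
  show "AE w in M. norm ((cmod (f w + g w))\<^sup>2) \<le> norm (2 * (cmod (f w))\<^sup>2 + 2 * (cmod (g w))\<^sup>2)"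
    by (intro AE_I2) (simp add: norm_add_sq_le)
qed simp

lemma square_integrable_sum:
  fixes f :: "'i \<Rightarrow> 'w \<Rightarrow> complex"
  assumes "finite I" "\<And>i. i \<in> I \<Longrightarrow> f i \<in> borel_measurable M" "\<And>i. i \<in> I \<Longrightarrow> square_integrable M (f i)"
  shows "square_integrable M (\<lambda>w. \<Sum>i\<in>I. f i w)"
  using assms
proof (induction I rule: finite_induct)
  case (insert i I)
  then show ?case
    by (simp, intro square_integrable_add) auto
qed simp

text \<open>In every step the new increment is multiplied by a coefficient from the past, so
  independence propagates square integrability. It makes the iterates admissible as coefficients of
  an elementary integrand.\<close>

lemma euler_entry_square_integrable:
  assumes h: "0 \<le> h"
  shows "square_integrable M (\<lambda>w. euler h k w $ i $ j)"
proof (induction k arbitrary: i j)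
  case (Suc k)
  note [measurable] = euler_measurable[OF h, of k]
  have [measurable]: "incr (real k * h) (real (Suc k) * h) \<in> borel_measurable M"
    using h grid_mono by (intro incr_measurable) auto
  have "square_integrable M (\<lambda>w. of_real (1 - h / 2) * euler h k w $ i $ j
     + (\<Sum>l\<in>UNIV. euler h k w $ i $ l * incr (real k * h) (real (Suc k) * h) w $ l $ j))"
  proof (intro square_integrable_add square_integrable_sum mult_incr_square_integrable)
    show "(\<lambda>w. euler h k w $ i $ l) \<in> borel_measurable (F (real k * h))" for l
      using euler_measurable_F[OF h, of k] by measurable
    show "square_integrable M (\<lambda>w. of_real (1 - h / 2) * euler h k w $ i $ j)"
      unfolding norm_mult power_mult_distrib using Suc by simp
    show "(\<lambda>w. of_real (1 - h / 2) * euler h k w $ i $ j) \<in> borel_measurable M"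
      "(\<lambda>w. euler h k w $ i $ l * incr (real k * h) (real (Suc k) * h) w $ l $ j) \<in> borel_measurable M"
      "(\<lambda>w. \<Sum>l\<in>UNIV. euler h k w $ i $ l * incr (real k * h) (real (Suc k)
        * h) w $ l $ j) \<in> borel_measurable M"
      for l by measurable
  qed (use Suc h grid_mono[OF h] in auto)
  also have "(\<lambda>w. of_real (1 - h / 2) * euler h k w $ i $ j
     + (\<Sum>l\<in>UNIV. euler h k w $ i $ l * incr (real k * h) (real (Suc k) * h) w $ l $ j))
     = (\<lambda>w. euler h (Suc k) w $ i $ j)"
    unfolding euler_Suc by (simp add: fun_eq_iff matrix_matrix_mult_def scaleR_conv_of_real[where 'a
      = complex] algebra_simps)
  finally show ?case .
qed simp

lemma euler_square_integrable:
  assumes h: "0 \<le> h"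
  shows "square_integrable M (\<lambda>w. euler h k w)"
proof -
  have "(norm A)\<^sup>2 = (\<Sum>i\<in>UNIV. \<Sum>j\<in>UNIV. (cmod (A $ i $ j))\<^sup>2)" for A :: "complex^'n^'n"
    by (simp add: power2_norm_eq_inner inner_vec_def)
  then show ?thesis
    by (simp add: euler_entry_square_integrable[OF h])
qed

end

section \<open>A continuous version of the solution and its integral equation\<close>

locale unitary_bm = u_bm M F K for M :: "'w measure" and F and K :: "real \<Rightarrow> 'w \<Rightarrow> complex^'n^'n" +
  fixes G :: "real \<Rightarrow> 'w \<Rightarrow> complex^'n^'n"
  assumes ubm: "unitary_brownian_motion M F K G"
begin

text \<open>The modification below has continuous paths for every outcome; it need not be adapted.\<close>

lemma exists_continuous_modification:
  "\<exists>G'. (\<forall>w. continuous_on UNIV (\<lambda>t. G' t w)) \<and> (\<forall>t. G' t \<in> borel_measurable M) \<and>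
     (AE w in M. \<forall>t\<ge>0. G' t w = G t w)"
proof -
  have "AE w in M. continuous_on {0..} (\<lambda>t. G t w)"
    using ubm by (simp add: unitary_brownian_motion_def)
  then obtain N where N: "{w \<in> space M. \<not> continuous_on {0..} (\<lambda>t. G t w)} \<subseteq> N" "N \<in> null_sets M"
    by (auto elim!: AE_E intro: null_setsI)
  have [measurable]: "N \<in> sets M" using N(2) by auto
  have G: "G t \<in> borel_measurable M" if "0 \<le> t" for t
    using ubm that by (intro measurable_F_M[of t]) (auto simp: unitary_brownian_motion_def)
  \<comment> \<open>Frozen at its initial value for negative times, and zero on the exceptional null
    set.\<close>
  define G' where "G' t w = indicator (space M - N) w *\<^sub>R G (max 0 t) w" for t w
  have "continuous_on UNIV (\<lambda>t. G' t w)" for w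
  proof (cases "w \<in> space M - N")
    case True
    then have "continuous_on {0..} (\<lambda>t. G t w)" using N(1) by auto
    then have "continuous_on UNIV (\<lambda>t. G (max 0 t) w)"
      by (rule continuous_on_compose2) (auto intro!: continuous_intros)
    then show ?thesis using True by (simp add: G'_def)
  qed (simp add: G'_def)
  moreover have "G' t \<in> borel_measurable M" for t
    unfolding G'_def[abs_def] using G[of "max 0 t"] by (auto intro!: borel_measurable_scaleR)
  moreover have "AE w in M. \<forall>t\<ge>0. G' t w = G t w"
    using AE_not_in[OF N(2)] AE_space by eventually_elim (auto simp: G'_def)
  ultimately show ?thesis by blast
qed

definition Gc :: "real \<Rightarrow> 'w \<Rightarrow> complex^'n^'n" where
  "Gc = (SOME G'. (\<forall>w. continuous_on UNIV (\<lambda>t. G' t w)) \<and> (\<forall>t. G' t \<in> borel_measurable M) \<and>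
     (AE w in M. \<forall>t\<ge>0. G' t w = G t w))"

lemma Gc: "continuous_on UNIV (\<lambda>t. Gc t w)" "Gc t \<in> borel_measurable M"
    "AE w in M. \<forall>t\<ge>0. Gc t w = G t w"
  using someI_ex[OF exists_continuous_modification] unfolding Gc_def[symmetric] by blast+

abbreviation Gc_on :: "real \<Rightarrow> real \<Rightarrow> real \<Rightarrow> 'w \<Rightarrow> complex^'n^'n" where
  "Gc_on a b s w \<equiv> indicator {a<..b} s *\<^sub>R Gc s w"

lemma Gc_jointly_measurable [measurable]: "jointly_measurable M Gc"
  by (rule measurable_continuous_process[OF Gc(2,1)])

lemma Gc_interval_measurable [measurable]: "jointly_measurable M (Gc_on a b)"
proof -
  have "(\<lambda>x. indicator {a<..b} (fst x) *\<^sub>R (\<lambda>(s, w). Gc s w) x) \<in> borel_measurable (lborel \<Otimes>\<^sub>M M)"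
    by measurable
  then show ?thesis by (simp add: case_prod_beta')
qed

text \<open>The drift in the defining equation is a gauge integral over a closed interval, while the
  energy estimates use Bochner integrals over half-open ones, which split along a grid.\<close>

lemma Gc_integral:
  assumes "a \<le> b"
  shows "integrable lborel (\<lambda>s. Gc_on a b s w)"
    and "(\<integral>s. Gc_on a b s w \<partial>lborel) = integral {a..b} (\<lambda>s. Gc s w)"
proof -
  have c: "set_integrable lborel {a..b} (\<lambda>s. Gc s w)"
    by (rule borel_integrable_atLeastAtMost') (use Gc(1) continuous_on_subset in blast)
  have "set_integrable lborel {a<..b} (\<lambda>s. Gc s w)"
    by (rule set_integrable_subset[OF c]) auto
  then show "integrable lborel (\<lambda>s. Gc_on a b s w)"
    by (simp add: set_integrable_def)
  have [measurable]: "(\<lambda>s. Gc s w) \<in> borel_measurable borel"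
    using Gc(1) by (rule borel_measurable_continuous_onI)
  have "(\<integral>s. Gc_on a b s w \<partial>lborel) = (\<integral>s. indicator {a..b} s *\<^sub>R Gc s w \<partial>lborel)"
    by (rule integral_cong_AE) (use AE_lborel_singleton[of a] in \<open>auto elim!: eventually_mono simp:
      indicator_def\<close>)
  then show "(\<integral>s. Gc_on a b s w \<partial>lborel) = integral {a..b} (\<lambda>s. Gc s w)"
    using set_borel_integral_eq_integral(2)[OF c] by (simp add: set_lebesgue_integral_def)
qed

lemma Gc_ito:
  assumes "0 \<le> t"
  obtains Y where "ito_L2 (Gc_on 0 t) Y"
    "AE w in M. Gc t w = mat 1 + Y w - (1/2) *\<^sub>R (\<integral>s. Gc_on 0 t s w \<partial>lborel)"
proof -
  from ubm assms obtain Y where Y: "has_ito_integral M F K G t Y"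
    and eq: "AE w in M. G t w = G 0 w + Y w + integral {0..t} (\<lambda>s. (1/2) *\<^sub>R (u_casimir ** G s w))"
    unfolding unitary_brownian_motion_def by blast
  have G0: "AE w in M. G 0 w = mat 1" using ubm by (simp add: unitary_brownian_motion_def)
  have "ito_L2 (Gc_on 0 t) Y"
  proof (rule has_ito_integral_ito_L2[OF _ _ Gc_interval_measurable])
    \<comment> \<open>The equation says nothing about \<open>G\<close> at negative times, but the
      transfer lemma wants agreement at every s; the integrand is therefore replaced there by
      \<open>Gc\<close>, outside the range of integration.\<close>
    have "has_ito_integral M F K (\<lambda>s w. if 0 \<le> s then G s w else Gc s w) t Y"
    proof -
      have "(\<lambda>w. (\<integral>\<^sup>+s\<in>{0..t}. ennreal ((norm (simple_value k \<tau> \<xi> s w - (if 0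
        \<le> s then G s w else Gc s w)))\<^sup>2) \<partial>lborel)) =
         (\<lambda>w. (\<integral>\<^sup>+s\<in>{0..t}. ennreal ((norm (simple_value k \<tau> \<xi> s w - G s w))\<^sup>2) \<partial>lborel))"
           for k \<tau> and \<xi> :: "nat \<Rightarrow> 'w \<Rightarrow> complex^'n^'n"
        by (intro ext nn_integral_cong) (auto simp: indicator_def)
      then show ?thesis using Y unfolding has_ito_integral_def by simp
    qed
    then show "has_ito_integral M F K (\<lambda>s w. if 0 \<le> s then G s w else Gc s w) t Y" .
    show "AE w in M. \<forall>s. Gc s w = (if 0 \<le> s then G s w else Gc s w)"
      using Gc(3) by eventually_elim auto
  qed
  moreover have "AE w in M. Gc t w = mat 1 + Y w - (1/2) *\<^sub>R (\<integral>s. Gc_on 0 t s w \<partial>lborel)"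
    using eq G0 Gc(3)
  proof eventually_elim
    case (elim w)
    have "integral {0..t} (\<lambda>s. (1/2) *\<^sub>R (u_casimir ** G s w)) = integral {0..t} (\<lambda>s. - ((1/2) *\<^sub>R Gc s w))"
      by (rule integral_cong) (simp add: u_casimir_eq elim(3) matrix_minus_mult)
    also have "\<dots> = - ((1/2) *\<^sub>R integral {0..t} (\<lambda>s. Gc s w))" by simp
    finally show ?case using elim assms by (simp add: Gc_integral)
  qed
  ultimately show ?thesis using that by blast
qed

lemma Gc_energy_finite: "0 \<le> t \<Longrightarrow> energy M (Gc_on 0 t) < \<infinity>"
  by (rule Gc_ito, assumption, rule ito_L2_energy_finite)

text \<open>Subtracting the equations at times s and u leaves an integral and a drift over (u, s]
  only, so the increment is controlled by the energy of that interval.\<close>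

lemma Gc_increment_bound:
  assumes "0 \<le> u" "u \<le> s" "s \<le> T"
  shows "L2_sq M (\<lambda>w. Gc s w - Gc u w) \<le>
    ennreal (8 + T / 2) * energy M (Gc_on u s)"
proof -
  obtain Y where Y: "ito_L2 (Gc_on 0 s) Y"
    "AE w in M. Gc s w = mat 1 + Y w - (1/2) *\<^sub>R (\<integral>r. Gc_on 0 s r w \<partial>lborel)"
    using Gc_ito[of s] assms by auto
  obtain Y' where Y': "ito_L2 (Gc_on 0 u) Y'"
    "AE w in M. Gc u w = mat 1 + Y' w - (1/2) *\<^sub>R (\<integral>r. Gc_on 0 u r w \<partial>lborel)"
    using Gc_ito[of u] assms by auto
  have i: "Gc_on 0 s r w - Gc_on 0 u r w = Gc_on u s r w" for r w
    using assms by (auto simp: indicator_def)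
  show ?thesis
  proof (rule ito_drift_bound)
    show "ito_L2 (Gc_on u s) (\<lambda>w. Y w - Y' w)"
      using ito_L2_diff[OF Y(1) Y'(1)] unfolding i .
    show "AE w in M. Gc s w - Gc u w = Y w - Y' w - (1/2) *\<^sub>R (\<integral>r. Gc_on u s r w \<partial>lborel)"
      using Y(2) Y'(2)
    proof eventually_elim
      case (elim w)
      have "(\<integral>r. Gc_on u s r w \<partial>lborel) =
        (\<integral>r. Gc_on 0 s r w \<partial>lborel) - (\<integral>r. Gc_on 0 u r w \<partial>lborel)"
        unfolding i[symmetric] using assms by (intro Bochner_Integration.integral_diff Gc_integral(1)) auto
      then show ?case using elim by (simp add: scaleR_right_diff_distrib)
    qed
  qed (use assms Gc_integral in \<open>auto\<close>)
qed

end

section \<open>Mean square error of the scheme\<close>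

context unitary_bm
begin

lemma interval_decomposition:
  fixes h :: real
  assumes "0 \<le> h"
  shows "indicator {0<..real k * h} s = (\<Sum>i<k. indicator (cell h i) s :: real)"
proof (induction k)
  case (Suc k)
  have "0 \<le> real k * h" using assms by simp
  with grid_mono[OF assms, of k]
  have "indicator {0<..real (Suc k) * h} s = (indicator {0<..real k * h} s
    + indicator (cell h k) s :: real)"
    by (auto simp: indicator_def)
  then show ?case using Suc by simp
qed simp

text \<open>The solution minus the piecewise constant integrand of the scheme. The error at a grid
  point is its stochastic integral minus half its time integral.\<close>

definition euler_error_process :: "real \<Rightarrow> nat \<Rightarrow> real \<Rightarrow> 'w \<Rightarrow> complex^'n^'n" where
  "euler_error_process h k s w = (\<Sum>i<k. indicator (cell h i) s *\<^sub>R (Gc s w - euler h i w))"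

lemma euler_error_process_eq:
  assumes "0 \<le> h"
  shows "euler_error_process h k s w = Gc_on 0 (real k * h) s w
    - (\<Sum>i<k. indicator (cell h i) s *\<^sub>R euler h i w)"
  unfolding interval_decomposition[OF assms] euler_error_process_def
  by (simp add: scaleR_right_diff_distrib sum_subtractf scaleR_sum_left)

text \<open>Solution and scheme obey the same linear equation with different integrands and both
  start at the identity. Subtracting them leaves an Ito integral with drift whose integrand is the
  error process.\<close>

lemma euler_error_bound:
  assumes h: "0 \<le> h" and T: "real k * h \<le> T"
  shows "L2_sq M (\<lambda>w. Gc (real k * h) w - euler h k w) \<le>
    ennreal (8 + T / 2) * energy M (euler_error_process h k)"
proof -
  have kh: "0 \<le> real k * h" using h by simp
  obtain Y where Y: "ito_L2 (Gc_on 0 (real k * h)) Y"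
    "AE w in M. Gc (real k * h) w = mat 1 + Y w - (1/2) *\<^sub>R (\<integral>r. Gc_on 0 (real k * h) r w \<partial>lborel)"
    using Gc_ito[OF kh] by auto
  let ?S = "\<lambda>w. \<Sum>i<k. euler h i w ** incr (real i * h) (real (Suc i) * h) w"
  have el: "elementary (\<lambda>s w. \<Sum>i<k. indicator (cell h i) s *\<^sub>R euler h i w) ?S"
    by (rule elementary_sum) (use h grid_mono[OF h] euler_measurable_F[OF h]
      euler_square_integrable[OF h] in auto)
  have step: "has_bochner_integral lborel (\<lambda>s. indicator (cell h i) s *\<^sub>R euler h i w) (h *\<^sub>R euler
    h i w)" for i w
  proof -
    have "has_bochner_integral lborel (indicator (cell h i) :: real \<Rightarrow> real) h"
      using has_bochner_integral_real_indicator[of "cell h i" lborel] grid_mono[OF h, of i]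
      by (simp add: algebra_simps)
    then show ?thesis by (intro has_bochner_integral_scaleR_left)
  qed
  have steps: "has_bochner_integral lborel (\<lambda>s. \<Sum>i<k. indicator (cell h i) s *\<^sub>R euler h i w) (h *\<^sub>R
    (\<Sum>i<k. euler h i w))" for w
    unfolding scaleR_sum_right by (intro has_bochner_integral_sum step)
  have hbi: "has_bochner_integral lborel (\<lambda>s. euler_error_process h k s w)
    ((\<integral>r. Gc_on 0 (real k * h) r w \<partial>lborel) - h *\<^sub>R (\<Sum>i<k. euler h i w))" for w
    unfolding euler_error_process_eq[OF h]
    by (intro has_bochner_integral_diff steps) (simp add: has_bochner_integral_iff Gc_integral(1)[OF kh])
  show ?thesis
  proof (rule ito_drift_bound)
    show "ito_L2 (euler_error_process h k) (\<lambda>w. Y w - ?S w)"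
      using ito_L2_diff[OF Y(1) elementary_ito_L2[OF el]]
      unfolding euler_error_process_eq[OF h, symmetric] .
    show "integrable lborel (\<lambda>s. euler_error_process h k s w)" for w
      using hbi by (auto simp: has_bochner_integral_iff)
    show "0 \<le> T" using kh T by linarith
    show "euler_error_process h k s w = 0" if s: "s \<notin> {0<..T}" for s w
      unfolding euler_error_process_def
    proof (rule sum.neutral, intro ballI)
      fix i assume "i \<in> {..<k}"
      then have "real (Suc i) * h \<le> real k * h" using h by (intro mult_right_mono) auto
      moreover have "0 \<le> real i * h" using h by simp
      ultimately show "indicator (cell h i) s *\<^sub>R (Gc s w - euler h i w) = 0"
        using s T by (auto simp: indicator_def simp del: of_nat_Suc)
    qed
    show "AE w in M. Gc (real k * h) w - euler h k w = Y w - ?S w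
      - (1/2) *\<^sub>R (\<integral>s. euler_error_process h k s w \<partial>lborel)"
      using Y(2)
    proof eventually_elim
      case (elim w)
      show ?case
        unfolding elim euler_sum[of h k] has_bochner_integral_integral_eq[OF hbi]
        by (simp add: scaleR_right_diff_distrib del: of_nat_Suc)
    qed
  qed
qed

text \<open>The cells are disjoint, so at most one summand is nonzero and no cross terms
  arise.\<close>

lemma euler_error_process_sq:
  assumes h: "0 \<le> h"
  shows "ennreal ((norm (euler_error_process h k s w))\<^sup>2) =
    (\<Sum>i<k. indicator (cell h i) s * ennreal ((norm (Gc s w - euler h i w))\<^sup>2))"
proof (induction k)
  case (Suc k)
  have z: "euler_error_process h k s w = 0" if "s > real k * h"
    unfolding euler_error_process_def
  proof (rule sum.neutral, intro ballI)
    fix i assume "i \<in> {..<k}"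
    then have "real (Suc i) * h \<le> real k * h" using h by (intro mult_right_mono) auto
    then show "indicator (cell h i) s *\<^sub>R (Gc s w - euler h i w) = 0"
      using that by (auto simp: indicator_def simp del: of_nat_Suc)
  qed
  have eq: "euler_error_process h (Suc k) s w = euler_error_process h k s w
    + indicator (cell h k) s *\<^sub>R (Gc s w - euler h k w)"
    by (simp add: euler_error_process_def)
  show ?case
  proof (cases "s \<in> cell h k")
    case True
    then have "euler_error_process h k s w = 0" using z by simp
    then show ?thesis using True eq Suc by (simp del: of_nat_Suc)
  next
    case False
    then show ?thesis using eq Suc by (simp del: of_nat_Suc)
  qed
qed (simp add: euler_error_process_def)

lemma energy_interval_sum:
  assumes h: "0 \<le> h"
  shows "(\<Sum>i<k. energy M (\<lambda>s w. indicator (cell h i) s *\<^sub>R Gc s w)) =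
    energy M (Gc_on 0 (real k * h))"
proof -
  have sq: "ennreal ((norm (indicator A s *\<^sub>R x))\<^sup>2) = ennreal (indicator A s)
    * ennreal ((norm x)\<^sup>2)" for A s and x :: "complex^'n^'n"
    by (auto simp: indicator_def)
  have [measurable]: "(\<lambda>s. Gc s w) \<in> borel_measurable borel" for w
    using Gc(1) by (rule borel_measurable_continuous_onI)
  note m = measurable_energy_inner[OF Gc_interval_measurable, unfolded sq]
  have "energy M (Gc_on 0 (real k * h)) =
    (\<integral>\<^sup>+w. (\<integral>\<^sup>+s. (\<Sum>i<k. ennreal (indicator (cell h i) s) * ennreal ((norm (Gc s w))\<^sup>2)) \<partial>lborel) \<partial>M)"
    unfolding energy_def sq unfolding interval_decomposition[OF h]
    by (intro nn_integral_cong) (simp only: sum_distrib_right[symmetric] sum_ennreal[OF indicator_pos_le])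
  also have "\<dots> = (\<integral>\<^sup>+w. (\<Sum>i<k. (\<integral>\<^sup>+s. ennreal (indicator (cell h i) s)
    * ennreal ((norm (Gc s w))\<^sup>2) \<partial>lborel)) \<partial>M)"
    by (intro nn_integral_cong nn_integral_sum) simp
  also have "\<dots> = (\<Sum>i<k. \<integral>\<^sup>+w. (\<integral>\<^sup>+s. ennreal (indicator (cell h i) s)
    * ennreal ((norm (Gc s w))\<^sup>2) \<partial>lborel) \<partial>M)"
    by (intro nn_integral_sum m)
  finally show ?thesis unfolding energy_def sq ..
qed

text \<open>On the cell i, the difference of \<open>Gc s\<close> and the iterate is split at the
  grid point into an increment of \<open>Gc\<close> and the error already made. The increment is
  bounded by the energy of its own cell; the cell energies add up to the total energy, so one factor
  h remains without any pointwise bound on the second moment of \<open>G\<close>. Fubini is applied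
  so that this can be done at fixed s.\<close>

lemma energy_euler_error:
  assumes h: "0 \<le> h" and T: "real k * h \<le> T"
  shows "energy M (euler_error_process h k) \<le>
    2 * ennreal h * ennreal (8 + T / 2) * energy M (Gc_on 0 T)
     + 2 * ennreal h * (\<Sum>i<k. L2_sq M (\<lambda>w. Gc (real i * h) w - euler h i w))"
proof -
  let ?a = "\<lambda>i. L2_sq M (\<lambda>w. Gc (real i * h) w - euler h i w)"
  let ?e = "\<lambda>i. energy M (\<lambda>s w. indicator (cell h i) s *\<^sub>R Gc s w)"
  note [measurable] = euler_measurable[OF h] Gc(2)
  have jm: "(\<lambda>x. ennreal ((norm (Gc (fst x) (snd x) - euler h i (snd x)))\<^sup>2)) \<in> borel_measurable
    (lborel \<Otimes>\<^sub>M M)" for i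
  proof -
    have "(\<lambda>x. ennreal ((norm ((\<lambda>(s, w). Gc s w) x - euler h i (snd x)))\<^sup>2)) \<in> borel_measurable
      (lborel \<Otimes>\<^sub>M M)"
      by measurable
    then show ?thesis by (simp add: case_prod_beta')
  qed
  have [measurable]: "(\<lambda>s. Gc s w) \<in> borel_measurable borel" for w
    using Gc(1) by (rule borel_measurable_continuous_onI)
  interpret L: pair_sigma_finite lborel M ..
  have jm': "(\<lambda>(s, w). indicator (cell h i) s * ennreal ((norm (Gc s w
    - euler h i w))\<^sup>2)) \<in> borel_measurable (lborel \<Otimes>\<^sub>M M)" for i
    unfolding case_prod_beta' using jm[of i] by measurable
  have "energy M (euler_error_process h k) =
     (\<integral>\<^sup>+w. (\<Sum>i<k. \<integral>\<^sup>+s. indicator (cell h i) s * ennreal ((norm (Gc s w - euler h i w))\<^sup>2) \<partial>lborel) \<partial>M)"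
    unfolding energy_def euler_error_process_sq[OF h]
    by (intro nn_integral_cong nn_integral_sum) simp
  also have "\<dots> = (\<Sum>i<k. \<integral>\<^sup>+w. (\<integral>\<^sup>+s. indicator (cell h i) s * ennreal ((norm (Gc s w
    - euler h i w))\<^sup>2) \<partial>lborel) \<partial>M)"
    using jm' by (intro nn_integral_sum) measurable
  also have "\<dots> \<le> (\<Sum>i<k. ennreal h * (2 * (ennreal (8 + T / 2) * ?e i) + 2 * ?a i))"
  proof (rule sum_mono)
    fix i assume i: "i \<in> {..<k}"
    have iT: "real (Suc i) * h \<le> T"
      using i h T by (intro order_trans[OF mult_right_mono T]) auto
    have ih: "0 \<le> real i * h" using h by simp
    have "(\<integral>\<^sup>+w. (\<integral>\<^sup>+s. indicator (cell h i) s * ennreal ((norm (Gc s w - euler h i w))\<^sup>2) \<partial>lborel) \<partial>M)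
      = (\<integral>\<^sup>+s. (\<integral>\<^sup>+w. indicator (cell h i) s * ennreal ((norm (Gc s w - euler h i w))\<^sup>2) \<partial>M) \<partial>lborel)"
      by (rule L.Fubini'[OF jm'])
    also have "\<dots> \<le> (\<integral>\<^sup>+s. (2 * (ennreal (8 + T / 2) * ?e i) + 2 * ?a i) * indicator (cell h i) s \<partial>lborel)"
    proof (rule nn_integral_mono)
      fix s
      show "(\<integral>\<^sup>+w. indicator (cell h i) s * ennreal ((norm (Gc s w - euler h i w))\<^sup>2) \<partial>M)
        \<le> (2 * (ennreal (8 + T / 2) * ?e i) + 2 * ?a i) * indicator (cell h i) s"
      proof (cases "s \<in> cell h i")
        case True
        have "L2_sq M (\<lambda>w. Gc s w - euler h i w) =
           L2_sq M (\<lambda>w. (Gc s w - Gc (real i * h) w) - (euler h i w - Gc (real i * h) w))"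
          by simp
        also have "\<dots> \<le> 2 * L2_sq M (\<lambda>w. Gc s w - Gc (real i * h) w) + 2 * L2_sq M (\<lambda>w. euler h i w
          - Gc (real i * h) w)"
          by (rule nn_integral_diff_sq_le) measurable
        also have "L2_sq M (\<lambda>w. euler h i w - Gc (real i * h) w) = ?a i"
          by (simp add: norm_minus_commute)
        also have "L2_sq M (\<lambda>w. Gc s w - Gc (real i * h) w) \<le>
            ennreal (8 + T / 2) * energy M (Gc_on (real i * h) s)"
          using True iT ih by (intro Gc_increment_bound) auto
        also have "energy M (Gc_on (real i * h) s) \<le> ?e i"
          unfolding energy_def
          by (intro nn_integral_mono ennreal_leI power_mono) (use True in \<open>auto simp: indicator_def
            simp del: of_nat_Suc\<close>)
        finally show ?thesis using True by (simp add: mult_left_mono add_mono del: of_nat_Suc)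
      qed (simp del: of_nat_Suc)
    qed
    also have "\<dots> = (2 * (ennreal (8 + T / 2) * ?e i) + 2 * ?a i) * emeasure lborel (cell h i)"
      by (rule nn_integral_cmult_indicator) simp
    also have "emeasure lborel (cell h i) = ennreal h"
      using grid_mono[OF h, of i] by (simp add: algebra_simps)
    finally show "(\<integral>\<^sup>+w. (\<integral>\<^sup>+s. indicator (cell h i) s * ennreal ((norm (Gc s w
      - euler h i w))\<^sup>2) \<partial>lborel) \<partial>M)
      \<le> ennreal h * (2 * (ennreal (8 + T / 2) * ?e i) + 2 * ?a i)" by (simp add: mult.commute)
  qed
  also have "\<dots> = 2 * ennreal h * ennreal (8 + T / 2) * (\<Sum>i<k. ?e i) + 2 * ennreal h * (\<Sum>i<k. ?a i)"
    by (simp add: sum_distrib_left sum.distrib distrib_left mult_ac del: of_nat_Suc)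
  also have "(\<Sum>i<k. ?e i) \<le> energy M (Gc_on 0 T)"
    unfolding energy_interval_sum[OF h] unfolding energy_def
    by (intro nn_integral_mono ennreal_leI power_mono) (use T in \<open>auto simp: indicator_def\<close>)
  finally show ?thesis by (simp add: mult_left_mono add_mono)
qed

text \<open>Combining the two preceding bounds gives a_k \<le> 2hc^2 q + 2hc (a_0 + ... + a_(k-1))
  with c = 8 + T/2 and q the energy of the solution. Gronwall yields a rate 1/n.\<close>

lemma euler_converges:
  assumes T: "0 \<le> T"
  shows "(\<lambda>n. L2_sq M (\<lambda>w. Gc T w - euler (T / real n) n w)) \<longlonglongrightarrow> 0"
proof -
  define c where "c = 8 + T / 2"
  have c: "c \<ge> 0" using T by (simp add: c_def)
  obtain q where q: "q \<ge> 0" "energy M (Gc_on 0 T) = ennreal q"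
    using Gc_energy_finite[OF T] by (cases "energy M (Gc_on 0 T)") auto
  have bound: "L2_sq M (\<lambda>w. Gc T w - euler (T / real n) n w) \<le> ennreal (2 * T * c\<^sup>2 * q * exp (2 * c
    * T) / real n)"
    if n: "n > 0" for n
  proof -
    define h where "h = T / real n"
    have h: "0 \<le> h" "real n * h = T" using n T by (auto simp: h_def)
    let ?a = "\<lambda>k. L2_sq M (\<lambda>w. Gc (real k * h) w - euler h k w)"
    have "?a n \<le> ennreal (2 * h * c\<^sup>2 * q) * (1 + ennreal (2 * h * c)) ^ n"
    proof (rule ennreal_discrete_gronwall)
      fix k assume "k \<le> n"
      then have k: "real k * h \<le> T" unfolding h(2)[symmetric] using h by (intro mult_right_mono) auto
      have "?a k \<le> ennreal c * (2 * ennreal h * ennreal c * ennreal q + 2 * ennreal h * (\<Sum>i<k. ?a i))"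
        unfolding c_def q(2)[symmetric]
        by (rule order_trans[OF euler_error_bound[OF h(1) k] mult_left_mono[OF energy_euler_error[OF
          h(1) k]]]) simp
      also have "\<dots> = ennreal (2 * h * c\<^sup>2 * q) + ennreal (2 * h * c) * (\<Sum>i<k. ?a i)"
        using h c q(1) by (simp add: ennreal_mult distrib_left power2_eq_square mult_ac)
      finally show "?a k \<le> ennreal (2 * h * c\<^sup>2 * q) + ennreal (2 * h * c) * (\<Sum>i<k. ?a i)" .
    qed simp
    also have "(1 + ennreal (2 * h * c)) = ennreal (1 + 2 * h * c)"
      using h c by (simp add: ennreal_plus)
    also have "ennreal (1 + 2 * h * c) ^ n = ennreal ((1 + 2 * h * c) ^ n)"
      by (rule ennreal_power) (use h c in simp)
    also have "ennreal (2 * h * c\<^sup>2 * q) * ennreal ((1 + 2 * h * c) ^ n)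
      = ennreal ((2 * h * c\<^sup>2 * q) * (1 + 2 * h * c) ^ n)"
      using h c q(1) by (simp add: ennreal_mult)
    also have "\<dots> \<le> ennreal ((2 * h * c\<^sup>2 * q) * exp (2 * c * T))"
    proof (intro ennreal_leI mult_left_mono)
      have "(1 + 2 * h * c) ^ n \<le> exp (2 * h * c) ^ n"
        using h c by (intro power_mono) (auto simp: exp_ge_add_one_self)
      also have "\<dots> = exp (2 * c * T)"
        unfolding h(2)[symmetric] by (simp add: exp_of_nat_mult[symmetric] mult_ac)
      finally show "(1 + 2 * h * c) ^ n \<le> exp (2 * c * T)" .
    qed (use h c q in simp)
    finally show ?thesis unfolding h(2) by (simp add: h_def)
  qed
  show ?thesis
  proof (rule tendsto_sandwich[OF _ _ tendsto_const])
    show "\<forall>\<^sub>F n in sequentially. L2_sq M (\<lambda>w. Gc T w - euler (T / real n) n w)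
      \<le> ennreal (2 * T * c\<^sup>2 * q * exp (2 * c * T) / real n)"
      using eventually_gt_at_top[of 0] by eventually_elim (rule bound)
    have "(\<lambda>n. 2 * T * c\<^sup>2 * q * exp (2 * c * T) / real n) \<longlonglongrightarrow> 0"
      by (rule lim_const_over_n)
    then show "(\<lambda>n. ennreal (2 * T * c\<^sup>2 * q * exp (2 * c * T) / real n)) \<longlonglongrightarrow> 0"
      using tendsto_ennrealI by fastforce
  qed auto
qed

end

section \<open>Powers and exponential of operators on tensor powers\<close>

lemma finite_words [simp]: "finite (words d :: (nat \<Rightarrow> 'n::finite) set)"
  by (simp add: words_def finite_PiE)

lemma words_eq_iff: "I \<in> words d \<Longrightarrow> J \<in> words d \<Longrightarrow> I = J \<longleftrightarrow> (\<forall>i\<in>{1..d}. I i = J i)"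
  unfolding words_def by (auto intro: PiE_ext)

lemma prod_of_bool: "finite A \<Longrightarrow> (\<Prod>r\<in>A. of_bool (P r)) = (of_bool (\<forall>r\<in>A. P r) :: 'b::comm_semiring_1)"
  by (induction A rule: finite_induct) auto

lemma op_id_eq:
  assumes "I \<in> words d" "J \<in> words d"
  shows "op_id d I J = of_bool (I = J)"
proof -
  have "op_id d I J = (\<Prod>i\<in>{1..d}. of_bool (I i = J i))"
    by (simp add: op_id_def tensor_def mat_def of_bool_def)
  then show ?thesis by (simp add: prod_of_bool words_eq_iff[OF assms])
qed

lemma op_mult_assoc: "op_mult d (op_mult d A B) C I J = op_mult d A (op_mult d B C) I J"
  unfolding op_mult_def sum_distrib_left sum_distrib_right
  by (subst sum.swap) (simp add: mult.assoc)

lemma op_mult_id_right: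
  assumes "J \<in> words d"
  shows "op_mult d A (op_id d) I J = A I J"
proof -
  have "op_mult d A (op_id d) I J = (\<Sum>L\<in>words d. if L = J then A I J else 0)"
    unfolding op_mult_def by (intro sum.cong) (auto simp: op_id_eq assms)
  then show ?thesis using assms by simp
qed

lemma op_mult_id_left:
  assumes "I \<in> words d"
  shows "op_mult d (op_id d) A I J = A I J"
proof -
  have "op_mult d (op_id d) A I J = (\<Sum>L\<in>words d. if L = I then A I J else 0)"
    unfolding op_mult_def by (intro sum.cong) (auto simp: op_id_eq assms)
  then show ?thesis using assms by simp
qed

lemma op_mult_cong:
  assumes "\<And>L. L \<in> words d \<Longrightarrow> A I L = A' I L" "\<And>L. L \<in> words d \<Longrightarrow> B L J = B' L J"
  shows "op_mult d A B I J = op_mult d A' B' I J"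
  unfolding op_mult_def using assms by (intro sum.cong) auto

text \<open>\<open>op_power\<close> multiplies on the left, whereas an Euler step multiplies on the
  right.\<close>

lemma op_power_commute:
  assumes "I \<in> words d" "J \<in> words d"
  shows "op_mult d (op_power d A r) A I J = op_power d A (Suc r) I J"
  using assms
proof (induction r arbitrary: I J)
  case 0
  then show ?case by (simp add: op_mult_id_left op_mult_id_right)
next
  case (Suc r)
  have "op_mult d (op_power d A (Suc r)) A I J = op_mult d A (op_mult d (op_power d A r) A) I J"
    by (simp add: op_mult_assoc)
  also have "\<dots> = op_mult d A (op_power d A (Suc r)) I J"
    using Suc by (intro op_mult_cong) auto
  finally show ?case by simp
qed

text \<open>The sum of the moduli of all meaningful entries. It is submultiplicative and dominates
  every entry, but the identity has norm equal to the number of words, not 1; this is why such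
  prefactors persist in the bounds.\<close>

definition op_norm :: "nat \<Rightarrow> 'n::finite tensor_op \<Rightarrow> real" where
  "op_norm d A = (\<Sum>I\<in>words d. \<Sum>J\<in>words d. cmod (A I J))"

lemma op_norm_nonneg: "0 \<le> op_norm d A"
  by (simp add: op_norm_def sum_nonneg)

lemma entry_le_op_norm:
  assumes "I \<in> words d" "J \<in> words d"
  shows "cmod (A I J) \<le> op_norm d A"
proof -
  have "cmod (A I J) \<le> (\<Sum>J\<in>words d. cmod (A I J))"
    using assms by (intro member_le_sum) auto
  also have "\<dots> \<le> op_norm d A"
    unfolding op_norm_def using assms by (intro member_le_sum) (auto intro: sum_nonneg)
  finally show ?thesis .
qed

lemma op_norm_triangle:
  assumes "\<And>I J. I \<in> words d \<Longrightarrow> J \<in> words d \<Longrightarrow> cmod (C I J) \<le> cmod (A I J) + cmod (B I J)"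
  shows "op_norm d C \<le> op_norm d A + op_norm d B"
  unfolding op_norm_def sum.distrib[symmetric] using assms by (intro sum_mono)

lemma op_norm_scale: "op_norm d (\<lambda>I J. c * A I J) = cmod c * op_norm d A"
  by (simp add: op_norm_def norm_mult sum_distrib_left)

lemma op_norm_mult: "op_norm d (op_mult d A B) \<le> op_norm d A * op_norm d B"
proof -
  have "op_norm d (op_mult d A B) \<le> (\<Sum>I\<in>words d. \<Sum>J\<in>words d. \<Sum>L\<in>words d. cmod (A I L) * cmod (B L J))"
    unfolding op_norm_def op_mult_def norm_mult[symmetric] by (intro sum_mono norm_sum)
  also have "\<dots> = (\<Sum>I\<in>words d. \<Sum>L\<in>words d. cmod (A I L) * (\<Sum>J\<in>words d. cmod (B L J)))"
    unfolding sum_distrib_left by (intro sum.cong refl sum.swap)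
  also have "\<dots> \<le> (\<Sum>I\<in>words d. \<Sum>L\<in>words d. cmod (A I L) * op_norm d B)"
    unfolding op_norm_def by (intro sum_mono mult_left_mono member_le_sum) (auto intro: sum_nonneg)
  also have "\<dots> = op_norm d A * op_norm d B"
    by (simp add: op_norm_def sum_distrib_right)
  finally show ?thesis .
qed

lemma op_norm_power:
  fixes A :: "'n::finite tensor_op"
  shows "op_norm d (op_power d A r) \<le> op_norm d (op_id d :: 'n tensor_op) * op_norm d A ^ r"
proof (induction r)
  case (Suc r)
  have "op_norm d (op_power d A (Suc r)) \<le> op_norm d A * op_norm d (op_power d A r)"
    by (simp add: op_norm_mult)
  also have "\<dots> \<le> op_norm d A * (op_norm d (op_id d :: 'n tensor_op) * op_norm d A ^ r)"
    by (intro mult_left_mono Suc op_norm_nonneg)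
  finally show ?case by (simp add: mult_ac)
qed simp

section \<open>The powers of 1 + h A and their exponential limit\<close>

lemma op_power_scale: "op_power d (\<lambda>I J. c * A I J) r I J = c ^ r * op_power d A r I J"
  by (induction r arbitrary: I J) (simp_all add: op_mult_def sum_distrib_left mult_ac)

text \<open>The power \<open>(1 + h A) ^ k\<close>, written out by the binomial theorem so that it
  can be compared term by term with the exponential series.\<close>

definition op_binomial :: "nat \<Rightarrow> 'n::finite tensor_op \<Rightarrow> real \<Rightarrow> nat \<Rightarrow> 'n tensor_op" where
  "op_binomial d A h k I J = (\<Sum>r\<le>k. of_nat (k choose r) * of_real h ^ r * op_power d A r I J)"

lemma op_mult_sum_left: "op_mult d (\<lambda>I J. \<Sum>r\<in>R. c r * A r I J) B I J = (\<Sum>r\<in>R. c r * op_mult d (A r) B I J)"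
  unfolding op_mult_def sum_distrib_right sum_distrib_left by (subst sum.swap) (simp add: mult.assoc)

lemma op_binomial_Suc:
  assumes "I \<in> words d" "J \<in> words d"
  shows "op_binomial d A h (Suc k) I J = op_binomial d A h k I J + of_real h
    * op_mult d (op_binomial d A h k) A I J"
proof -
  let ?c = "\<lambda>k r. of_nat (k choose r) * of_real h ^ r :: complex"
  let ?P = "\<lambda>r. op_power d A r I J"
  have m: "op_mult d (op_binomial d A h k) A I J = (\<Sum>r\<le>k. ?c k r * ?P (Suc r))"
    unfolding op_binomial_def[abs_def] op_mult_sum_left
      by (simp add: op_power_commute assms del: op_power.simps)
  have "op_binomial d A h (Suc k) I J = ?P 0 + (\<Sum>r\<le>k. ?c (Suc k) (Suc r) * ?P (Suc r))"
    unfolding op_binomial_def by (subst sum.atMost_Suc_shift) simp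
  also have "(\<Sum>r\<le>k. ?c (Suc k) (Suc r) * ?P (Suc r)) =
      (\<Sum>r\<le>k. of_real h * (?c k r * ?P (Suc r))) + (\<Sum>r\<le>k. ?c k (Suc r) * ?P (Suc r))"
    unfolding sum.distrib[symmetric] by (intro sum.cong) (simp_all add: algebra_simps)
  also have "?P 0 + (\<dots>) = (?P 0 + (\<Sum>r\<le>k. ?c k (Suc r) * ?P (Suc r))) + of_real h
    * op_mult d (op_binomial d A h k) A I J"
    unfolding m by (simp add: sum_distrib_left)
  also have "?P 0 + (\<Sum>r\<le>k. ?c k (Suc r) * ?P (Suc r)) = (\<Sum>r\<le>Suc k. ?c k r * ?P r)"
    by (subst sum.atMost_Suc_shift) simp
  also have "\<dots> = op_binomial d A h k I J"
    by (simp add: op_binomial_def)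
  finally show ?thesis .
qed

lemma binomial_over_power_tendsto: "(\<lambda>n. of_nat (n choose r) / of_nat n ^ r :: complex) \<longlonglongrightarrow> 1 / fact r"
proof (induction r)
  case (Suc r)
  have eq: "of_nat (n choose Suc r) / of_nat n ^ Suc r =
     (of_nat (n choose r) / of_nat n ^ r) * ((1 - of_nat r / of_nat n) / of_nat (Suc r) :: complex)"
       if n: "n > r" for n
  proof -
    have "Suc r * (n choose Suc r) = (n - r) * (n choose r)"
      using n binomial_absorption[of r n] binomial_absorb_comp[of n r] by simp
    then have "of_nat (Suc r) * of_nat (n choose Suc r) = (of_nat n - of_nat r)
      * (of_nat (n choose r) :: complex)"
      using n by (metis of_nat_diff of_nat_mult less_imp_le)
    then have "(of_nat (n choose Suc r) :: complex) = (of_nat n - of_nat r)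
      * of_nat (n choose r) / of_nat (Suc r)"
      by (simp add: nonzero_eq_divide_eq mult.commute del: of_nat_Suc)
    then show ?thesis using n by (simp add: divide_simps del: of_nat_Suc)
  qed
  have "(\<lambda>n. 1 - of_nat r / of_nat n :: complex) \<longlonglongrightarrow> 1 - 0"
    by (intro tendsto_intros lim_const_over_n)
  then have "(\<lambda>n. (of_nat (n choose r) / of_nat n ^ r) * ((1
    - of_nat r / of_nat n) / of_nat (Suc r) :: complex)) \<longlonglongrightarrow> 1 / fact r * ((1 - 0) / of_nat (Suc r))"
    by (intro tendsto_mult Suc tendsto_divide tendsto_const) (simp_all del: of_nat_Suc)
  then have "(\<lambda>n. of_nat (n choose Suc r) / of_nat n ^ Suc r :: complex)
    \<longlonglongrightarrow> 1 / fact r * ((1 - 0) / of_nat (Suc r))"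
    by (rule Lim_transform_eventually) (use eventually_gt_at_top[of r] in \<open>eventually_elim, simp only: eq\<close>)
  then show ?case by (simp add: mult.commute)
qed simp

text \<open>Tannery's theorem: for fixed r the ratio of \<open>n choose r\<close> to
  \<open>n ^ r\<close> tends to \<open>1 / fact r\<close> and never exceeds it, so the exponential
  series of t times the norm of \<open>A\<close> dominates.\<close>

lemma op_binomial_tendsto_exp:
  assumes IJ: "I \<in> words d" "J \<in> words d" and t: "0 \<le> t"
  shows "(\<lambda>n. op_binomial d A (t / real n) n I J) \<longlonglongrightarrow> op_exp d (\<lambda>I J. of_real t * A I J) I J"
proof -
  define a where "a r n = of_nat (n choose r) / of_nat n ^ r * (of_real t ^ r * op_power d A r I J)" for r n
  define M where "M r = op_norm d (op_id d :: 'a tensor_op) * ((t * op_norm d A) ^ r / fact r)" for r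
  have sum: "op_binomial d A (t / real n) n I J = (\<Sum>r. a r n)" for n
  proof -
    have "op_binomial d A (t / real n) n I J = (\<Sum>r\<in>{..n}. a r n)"
      unfolding op_binomial_def a_def by (intro sum.cong) (simp_all add: power_divide)
    also have "\<dots> = (\<Sum>r. a r n)"
      by (rule suminf_finite[symmetric]) (auto simp: a_def binomial_eq_0)
    finally show ?thesis .
  qed
  have bound: "norm (a r n) \<le> M r" for r n
  proof -
    have "real (n choose r) / real n ^ r \<le> 1 / fact r"
    proof (cases "n = 0")
      case False
      have "real ((n choose r) * fact r) \<le> real (n ^ r)"
        by (rule of_nat_mono) (rule binomial_fact_pow)
      then show ?thesis using False by (simp add: divide_simps)
    qed (cases r; simp)
    moreover have "cmod (op_power d A r I J) \<le> op_norm d (op_id d :: 'a tensor_op) * op_norm d A ^ r"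
      using entry_le_op_norm[OF IJ] op_norm_power order_trans by blast
    ultimately have "norm (a r n) \<le> 1 / fact r * (t ^ r * (op_norm d (op_id d :: 'a tensor_op)
      * op_norm d A ^ r))"
      unfolding a_def using t
      by (simp only: norm_mult norm_divide norm_power norm_of_nat norm_of_real abs_of_nonneg)
        (intro mult_mono; simp)
    then show ?thesis by (simp add: M_def power_mult_distrib mult_ac)
  qed
  have "summable M"
    unfolding M_def using summable_exp[of "t * op_norm d A"]
      by (intro summable_mult) (simp add: field_simps)
  have "((\<lambda>n. \<Sum>r. a r n) \<longlongrightarrow> (\<Sum>r. 1 / fact r * (of_real t ^ r * op_power d A r I J))) sequentially"
  proof (rule conjunct2[OF conjunct2[OF tannerys_theorem[OF _ _ \<open>summable M\<close>]]])
    show "(\<lambda>n. a r n) \<longlonglongrightarrow> 1 / fact r * (of_real t ^ r * op_power d A r I J)" for r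
      unfolding a_def by (intro tendsto_mult binomial_over_power_tendsto tendsto_const)
    show "\<forall>\<^sub>F (k, n) in at_top \<times>\<^sub>F sequentially. norm (a k n) \<le> M k"
      using bound by (intro always_eventually) auto
  qed simp
  then show ?thesis
    unfolding sum op_exp_def op_power_scale by simp
qed

text \<open>Stability and consistency of a product of one-step operators. A uniform entrywise error
  \<epsilon> has norm at most \<open>D\<^sup>2 * \<epsilon>\<close>; \<open>D\<^sup>2\<close> also
  bounds the norm of the identity. Stability bounds the products, and each of the k steps then adds
  one local error propagated by \<open>1 + h A\<close>.\<close>

lemma perturbed_powers:
  fixes A :: "'n::finite tensor_op" and e :: "nat \<Rightarrow> 'n tensor_op"
  assumes h: "0 \<le> h" and \<epsilon>: "0 \<le> \<epsilon>"
    and e0: "\<And>I J. I \<in> words d \<Longrightarrow> J \<in> words d \<Longrightarrow> e 0 I J = op_id d I J"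
    and eS: "\<And>k I J. I \<in> words d \<Longrightarrow> J \<in> words d \<Longrightarrow> e (Suc k) I J = op_mult d (e k) (S k) I J"
    and S: "\<And>k I J. I \<in> words d \<Longrightarrow> J \<in> words d \<Longrightarrow> cmod (S k I J - (op_id d I J + of_real h * A I J)) \<le> \<epsilon>"
    and D_def: "D = real (card (words d :: (nat \<Rightarrow> 'n) set))"
  shows "op_norm d (e k) \<le> D\<^sup>2 * exp (real k * (h * op_norm d A + D\<^sup>2 * \<epsilon>))"
    and "op_norm d (\<lambda>I J. e k I J - op_binomial d A h k I J) \<le>
      real k * (D\<^sup>2 * \<epsilon>) * (D\<^sup>2 * exp (real k * (h * op_norm d A + D\<^sup>2 * \<epsilon>))) * exp (real k * (h
        * op_norm d A))"
proof -
  define \<delta> where "\<delta> = D\<^sup>2 * \<epsilon>"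
  define W where "W = h * op_norm d A"
  define R where "R k I J = S k I J - (op_id d I J + of_real h * A I J)" for k I J
  have nn: "0 \<le> \<delta>" "0 \<le> W" "0 \<le> D" using \<epsilon> h by (auto simp: \<delta>_def W_def D_def op_norm_nonneg)
  have R: "op_norm d (R k) \<le> \<delta>" for k
  proof -
    have "op_norm d (R k) \<le> (\<Sum>I\<in>(words d :: (nat \<Rightarrow> 'n) set). \<Sum>J\<in>(words d :: (nat \<Rightarrow> 'n) set). \<epsilon>)"
      unfolding op_norm_def R_def by (intro sum_mono S)
    then show ?thesis by (simp add: \<delta>_def D_def power2_eq_square mult_ac)
  qed
  have step: "e (Suc k) I J = e k I J + of_real h * op_mult d (e k) A I J + op_mult d (e k) (R k) I J"
    if "I \<in> words d" "J \<in> words d" for k I J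
  proof -
    have "op_mult d (e k) (S k) I J = op_mult d (e k) (op_id d) I J + of_real h
      * op_mult d (e k) A I J + op_mult d (e k) (R k) I J"
      unfolding op_mult_def R_def by (simp add: sum_distrib_left sum.distrib[symmetric] algebra_simps)
    then show ?thesis using eS[OF that] op_mult_id_right[OF that(2)] by simp
  qed
  have b1: "op_norm d (e k) \<le> D\<^sup>2 * exp (real k * (W + \<delta>))" for k
  proof (induction k)
    case 0
    have "op_norm d (e 0) \<le> (\<Sum>I\<in>(words d :: (nat \<Rightarrow> 'n) set). \<Sum>J\<in>(words d :: (nat \<Rightarrow> 'n) set). 1)"
      unfolding op_norm_def by (intro sum_mono) (simp add: e0 op_id_eq)
    then show ?case by (simp add: D_def power2_eq_square)
  next
    case (Suc k)
    have "op_norm d (e (Suc k)) \<le> op_norm d (\<lambda>I J. e k I J + of_real h * op_mult d (e k) A I J)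
      + op_norm d (op_mult d (e k) (R k))"
      by (rule op_norm_triangle) (simp add: step norm_triangle_ineq)
    also have "op_norm d (\<lambda>I J. e k I J + of_real h * op_mult d (e k) A I J)
      \<le> op_norm d (e k) + op_norm d (\<lambda>I J. of_real h * op_mult d (e k) A I J)"
      by (rule op_norm_triangle) (rule norm_triangle_ineq)
    also have "op_norm d (\<lambda>I J. of_real h * op_mult d (e k) A I J) = h * op_norm d (op_mult d (e k) A)"
      using h by (simp add: op_norm_scale)
    also have "h * op_norm d (op_mult d (e k) A) \<le> h * (op_norm d (e k) * op_norm d A)"
      by (intro mult_left_mono op_norm_mult h)
    also have "op_norm d (op_mult d (e k) (R k)) \<le> op_norm d (e k) * \<delta>"
      by (intro order_trans[OF op_norm_mult] mult_left_mono R op_norm_nonneg)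
    finally have "op_norm d (e (Suc k)) \<le> op_norm d (e k) * (1 + (W + \<delta>))"
      by (simp add: W_def algebra_simps)
    also have "\<dots> \<le> (D\<^sup>2 * exp (real k * (W + \<delta>))) * exp (W + \<delta>)"
      using nn by (intro mult_mono Suc exp_ge_add_one_self) auto
    also have "\<dots> = D\<^sup>2 * exp (real (Suc k) * (W + \<delta>))"
      by (simp add: exp_add[symmetric] algebra_simps)
    finally show ?case .
  qed
  then show "op_norm d (e k) \<le> D\<^sup>2 * exp (real k * (h * op_norm d A + D\<^sup>2 * \<epsilon>))"
    by (simp add: W_def \<delta>_def)
  let ?g = "op_binomial d A h"
  \<comment> \<open>The stability factor is kept at its final value, with k instead of j, so that it
    is constant during the induction on j.\<close>
  have b2: "op_norm d (\<lambda>I J. e j I J - ?g j I J) \<le> real j * \<delta> * (D\<^sup>2 * exp (real k * (W + \<delta>)))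
    * exp (real j * W)" if "j \<le> k" for j
    using that
  proof (induction j)
    case 0
    have "op_norm d (\<lambda>I J. e 0 I J - ?g 0 I J) = 0"
      unfolding op_norm_def by (intro sum.neutral ballI) (simp add: e0 op_binomial_def)
    then show ?case by simp
  next
    case (Suc j)
    let ?f = "\<lambda>I J. e j I J - ?g j I J"
    let ?B = "D\<^sup>2 * exp (real k * (W + \<delta>))"
    have eq: "e (Suc j) I J - ?g (Suc j) I J = (?f I J + of_real h * op_mult d ?f A I J)
      + op_mult d (e j) (R j) I J"
      if "I \<in> words d" "J \<in> words d" for I J
      unfolding step[OF that] op_binomial_Suc[OF that]
      by (simp add: op_mult_def left_diff_distrib sum_subtractf algebra_simps)
    have "op_norm d (\<lambda>I J. e (Suc j) I J - ?g (Suc j) I J) \<le> op_norm d (\<lambda>I J. ?f I J + of_real h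
      * op_mult d ?f A I J) + op_norm d (op_mult d (e j) (R j))"
      by (rule op_norm_triangle) (simp only: eq norm_triangle_ineq)
    also have "op_norm d (\<lambda>I J. ?f I J + of_real h * op_mult d ?f A I J)
      \<le> op_norm d ?f + op_norm d (\<lambda>I J. of_real h * op_mult d ?f A I J)"
      by (rule op_norm_triangle) (rule norm_triangle_ineq)
    also have "op_norm d (\<lambda>I J. of_real h * op_mult d ?f A I J) = h * op_norm d (op_mult d ?f A)"
      using h by (simp add: op_norm_scale)
    also have "h * op_norm d (op_mult d ?f A) \<le> h * (op_norm d ?f * op_norm d A)"
      by (intro mult_left_mono op_norm_mult h)
    also have "op_norm d (op_mult d (e j) (R j)) \<le> op_norm d (e j) * \<delta>"
      by (intro order_trans[OF op_norm_mult] mult_left_mono R op_norm_nonneg)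
    also have "op_norm d (e j) * \<delta> \<le> ?B * \<delta>"
    proof (intro mult_right_mono order_trans[OF b1])
      show "D\<^sup>2 * exp (real j * (W + \<delta>)) \<le> ?B"
        using nn Suc.prems by (intro mult_left_mono) (auto intro!: mult_right_mono)
    qed (rule nn)
    finally have "op_norm d (\<lambda>I J. e (Suc j) I J - ?g (Suc j) I J) \<le> op_norm d ?f * (1 + W) + ?B * \<delta>"
      by (simp add: W_def algebra_simps)
    also have "\<dots> \<le> (real j * \<delta> * ?B * exp (real j * W)) * exp W + ?B * \<delta> * exp (real (Suc j) * W)"
    proof (rule add_mono)
      show "op_norm d ?f * (1 + W) \<le> (real j * \<delta> * ?B * exp (real j * W)) * exp W"
        using Suc nn by (intro mult_mono exp_ge_add_one_self) auto
      show "?B * \<delta> \<le> ?B * \<delta> * exp (real (Suc j) * W)"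
        using nn mult_left_mono[of 1 "exp (real (Suc j) * W)" "?B * \<delta>"] by simp
    qed
    also have "\<dots> = real (Suc j) * \<delta> * ?B * exp (real (Suc j) * W)"
      by (simp add: exp_add distrib_right distrib_left mult_ac)
    finally show ?case .
  qed
  show "op_norm d (\<lambda>I J. e k I J - op_binomial d A h k I J) \<le>
      real k * (D\<^sup>2 * \<epsilon>) * (D\<^sup>2 * exp (real k * (h * op_norm d A + D\<^sup>2 * \<epsilon>))) * exp (real k * (h
        * op_norm d A))"
    using b2[of k] by (simp add: W_def \<delta>_def)
qed

section \<open>The moments of one Euler step\<close>

definition mixed :: "nat \<Rightarrow> nat \<Rightarrow> complex^'n^'n \<Rightarrow> 'n::finite tensor_op" where
  "mixed n m X = tensor (n + m) (\<lambda>i. if i \<le> n then X else mat_cnj X)"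

definition mixed_entry :: "nat \<Rightarrow> (nat \<Rightarrow> 'n) \<Rightarrow> (nat \<Rightarrow> 'n) \<Rightarrow> complex^'n^'n \<Rightarrow> nat \<Rightarrow> complex" where
  "mixed_entry n I J X i = (if i \<le> n then X $ I i $ J i else cnj (X $ I i $ J i))"

lemma mixed_eq_prod: "mixed n m X I J = (\<Prod>i\<in>{1..n + m}. mixed_entry n I J X i)"
  unfolding mixed_def tensor_def mixed_entry_def by (intro prod.cong) auto

lemma tensor_mult:
  fixes A B :: "nat \<Rightarrow> complex^'n^'n"
  shows "tensor d (\<lambda>i. A i ** B i) I J = op_mult d (tensor d A) (tensor d B) I J"
  unfolding tensor_def op_mult_def words_def
  by (simp add: matrix_matrix_mult_def prod_sum_PiE prod.distrib)

lemma mixed_mult: "mixed n m (X ** Y) I J = op_mult (n + m) (mixed n m X) (mixed n m Y) I J"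
proof -
  have "mat_cnj (X ** Y) = mat_cnj X ** mat_cnj Y"
    by (simp add: vec_eq_iff matrix_matrix_mult_def)
  then have "(\<lambda>i. if i \<le> n then X ** Y else mat_cnj (X ** Y)) =
      (\<lambda>i. (if i \<le> n then X else mat_cnj X) ** (if i \<le> n then Y else mat_cnj Y))"
    by auto
  then show ?thesis unfolding mixed_def by (simp add: tensor_mult)
qed

lemma mixed_one: "mixed n m (mat 1 :: complex^'n::finite^'n) = op_id (n + m)"
proof -
  have "mat_cnj (mat 1) = (mat 1 :: complex^'n^'n)"
    by (simp add: vec_eq_iff mat_def)
  then show ?thesis by (simp add: mixed_def op_id_def cong: if_cong)
qed

lemma borel_measurable_mixed [measurable (raw)]:
  assumes [measurable]: "f \<in> borel_measurable M"
  shows "(\<lambda>w. mixed n m (f w) I J) \<in> borel_measurable M"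
  unfolding mixed_eq_prod mixed_entry_def by measurable

text \<open>Each tensor slot chooses between \<open>X\<close> and the scalar matrix;
  \<open>S\<close> is the set of slots that choose \<open>X\<close>.\<close>

lemma mixed_expand:
  "mixed n m (\<beta> *\<^sub>R mat 1 + X) I J = (\<Sum>S\<in>Pow {1..n + m}. of_real \<beta> ^ card ({1..n + m} - S) *
     of_bool (\<forall>r\<in>{1..n + m} - S. I r = J r) * (\<Prod>i\<in>S. mixed_entry n I J X i))"
proof -
  have "mixed_entry n I J (\<beta> *\<^sub>R mat 1 + X) i = mixed_entry n I J X i + of_real \<beta> * of_bool (I i
    = J i)" for i
    by (auto simp: mixed_entry_def mat_def scaleR_conv_of_real[where 'a = complex])
  then have "mixed n m (\<beta> *\<^sub>R mat 1 + X) I J = (\<Sum>S\<in>Pow {1..n + m}. (\<Prod>i\<in>S. mixed_entry n I J X i) *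
     (\<Prod>i\<in>{1..n + m} - S. of_real \<beta> * of_bool (I i = J i)))"
    unfolding mixed_eq_prod by (subst prod_add[OF finite_atLeastAtMost, symmetric]) simp
  also have "\<dots> = (\<Sum>S\<in>Pow {1..n + m}. of_real \<beta> ^ card ({1..n + m} - S) *
     of_bool (\<forall>r\<in>{1..n + m} - S. I r = J r) * (\<Prod>i\<in>S. mixed_entry n I J X i))"
    by (intro sum.cong refl) (simp add: prod.distrib prod_of_bool mult_ac)
  finally show ?thesis .
qed

section \<open>The entries of the generator\<close>

definition ordered_pairs :: "nat \<Rightarrow> (nat \<times> nat) set" where
  "ordered_pairs d = {(i, j). 1 \<le> i \<and> i < j \<and> j \<le> d}"

lemma finite_ordered_pairs [simp]: "finite (ordered_pairs d)"
  by (rule finite_subset[of _ "{1..d} \<times> {1..d}"]) (auto simp: ordered_pairs_def)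

text \<open>The covariance, per unit time, of the entries of an increment standing in slots i and j.
  Slots of the same kind give minus a transposition; slots of different kinds give plus a
  contraction, since conjugation transposes a skew-Hermitian matrix and changes its sign.\<close>

definition pair_coeff :: "nat \<Rightarrow> (nat \<Rightarrow> 'n::finite) \<Rightarrow> (nat \<Rightarrow> 'n) \<Rightarrow> nat \<Rightarrow> nat \<Rightarrow> complex" where
  "pair_coeff n I J i j = (if i \<le> n \<longleftrightarrow> j \<le> n then - of_bool (I i = J j \<and> J i = I j)
     else of_bool (I i = I j \<and> J i = J j)) / of_nat CARD('n)"

lemma cmod_pair_coeff: "cmod (pair_coeff n I J i j) \<le> 1" for I J :: "nat \<Rightarrow> 'n::finite"
proof -
  have N: "1 \<le> real CARD('n)" using zero_less_card_finite[where 'a = 'n] by linarith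
  have b: "cmod (if P then - of_bool Q else of_bool R) \<le> 1" for P Q R by simp
  have "cmod (pair_coeff n I J i j) \<le> 1 / 1"
    unfolding pair_coeff_def norm_divide norm_of_nat by (intro frac_le zero_le_one zero_less_one N b)
  then show ?thesis by simp
qed

lemma rho_transposition_eq:
  assumes "I \<in> words d" "J \<in> words d" "(i, j) \<in> ordered_pairs d"
  shows "rho_transposition i j I J = of_bool (I i = J j \<and> J i = I j) * of_bool (\<forall>r\<in>{1..d} - {i,
    j}. I r = J r)"
proof -
  have ij: "i \<in> {1..d}" "j \<in> {1..d}" "i \<noteq> j" using assms(3) by (auto simp: ordered_pairs_def)
  have "J \<circ> Transposition.transpose i j \<in> words d"
    using assms(2) ij unfolding words_def
    by (auto simp: PiE_iff extensional_def Transposition.transpose_def)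
  then have "I = J \<circ> Transposition.transpose i j \<longleftrightarrow> (\<forall>r\<in>{1..d}. I r = J (Transposition.transpose i j r))"
    using words_eq_iff[OF assms(1)] by auto
  also have "\<dots> \<longleftrightarrow> (I i = J j \<and> J i = I j) \<and> (\<forall>r\<in>{1..d} - {i, j}. I r = J r)"
  proof -
    have split: "(\<forall>r\<in>{1..d}. P r) \<longleftrightarrow> P i \<and> P j \<and> (\<forall>r\<in>{1..d} - {i, j}. P r)" for P
      using ij by blast
    have "(\<forall>r\<in>{1..d} - {i, j}. I r = J (Transposition.transpose i j r)) \<longleftrightarrow> (\<forall>r\<in>{1..d} - {i, j}. I r = J r)"
      by (intro ball_cong refl) (simp add: Transposition.transpose_def)
    then show ?thesis
      unfolding split[of "\<lambda>r. I r = J (Transposition.transpose i j r)"]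
        by (auto simp: Transposition.transpose_def)
  qed
  finally show ?thesis by (simp add: rho_transposition_def)
qed

lemma elementary_mat_nth': "elementary_mat a b $ i $ j = of_bool (a = i \<and> b = j)"
  by (auto simp: elementary_mat_nth)

text \<open>Slot i pins the matrix unit to a = I i, b = J i, so a single term of the double sum
  survives and slot j imposes the remaining condition.\<close>

lemma rho_contraction_eq:
  fixes I J :: "nat \<Rightarrow> 'n::finite"
  assumes "(i, j) \<in> ordered_pairs d"
  shows "rho_contraction d i j I J = of_bool (I i = I j \<and> J i = J j) * of_bool (\<forall>r\<in>{1..d} - {i,
    j}. I r = J r)"
proof -
  have ij: "i \<in> {1..d}" "j \<in> {1..d}" "i \<noteq> j" using assms by (auto simp: ordered_pairs_def)
  have "tensor d (\<lambda>r. if r = i \<or> r = j then elementary_mat a b else mat 1) I J =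
    of_bool (a = I i \<and> b = J i) * (of_bool (a = I j \<and> b = J j) * of_bool (\<forall>r\<in>{1..d} - {i, j}. I r
      = J r))" for a b :: 'n
  proof -
    let ?f = "\<lambda>r. (if r = i \<or> r = j then elementary_mat a b else mat 1 :: complex^'n^'n) $ I r $ J r"
    have "prod ?f {1..d} = ?f i * (?f j * prod ?f ({1..d} - {i} - {j}))"
      using ij prod.remove[of "{1..d}" i ?f] prod.remove[of "{1..d} - {i}" j ?f]
        by (simp only: finite_Diff finite_atLeastAtMost Diff_iff singleton_iff simp_thms)
    also have "prod ?f ({1..d} - {i} - {j}) = (\<Prod>r\<in>{1..d} - {i} - {j}. of_bool (I r = J r))"
      by (intro prod.cong) (auto simp: mat_def)
    also have "{1..d} - {i} - {j} = {1..d} - {i, j}" by auto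
    finally show ?thesis
      unfolding tensor_def by (simp only: elementary_mat_nth' prod_of_bool finite_Diff
        finite_atLeastAtMost if_True simp_thms)
  qed
  then have "rho_contraction d i j I J = (\<Sum>a\<in>UNIV. \<Sum>b\<in>UNIV. of_bool (a = I i \<and> b
    = J i) * (of_bool (a = I j \<and> b = J j) * of_bool (\<forall>r\<in>{1..d} - {i, j}. I r = J r)))"
    unfolding rho_contraction_def by (intro sum.cong refl)
  also have "\<dots> = of_bool (I i = I j \<and> J i = J j) * of_bool (\<forall>r\<in>{1..d} - {i, j}. I r = J r)"
    by (rule sum_of_bool_pair)
  finally show ?thesis .
qed

text \<open>Puts the generator into the shape produced by \<open>mixed_expand\<close>: a drift term
  for the empty set of slots and one term for each pair, with identity matrices elsewhere. The
  overall minus sign is absorbed by \<open>pair_coeff\<close>.\<close>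

lemma Delta_U_eq:
  fixes I J :: "nat \<Rightarrow> 'n::finite"
  assumes "I \<in> words (n + m)" "J \<in> words (n + m)"
  shows "Delta_U n m I J = - (of_nat (n + m) / 2) * op_id (n + m) I J +
    (\<Sum>(i, j)\<in>ordered_pairs (n + m). pair_coeff n I J i j * of_bool (\<forall>r\<in>{1..n + m} - {i, j}. I r = J r))"
proof -
  let ?t = "\<lambda>i j. of_bool ((i \<le> n \<and> j \<le> n) \<or> (i > n \<and> j > n)) * rho_transposition i j I J
       - of_bool (i \<le> n \<and> n < j) * rho_contraction (n + m) i j I J"
  have "1 / of_nat CARD('n) * ?t i j = - (pair_coeff n I J i j * of_bool (\<forall>r\<in>{1..n + m} - {i,
    j}. I r = J r))"
    if "(i, j) \<in> ordered_pairs (n + m)" for i j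
  proof -
    have "i < j" using that by (simp add: ordered_pairs_def)
    then show ?thesis
      unfolding rho_transposition_eq[OF assms that] rho_contraction_eq[OF that] pair_coeff_def
      by (cases "i \<le> n"; cases "j \<le> n") simp_all
  qed
  then have "1 / of_nat CARD('n) * (\<Sum>(i, j)\<in>ordered_pairs (n + m). ?t i j) =
      - (\<Sum>(i, j)\<in>ordered_pairs (n + m). pair_coeff n I J i j * of_bool (\<forall>r\<in>{1..n + m} - {i, j}. I r = J r))"
    unfolding sum_distrib_left sum_negf[symmetric] by (intro sum.cong) auto
  then show ?thesis
    unfolding Delta_U_def rho_scalar_def ordered_pairs_def[symmetric]
      by (simp add: add_divide_distrib algebra_simps)
qed

text \<open>Every factor is at most the largest one. In place of Hoelder's inequality, this reduces
  mixed moments to moments of single entries.\<close>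

lemma prod_le_sum_power:
  fixes x :: "'i \<Rightarrow> real"
  assumes "finite S" "S \<noteq> {}" "\<And>i. i \<in> S \<Longrightarrow> 0 \<le> x i"
  shows "(\<Prod>i\<in>S. x i) \<le> (\<Sum>i\<in>S. x i ^ card S)"
proof -
  obtain k where k: "k \<in> S" "\<And>i. i \<in> S \<Longrightarrow> x i \<le> x k"
    using assms(1,2) obtains_MAX[of S x] by (metis Max_ge finite_imageI image_eqI)
  have "(\<Prod>i\<in>S. x i) \<le> (\<Prod>i\<in>S. x k)"
    using assms(3) k(2) by (intro prod_mono) auto
  also have "\<dots> = x k ^ card S" by simp
  also have "\<dots> \<le> (\<Sum>i\<in>S. x i ^ card S)"
    using assms k(1) by (intro member_le_sum) auto
  finally show ?thesis .
qed

lemma one_minus_power_bounds: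
  fixes x :: real
  assumes "0 \<le> x" "x \<le> 1"
  shows "\<bar>1 - (1 - x) ^ d\<bar> \<le> real d * x" "\<bar>(1 - x) ^ d - (1 - real d * x)\<bar> \<le> (real d)\<^sup>2 * x\<^sup>2"
proof -
  have le1: "0 \<le> (1 - x) ^ d" "(1 - x) ^ d \<le> 1" for d using assms by (auto intro: power_le_one)
  have bern: "1 - real d * x \<le> (1 - x) ^ d" for d
    using Bernoulli_inequality[of "- x" d] assms by simp
  show "\<bar>1 - (1 - x) ^ d\<bar> \<le> real d * x" using le1[of d] bern[of d] by simp
  have "(1 - x) ^ d - (1 - real d * x) \<le> (real d)\<^sup>2 * x\<^sup>2"
  proof (induction d)
    case (Suc d)
    have "(1 - x) ^ Suc d - (1 - real (Suc d) * x) = ((1 - x) ^ d - (1 - real d * x)) + x * (1 - (1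
      - x) ^ d)"
      by (simp add: algebra_simps)
    also have "\<dots> \<le> (real d)\<^sup>2 * x\<^sup>2 + x * (real d * x)"
      using assms bern[of d] by (intro add_mono Suc mult_left_mono) auto
    also have "\<dots> = ((real d)\<^sup>2 + real d) * x\<^sup>2" by (simp add: power2_eq_square algebra_simps)
    also have "\<dots> \<le> (real (Suc d))\<^sup>2 * x\<^sup>2"
      by (intro mult_right_mono) (simp_all add: power2_eq_square algebra_simps)
    finally show ?case .
  qed simp
  then show "\<bar>(1 - x) ^ d - (1 - real d * x)\<bar> \<le> (real d)\<^sup>2 * x\<^sup>2"
    using bern[of d] by simp
qed

section \<open>Expectations of products of increment entries\<close>

context u_bm
begin

lemma mixed_entry_mean:
  assumes "0 \<le> s" "s \<le> t"
  shows "has_bochner_integral M (\<lambda>w. mixed_entry n I J (incr s t w) i) 0"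
  using incr_mean[OF assms, of "I i" "J i"] has_bochner_integral_cnj[OF incr_mean[OF assms, of "I i" "J i"]]
  by (cases "i \<le> n") (simp_all add: mixed_entry_def)

lemma mixed_entry_covariance:
  assumes st: "0 \<le> s" "s \<le> t" and ij: "i < j"
  shows "has_bochner_integral M (\<lambda>w. mixed_entry n I J (incr s t w) i * mixed_entry n I J (incr s t w) j)
    (of_real (t - s) * pair_coeff n I J i j)"
proof -
  note c = incr_covariance[OF st]
  consider "i \<le> n" "j \<le> n" | "i \<le> n" "\<not> j \<le> n" | "\<not> i \<le> n" "\<not> j \<le> n"
    using ij by linarith
  then show ?thesis
  proof cases
    case 1
    then show ?thesis
      by (intro has_bochner_integral_cong'[OF c[of "I i" "J i" "I j" "J j"]])
        (auto simp: mixed_entry_def pair_coeff_def diff_divide_distrib)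
  next
    case 2
    \<comment> \<open>The conjugated entry at (I j, J j) equals minus the entry at (J j, I
      j).\<close>
    have "has_bochner_integral M (\<lambda>w. - (incr s t w $ I i $ J i * incr s t w $ J j $ I j))
      (- (- of_real (t - s) / of_nat CARD('n) * of_bool (I i = I j \<and> J i = J j)))"
      by (intro has_bochner_integral_minus c)
    then show ?thesis using 2
      by (rule_tac has_bochner_integral_cong') (auto simp: mixed_entry_def pair_coeff_def
        incr_cnj[OF st] diff_divide_distrib)
  next
    case 3
    then show ?thesis
      by (intro has_bochner_integral_cong'[OF has_bochner_integral_cnj[OF c[of "I i" "J i" "I j" "J j"]]])
        (auto simp: mixed_entry_def pair_coeff_def diff_divide_distrib)
  qed
qed

lemma mixed_entry_measurable:
  assumes "0 \<le> s" "s \<le> t"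
  shows "(\<lambda>w. mixed_entry n I J (incr s t w) i) \<in> borel_measurable M"
  using incr_measurable[OF assms] unfolding mixed_entry_def by measurable

lemma mixed_entry_product_bound:
  obtains C where "C \<ge> 0" "\<And>s t n I J S. 0 \<le> s \<Longrightarrow> s \<le> t \<Longrightarrow> finite S \<Longrightarrow> card S = k \<Longrightarrow>
    integrable M (\<lambda>w. \<Prod>i\<in>S. mixed_entry n I J (incr s t w) i) \<and>
    cmod (\<integral>w. (\<Prod>i\<in>S. mixed_entry n I J (incr s t w) i) \<partial>M) \<le> C * sqrt (t - s) ^ k"
proof -
  obtain C where C: "\<And>s t a b. 0 \<le> s \<Longrightarrow> s \<le> t \<Longrightarrow>
    integrable M (\<lambda>w. cmod (incr s t w $ a $ b) ^ k) \<and>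
    (\<integral>w. cmod (incr s t w $ a $ b) ^ k \<partial>M) \<le> C * sqrt (t - s) ^ k"
    using incr_abs_moment by metis
  show ?thesis
  proof (rule that)
    \<comment> \<open>The summand 1 is for the empty set, where the product has expectation 1 while
      \<open>real k * \<bar>C\<bar>\<close> is 0.\<close>
    show "0 \<le> 1 + real k * \<bar>C\<bar>" by simp
    fix s t :: real and n and I J :: "nat \<Rightarrow> 'n" and S :: "nat set"
    assume st: "0 \<le> s" "s \<le> t" and S: "finite S" "card S = k"
    let ?\<kappa> = "\<lambda>i w. mixed_entry n I J (incr s t w) i"
    show "integrable M (\<lambda>w. \<Prod>i\<in>S. ?\<kappa> i w) \<and> cmod (\<integral>w. (\<Prod>i\<in>S. ?\<kappa> i w) \<partial>M)
      \<le> (1 + real k * \<bar>C\<bar>) * sqrt (t - s) ^ k"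
    proof (cases "S = {}")
      case True
      then show ?thesis using S by (simp add: prob_space)
    next
      case False
      have le: "cmod (\<Prod>i\<in>S. ?\<kappa> i w) \<le> (\<Sum>i\<in>S. cmod (incr s t w $ I i $ J i) ^ k)" for w
      proof -
        have "cmod (?\<kappa> i w) = cmod (incr s t w $ I i $ J i)" for i by (simp add: mixed_entry_def)
        then show ?thesis
          using prod_le_sum_power[OF S(1) False, of "\<lambda>i. cmod (?\<kappa> i w)"] unfolding prod_norm S(2) by simp
      qed
      have i: "integrable M (\<lambda>w. \<Sum>i\<in>S. cmod (incr s t w $ I i $ J i) ^ k)"
        using C[OF st] by simp
      have I: "integrable M (\<lambda>w. \<Prod>i\<in>S. ?\<kappa> i w)"
      proof (rule Bochner_Integration.integrable_bound[OF i])
        show "(\<lambda>w. \<Prod>i\<in>S. ?\<kappa> i w) \<in> borel_measurable M"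
          using mixed_entry_measurable[OF st] by measurable
        show "AE w in M. norm (\<Prod>i\<in>S. ?\<kappa> i w) \<le> norm (\<Sum>i\<in>S. cmod (incr s t w $ I i $ J i) ^ k)"
          unfolding real_norm_def by (intro AE_I2 order_trans[OF le abs_ge_self])
      qed
      have "cmod (\<integral>w. (\<Prod>i\<in>S. ?\<kappa> i w) \<partial>M) \<le> (\<integral>w. (\<Sum>i\<in>S. cmod (incr s t w $ I i $ J i) ^ k) \<partial>M)"
        by (intro order_trans[OF integral_norm_bound integral_mono] integrable_norm I i le)
      also have "\<dots> = (\<Sum>i\<in>S. \<integral>w. cmod (incr s t w $ I i $ J i) ^ k \<partial>M)"
        using C[OF st] by simp
      also have "\<dots> \<le> (\<Sum>i\<in>S. C * sqrt (t - s) ^ k)"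
        using C[OF st] by (intro sum_mono) auto
      also have "\<dots> = real k * C * sqrt (t - s) ^ k" using S(2) by simp
      also have "\<dots> \<le> (1 + real k * \<bar>C\<bar>) * sqrt (t - s) ^ k"
        using st by (intro mult_right_mono) (auto intro: order_trans[OF mult_left_mono[OF abs_ge_self]])
      finally show ?thesis using I by simp
    qed
  qed
qed

text \<open>The expansion over slot sets \<open>S\<close> is sorted by size. Size 0 gives a power of
  1 - h/2, linear in h up to a quadratic error; size 1 vanishes because increments are centered;
  size 2 gives h times the pair coefficients up to order h^2; size 3 or more is of order
  \<open>sqrt h ^ 3\<close> by scaling.\<close>

lemma one_step_moments:
  fixes n m :: nat
  obtains C where "C \<ge> 0" "\<And>s h I J. 0 \<le> s \<Longrightarrow> 0 \<le> h \<Longrightarrow> h \<le> 1 \<Longrightarrow> I \<in> words (n + m) \<Longrightarrow> J \<in> words (n + m) \<Longrightarrow>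
    integrable M (\<lambda>w. mixed n m ((1 - h / 2) *\<^sub>R mat 1 + incr s (s + h) w) I J) \<and>
    cmod ((\<integral>w. mixed n m ((1 - h / 2) *\<^sub>R mat 1 + incr s (s + h) w) I J \<partial>M)
      - (op_id (n + m) I J + of_real h * Delta_U n m I J)) \<le> C * sqrt h ^ 3"
proof -
  define d where "d = n + m"
  define D where "D = {1..d}"
  \<comment> \<open>Bundles the conditions on a constant, so that one constant for every size k can
    be chosen at once.\<close>
  define Q where "Q k C \<longleftrightarrow> C \<ge> 0 \<and> (\<forall>s t I J S. 0 \<le> s \<longrightarrow> s \<le> t \<longrightarrow> finite S \<longrightarrow> card S = k \<longrightarrow>
    integrable M (\<lambda>w. \<Prod>i\<in>S. mixed_entry n I J (incr s t w) i) \<and>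
    cmod (\<integral>w. (\<Prod>i\<in>S. mixed_entry n I J (incr s t w) i) \<partial>M) \<le> C * sqrt (t - s) ^ k)" for k C
  have "\<exists>C. Q k C" for k
    unfolding Q_def by (rule mixed_entry_product_bound[of k]) blast
  then obtain c where Q: "\<And>k. Q k (c k)" by metis
  have c: "\<And>k. c k \<ge> 0" "\<And>k s t I J S. 0 \<le> s \<Longrightarrow> s \<le> t \<Longrightarrow> finite S \<Longrightarrow> card S = k \<Longrightarrow>
    integrable M (\<lambda>w. \<Prod>i\<in>S. mixed_entry n I J (incr s t w) i) \<and>
    cmod (\<integral>w. (\<Prod>i\<in>S. mixed_entry n I J (incr s t w) i) \<partial>M) \<le> c k * sqrt (t - s) ^ k"
    using Q unfolding Q_def by blast+
  \<comment> \<open>One summand for each kind of slot set: the empty set, pairs, and sets of three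
    or more slots. The factor \<open>2 ^ d\<close> below counts the slot sets.\<close>
  define C where "C = (real d)\<^sup>2 + real d + (\<Sum>k\<le>d. c k)"
  show ?thesis
  proof (rule that)
    show "0 \<le> 2 ^ d * C" unfolding C_def using c(1) by (intro mult_nonneg_nonneg add_nonneg_nonneg
      sum_nonneg) auto
    fix s h :: real and I J :: "nat \<Rightarrow> 'n"
    assume s: "0 \<le> s" and h: "0 \<le> h" "h \<le> 1" and IJ: "I \<in> words (n + m)" "J \<in> words (n + m)"
    have sh: "s \<le> s + h" using h by simp
    let ?\<beta> = "1 - h / 2"
    let ?P = "\<lambda>S w. \<Prod>i\<in>S. mixed_entry n I J (incr s (s + h) w) i"
    let ?b = "\<lambda>S. of_bool (\<forall>r\<in>D - S. I r = J r) :: complex"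
    have fin: "finite S" "card S \<le> d" if "S \<in> Pow D" for S
      using that card_mono[of D S] by (auto simp: D_def finite_subset)
    have expand: "mixed n m (?\<beta> *\<^sub>R mat 1 + incr s (s + h) w) I J
      = (\<Sum>S\<in>Pow D. of_real ?\<beta> ^ card (D - S) * ?b S * ?P S w)" for w
      unfolding mixed_expand D_def d_def ..
    have Pint: "integrable M (?P S)" and Pb: "cmod (\<integral>w. ?P S w \<partial>M) \<le> c (card S) * sqrt h ^ card S"
      if "S \<in> Pow D" for S
      using c(2)[OF s sh fin(1)[OF that] refl] by auto
    have int: "integrable M (\<lambda>w. mixed n m (?\<beta> *\<^sub>R mat 1 + incr s (s + h) w) I J)"
      unfolding expand by (intro Bochner_Integration.integrable_sum integrable_mult_right Pint)
    define E where "E S = of_real ?\<beta> ^ card (D - S) * ?b S * (\<integral>w. ?P S w \<partial>M)" for S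
    have E: "(\<integral>w. mixed n m (?\<beta> *\<^sub>R mat 1 + incr s (s + h) w) I J \<partial>M) = (\<Sum>S\<in>Pow D. E S)"
      unfolding expand E_def by (subst Bochner_Integration.integral_sum) (simp_all add: Pint)
    \<comment> \<open>The target operator distributed over slot sets, so that it can be compared
      with the expectation summand by summand.\<close>
    define A where "A S = (if S = {} then (1 - of_real (real d * (h / 2))) * ?b {} else 0) +
       (\<Sum>(i, j)\<in>ordered_pairs d. if S = {i, j} then of_real h * pair_coeff n I J i j * ?b {i,
         j} else 0)" for S
    have "(\<Sum>S\<in>Pow D. A S) = (1 - of_real (real d * (h / 2))) * ?b {} +
       (\<Sum>(i, j)\<in>ordered_pairs d. of_real h * pair_coeff n I J i j * ?b {i, j})"
    proof -
      have "(\<Sum>S\<in>Pow D. (\<Sum>(i, j)\<in>ordered_pairs d. if S = {i,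
        j} then of_real h * pair_coeff n I J i j * ?b {i, j} else 0)) =
         (\<Sum>(i, j)\<in>ordered_pairs d. (\<Sum>S\<in>Pow D. if S = {i,
           j} then of_real h * pair_coeff n I J i j * ?b {i, j} else 0))"
        by (subst sum.swap) (simp add: case_prod_beta')
      also have "\<dots> = (\<Sum>(i, j)\<in>ordered_pairs d. of_real h * pair_coeff n I J i j * ?b {i, j})"
      proof (intro sum.cong refl, clarify)
        fix i j assume "(i, j) \<in> ordered_pairs d"
        then have "{i, j} \<in> Pow D" by (auto simp: ordered_pairs_def D_def)
        then show "(\<Sum>S\<in>Pow D. if S = {i, j} then of_real h * pair_coeff n I J i j * ?b {i,
          j} else 0) = of_real h * pair_coeff n I J i j * ?b {i, j}"
          by (subst sum.delta) (simp_all add: D_def)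
      qed
      finally show ?thesis
        unfolding A_def sum.distrib by (subst sum.delta) (auto simp: D_def)
    qed
    also have "\<dots> = op_id (n + m) I J + of_real h * Delta_U n m I J"
    proof -
      have "?b {} = op_id (n + m) I J"
        using IJ by (simp add: op_id_eq words_eq_iff[OF IJ] D_def d_def)
      then show ?thesis
        unfolding Delta_U_eq[OF IJ] d_def[symmetric] D_def[symmetric]
        by (simp add: algebra_simps sum_distrib_left case_prod_beta'
            del: sum_mult_of_bool_eq sum_of_bool_mult_eq)
    qed
    finally have A: "(\<Sum>S\<in>Pow D. A S) = op_id (n + m) I J + of_real h * Delta_U n m I J" .
    \<comment> \<open>The quadratic errors are absorbed into the order 3/2, which is where h \<le> 1
      enters.\<close>
    have h43: "h\<^sup>2 \<le> sqrt h ^ 3"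
    proof -
      have "h\<^sup>2 = sqrt h ^ 4" using h(1) by (metis numeral_Bit0 power_add power2_eq_square
        real_sqrt_pow2 mult_2)
      also have "\<dots> \<le> sqrt h ^ 3" using h by (intro power_decreasing) auto
      finally show ?thesis .
    qed
    have C_ge: "(real d)\<^sup>2 \<le> C" "real d \<le> C" "\<And>k. k \<le> d \<Longrightarrow> c k \<le> C" "0 \<le> C"
    proof -
      have "0 \<le> (\<Sum>k\<le>d. c k)" using c(1) by (intro sum_nonneg)
      then show "(real d)\<^sup>2 \<le> C" "real d \<le> C" "0 \<le> C" by (simp_all add: C_def)
      show "c k \<le> C" if "k \<le> d" for k
        using member_le_sum[of k "{..d}" c] that c(1) by (simp add: C_def add_increasing)
    qed
    have bb: "cmod (?b S) \<le> 1" for S by simp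
    have \<beta>: "0 \<le> ?\<beta>" "?\<beta> \<le> 1" using h by auto
    have diff: "cmod (E S - A S) \<le> C * sqrt h ^ 3" if S: "S \<in> Pow D" for S
    proof -
      note finS = fin[OF S]
      consider "card S = 0" | "card S = 1" | "card S = 2" | "card S \<ge> 3" by linarith
      then show ?thesis
      proof cases
        case 1
        then have [simp]: "S = {}" using finS by simp
        have "A {} = (1 - of_real (real d * (h / 2))) * ?b {}"
          unfolding A_def by (simp add: case_prod_beta')
        then have "E S - A S = of_real (?\<beta> ^ d - (1 - real d * (h / 2))) * ?b {}"
          by (simp add: E_def prob_space left_diff_distrib D_def)
        also have "cmod \<dots> \<le> \<bar>?\<beta> ^ d - (1 - real d * (h / 2))\<bar> * 1"
          unfolding norm_mult norm_of_real by (intro mult_mono bb) simp_all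
        also have "\<dots> \<le> (real d)\<^sup>2 * (h / 2)\<^sup>2"
          using one_minus_power_bounds(2)[of "h / 2" d] h by simp
        also have "\<dots> \<le> C * sqrt h ^ 3"
          by (intro mult_mono C_ge order_trans[OF _ h43]) (auto simp: power_divide C_ge)
        finally show ?thesis .
      next
        case 2
        then obtain i where i: "S = {i}" by (auto simp: card_1_singleton_iff)
        have "(\<integral>w. ?P S w \<partial>M) = 0"
          using mixed_entry_mean[OF s sh, of n I J i] by (simp add: i has_bochner_integral_iff)
        moreover have "A S = 0"
          unfolding A_def i by (auto intro!: sum.neutral simp: ordered_pairs_def)
        ultimately show ?thesis using C_ge h by (simp add: E_def)
      next
        case 3
        then obtain i j where ij: "S = {i, j}" "i < j"
          by (metis card_2_iff insert_commute linorder_neqE_nat)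
        then have p: "(i, j) \<in> ordered_pairs d" using S by (auto simp: ordered_pairs_def D_def)
        have "(\<integral>w. ?P S w \<partial>M) = of_real h * pair_coeff n I J i j"
          using mixed_entry_covariance[OF s sh ij(2), of n I J] ij by (simp add: has_bochner_integral_iff)
        moreover have "A S = of_real h * pair_coeff n I J i j * ?b S"
        proof -
          have "(\<Sum>(i', j')\<in>ordered_pairs d. if S = {i',
            j'} then of_real h * pair_coeff n I J i' j' * ?b {i', j'} else 0) =
            (\<Sum>q\<in>ordered_pairs d. if q = (i, j) then of_real h * pair_coeff n I J i j * ?b S else 0)"
          proof (intro sum.cong refl, clarify)
            fix a b assume "(a, b) \<in> ordered_pairs d"
            then have "S = {a, b} \<longleftrightarrow> (a, b) = (i, j)"
              using ij by (auto simp: ordered_pairs_def doubleton_eq_iff)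
            then show "(if S = {a, b} then of_real h * pair_coeff n I J a b * ?b {a, b} else 0) =
                (if (a, b) = (i, j) then of_real h * pair_coeff n I J i j * ?b S else 0)"
              by (cases "(a, b) = (i, j)") auto
          qed
          then show ?thesis using ij p by (simp add: A_def)
        qed
        ultimately have "E S - A S = of_real (- (1 - ?\<beta> ^ card (D - S))) * (of_real h
          * pair_coeff n I J i j * ?b S)"
          by (simp add: E_def algebra_simps)
        also have "cmod \<dots> \<le> \<bar>1 - ?\<beta> ^ card (D - S)\<bar> * (h * 1 * 1)"
          unfolding norm_mult norm_of_real using h
          by (intro mult_mono cmod_pair_coeff bb) auto
        also have "\<bar>1 - ?\<beta> ^ card (D - S)\<bar> \<le> real (card (D - S)) * (h / 2)"
          using one_minus_power_bounds(1)[of "h / 2" "card (D - S)"] h by simp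
        also have "real (card (D - S)) * (h / 2) \<le> real d * h"
          using card_mono[of D "D - S"] h by (intro mult_mono) (auto simp: D_def)
        finally have "cmod (E S - A S) \<le> real d * h\<^sup>2"
          using h by (simp add: power2_eq_square mult_right_mono)
        also have "\<dots> \<le> C * sqrt h ^ 3" by (intro mult_mono C_ge h43) (auto simp: C_ge)
        finally show ?thesis .
      next
        case 4
        have "A S = 0"
        proof -
          have "S \<noteq> {i, j}" for i j
            using 4 by (metis card_2_iff card.insert card.empty insert_absorb2 finite.emptyI
              is_singletonI is_singleton_altdef not_less_eq_eq numeral_2_eq_2 numeral_3_eq_3
                Suc_n_not_le_n le_SucI One_nat_def)
          moreover have "S \<noteq> {}" using 4 by auto
          ultimately show ?thesis unfolding A_def by (auto intro!: sum.neutral)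
        qed
        then have "cmod (E S - A S) = cmod (of_real ?\<beta> ^ card (D - S)) * cmod (?b S) * cmod (\<integral>w. ?P S w \<partial>M)"
          by (simp add: E_def norm_mult)
        also have "\<dots> \<le> 1 * 1 * (c (card S) * sqrt h ^ card S)"
        proof (intro mult_mono bb Pb S)
          show "cmod (of_real ?\<beta> ^ card (D - S)) \<le> 1"
            unfolding norm_power norm_of_real using \<beta> by (intro power_le_one) auto
        qed (use c(1) h in auto)
        also have "\<dots> \<le> C * sqrt h ^ 3"
          using C_ge finS(2) h 4 by (simp, intro mult_mono power_decreasing) auto
        finally show ?thesis .
      qed
    qed
    have "cmod ((\<Sum>S\<in>Pow D. E S) - (\<Sum>S\<in>Pow D. A S)) \<le> (\<Sum>S\<in>Pow D. C * sqrt h ^ 3)"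
      unfolding sum_subtractf[symmetric] by (intro order_trans[OF norm_sum] sum_mono diff)
    also have "\<dots> = 2 ^ d * C * sqrt h ^ 3" by (simp add: D_def card_Pow)
    finally show "integrable M (\<lambda>w. mixed n m (?\<beta> *\<^sub>R mat 1 + incr s (s + h) w) I J) \<and>
      cmod ((\<integral>w. mixed n m (?\<beta> *\<^sub>R mat 1 + incr s (s + h) w) I J \<partial>M)
      - (op_id (n + m) I J + of_real h * Delta_U n m I J)) \<le> 2 ^ d * C * sqrt h ^ 3"
      using int unfolding E A by simp
  qed
qed

end

section \<open>Passage to the limit\<close>

text \<open>A form of Vitali's theorem. Fatou puts the limit in L2 with the same bound; boundedness
  in L2 then controls the large values of |Z k - Z'| and dominated convergence the truncated
  ones.\<close>

lemma (in prob_space) bounded_L2_expectation_tendsto: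
  fixes Z :: "nat \<Rightarrow> 'a \<Rightarrow> complex"
  assumes [measurable]: "\<And>k. Z k \<in> borel_measurable M" "Z' \<in> borel_measurable M"
    and int: "\<And>k. square_integrable M (Z k)"
    and B: "\<And>k. (\<integral>w. (cmod (Z k w))\<^sup>2 \<partial>M) \<le> B"
    and lim: "AE w in M. (\<lambda>k. Z k w) \<longlonglongrightarrow> Z' w"
  shows "integrable M Z'" "(\<lambda>k. \<integral>w. Z k w \<partial>M) \<longlonglongrightarrow> (\<integral>w. Z' w \<partial>M)"
proof -
  have B0: "0 \<le> B"
    by (rule order_trans[OF _ B[of 0]]) (auto intro!: integral_nonneg_AE)
  have nn: "L2_sq M (Z k) \<le> ennreal B" for k
    using nn_integral_eq_integral[OF int[of k]] B[of k] by (simp add: ennreal_leI)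
  have "L2_sq M Z' = (\<integral>\<^sup>+w. liminf (\<lambda>k. ennreal ((cmod (Z k w))\<^sup>2)) \<partial>M)"
  proof (rule nn_integral_cong_AE)
    show "AE w in M. ennreal ((cmod (Z' w))\<^sup>2) = liminf (\<lambda>k. ennreal ((cmod (Z k w))\<^sup>2))"
      using lim
    proof eventually_elim
      case (elim w)
      then have "(\<lambda>k. ennreal ((cmod (Z k w))\<^sup>2)) \<longlonglongrightarrow> ennreal ((cmod (Z' w))\<^sup>2)"
        by (intro tendsto_ennrealI tendsto_intros)
      then show ?case by (intro lim_imp_Liminf[symmetric]) auto
    qed
  qed
  also have "\<dots> \<le> liminf (\<lambda>k. L2_sq M (Z k))"
    by (rule nn_integral_liminf) simp
  also have "\<dots> \<le> ennreal B"
    using nn by (intro Liminf_le) auto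
  finally have nn': "L2_sq M Z' \<le> ennreal B" .
  have int': "square_integrable M Z'"
    using nn' by (intro integrableI_bounded) (auto intro: le_less_trans)
  have B': "(\<integral>w. (cmod (Z' w))\<^sup>2 \<partial>M) \<le> B"
    using nn' nn_integral_eq_integral[OF int'] B0 by (simp add: ennreal_le_iff)
  have L1: "integrable M f" if "f \<in> borel_measurable M" "square_integrable M f" for f :: "'a \<Rightarrow> complex"
  proof -
    have "integrable M (\<lambda>w. f w * 1)"
      using that by (intro square_integrable_mult) auto
    then show ?thesis by simp
  qed
  show "integrable M Z'" by (rule L1[OF _ int']) simp
  define W where "W k w = cmod (Z k w - Z' w)" for k w
  have [measurable]: "W k \<in> borel_measurable M" for k unfolding W_def[abs_def] by simp
  have Wle: "(W k w)\<^sup>2 \<le> 2 * (cmod (Z k w))\<^sup>2 + 2 * (cmod (Z' w))\<^sup>2" for k w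
    unfolding W_def using norm_add_sq_le[of "Z k w" "- Z' w"] by simp
  have W2: "integrable M (\<lambda>w. (W k w)\<^sup>2)" for k
    by (rule Bochner_Integration.integrable_bound[where f = "\<lambda>w. 2 * (cmod (Z k w))\<^sup>2 + 2
      * (cmod (Z' w))\<^sup>2"])
      (use int int' in \<open>auto intro!: AE_I2 order_trans[OF Wle]\<close>)
  have W2B: "(\<integral>w. (W k w)\<^sup>2 \<partial>M) \<le> 4 * B" for k
  proof -
    have "(\<integral>w. (W k w)\<^sup>2 \<partial>M) \<le> (\<integral>w. 2 * (cmod (Z k w))\<^sup>2 + 2 * (cmod (Z' w))\<^sup>2 \<partial>M)"
      using int int' by (intro integral_mono W2 Wle) auto
    also have "\<dots> = 2 * (\<integral>w. (cmod (Z k w))\<^sup>2 \<partial>M) + 2 * (\<integral>w. (cmod (Z' w))\<^sup>2 \<partial>M)"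
      using int int' by simp
    finally show ?thesis using B[of k] B' by linarith
  qed
  have W1: "integrable M (W k)" for k
    unfolding W_def[abs_def] by (intro integrable_norm Bochner_Integration.integrable_diff L1 int
      int') simp_all
  have trunc: "(\<lambda>k. \<integral>w. min (W k w) R \<partial>M) \<longlonglongrightarrow> (\<integral>w. 0 \<partial>M)" if R: "R > 0" for R
  proof (rule integral_dominated_convergence[where w = "\<lambda>_. R"])
    show "AE w in M. (\<lambda>k. min (W k w) R) \<longlonglongrightarrow> 0"
      using lim
    proof eventually_elim
      case (elim w)
      then have "(\<lambda>k. W k w) \<longlonglongrightarrow> 0"
        unfolding W_def by (simp add: LIM_zero tendsto_norm_zero)
      then have "(\<lambda>k. min (W k w) R) \<longlonglongrightarrow> min 0 R" by (intro tendsto_min tendsto_const)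
      then show ?case using R by simp
    qed
    show "AE w in M. norm (min (W k w) R) \<le> R" for k
      using R by (intro AE_I2) (auto simp: W_def min_def)
  qed simp_all
  have null: "(\<lambda>k. \<integral>w. W k w \<partial>M) \<longlonglongrightarrow> 0"
  proof (rule LIMSEQ_I)
    fix e :: real assume e: "e > 0"
    \<comment> \<open>Makes \<open>4 * B / R\<close> at most e/2, where 4B bounds the second moment
      of \<open>W k\<close>; the added 1 keeps R positive when B = 0.\<close>
    define R where "R = (8 * B + 1) / e"
    have R: "R > 0" using e B0 by (simp add: R_def)
    have R4: "4 * B / R \<le> e / 2"
    proof -
      have "4 * B / R = e * (4 * B / (8 * B + 1))" using e B0 by (simp add: R_def)
      also have "\<dots> \<le> e * (1 / 2)" using e B0 by (intro mult_left_mono) (auto simp: divide_le_eq)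
      finally show ?thesis by simp
    qed
    from trunc[OF R] have "\<forall>\<^sub>F k in sequentially. (\<integral>w. min (W k w) R \<partial>M) < e / 2"
      using e by (intro order_tendstoD(2)) auto
    then obtain N where N: "\<And>k. k \<ge> N \<Longrightarrow> (\<integral>w. min (W k w) R \<partial>M) < e / 2"
      by (auto simp: eventually_sequentially)
    have "norm ((\<integral>w. W k w \<partial>M) - 0) < e" if "k \<ge> N" for k
    proof -
      \<comment> \<open>Where W exceeds R, the quotient W^2/R is at least W.\<close>
      have le: "W k w \<le> min (W k w) R + (W k w)\<^sup>2 / R" for w
      proof (cases "W k w \<le> R")
        case False
        then have "W k w * R \<le> (W k w)\<^sup>2" using R by (simp add: power2_eq_square)
        then have "W k w \<le> (W k w)\<^sup>2 / R" using R by (simp add: le_divide_eq)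
        then show ?thesis using R False by simp
      qed (use R in simp)
      have i: "integrable M (\<lambda>w. min (W k w) R)"
        by (rule Bochner_Integration.integrable_bound[OF W1[of k]]) (use R in \<open>auto simp: W_def min_def\<close>)
      have "(\<integral>w. W k w \<partial>M) \<le> (\<integral>w. min (W k w) R + (W k w)\<^sup>2 / R \<partial>M)"
        using i W2 by (intro integral_mono W1 le) auto
      also have "\<dots> = (\<integral>w. min (W k w) R \<partial>M) + (\<integral>w. (W k w)\<^sup>2 \<partial>M) / R"
        using i W2 by simp
      also have "\<dots> \<le> (\<integral>w. min (W k w) R \<partial>M) + 4 * B / R"
        using R by (intro add_left_mono divide_right_mono W2B) auto
      also have "\<dots> < e" using N[OF that] R4 by linarith
      finally have "(\<integral>w. W k w \<partial>M) < e" .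
      moreover have "0 \<le> (\<integral>w. W k w \<partial>M)" by (intro integral_nonneg_AE AE_I2) (simp add: W_def)
      ultimately show ?thesis by simp
    qed
    then show "\<exists>N. \<forall>k\<ge>N. norm ((\<integral>w. W k w \<partial>M) - 0) < e" by blast
  qed
  have le: "norm ((\<integral>w. Z k w \<partial>M) - (\<integral>w. Z' w \<partial>M)) \<le> (\<integral>w. W k w \<partial>M)" for k
  proof -
    have "(\<integral>w. Z k w \<partial>M) - (\<integral>w. Z' w \<partial>M) = (\<integral>w. Z k w - Z' w \<partial>M)"
      by (intro Bochner_Integration.integral_diff[symmetric] L1 int int') simp_all
    then show ?thesis unfolding W_def by (simp add: integral_norm_bound)
  qed
  show "(\<lambda>k. \<integral>w. Z k w \<partial>M) \<longlonglongrightarrow> (\<integral>w. Z' w \<partial>M)"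
    by (rule LIM_zero_cancel, rule Lim_null_comparison[OF always_eventually[OF allI[OF le]] null])
qed

text \<open>The concatenation of \<open>I\<close> with itself. The value \<open>undefined\<close>
  beyond 2d preserves the extensionality built into \<open>words\<close>.\<close>

definition double_word :: "nat \<Rightarrow> (nat \<Rightarrow> 'n) \<Rightarrow> nat \<Rightarrow> 'n" where
  "double_word d I i = (if i \<le> d then I i else if i \<le> 2 * d then I (i - d) else undefined)"

lemma double_word_in_words: "I \<in> words d \<Longrightarrow> double_word d I \<in> words (d + d)"
  by (auto simp: words_def double_word_def PiE_iff extensional_def)

text \<open>Second moments of entries of mixed tensors are first moments of longer mixed tensors.\<close>

lemma cmod_mixed_sq:
  "of_real ((cmod (mixed n m X I J))\<^sup>2) = mixed (n + m) (n + m) X (double_word (n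
    + m) I) (double_word (n + m) J)"
proof -
  let ?d = "n + m"
  let ?g = "mixed_entry ?d (double_word ?d I) (double_word ?d J) X"
  have "mixed ?d ?d X (double_word ?d I) (double_word ?d J) = (\<Prod>i\<in>{1..?d} \<union> {?d + 1..?d + ?d}. ?g i)"
    unfolding mixed_eq_prod by (intro prod.cong) auto
  also have "\<dots> = (\<Prod>i\<in>{1..?d}. ?g i) * (\<Prod>i\<in>{?d + 1..?d + ?d}. ?g i)"
    by (rule prod.union_disjoint) auto
  also have "(\<Prod>i\<in>{?d + 1..?d + ?d}. ?g i) = (\<Prod>i\<in>{1..?d}. ?g (i + ?d))"
    using prod.shift_bounds_cl_nat_ivl[of ?g 1 ?d ?d] by (simp add: add.commute)
  also have "(\<Prod>i\<in>{1..?d}. ?g i) * (\<Prod>i\<in>{1..?d}. ?g (i + ?d)) = (\<Prod>i\<in>{1..?d}. ?g i * ?g (i + ?d))"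
    by (rule prod.distrib[symmetric])
  also have "\<dots> = (\<Prod>i\<in>{1..?d}. mixed_entry n I J X i * cnj (mixed_entry n I J X i))"
  proof (intro prod.cong refl)
    fix i assume i: "i \<in> {1..?d}"
    \<comment> \<open>The doubled tensor conjugates its second half only. For i > n this is the
      reverse of what \<open>mixed n m\<close> does in slot i and its conjugate, but the product of
      the two factors is the same.\<close>
    then have "?g i = X $ I i $ J i" "?g (i + ?d) = cnj (X $ I i $ J i)"
      by (simp_all add: mixed_entry_def double_word_def)
    then show "?g i * ?g (i + ?d) = mixed_entry n I J X i * cnj (mixed_entry n I J X i)"
      by (cases "i \<le> n") (simp_all add: mixed_entry_def)
  qed
  also have "\<dots> = mixed n m X I J * cnj (mixed n m X I J)"
    unfolding mixed_eq_prod by (simp add: prod.distrib)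
  finally show ?thesis
    by (simp only: complex_norm_square)
qed

section \<open>Moments of the Euler scheme\<close>

context u_bm
begin

lemma euler_factor_shift: "euler_factor h k w = (1 - h / 2) *\<^sub>R mat 1 + incr (real k * h) (real k
  * h + h) w"
  by (simp add: euler_factor_def algebra_simps)

text \<open>The tensor of a product is the product of tensors, and the iterate is measurable at time
  kh while the new factor depends only on the later increment. The expectation of every entry
  product therefore factors.\<close>

lemma euler_moments:
  assumes h: "0 \<le> h" "h \<le> 1" and IJ: "I \<in> words (n + m)" "J \<in> words (n + m)"
  shows "integrable M (\<lambda>w. mixed n m (euler h k w) I J)"
    and "(\<integral>w. mixed n m (euler h (Suc k) w) I J \<partial>M) =
      op_mult (n + m) (\<lambda>I J. \<integral>w. mixed n m (euler h k w) I J \<partial>M) (\<lambda>I J. \<integral>w. mixed n m (euler_factor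
        h k w) I J \<partial>M) I J"
proof -
  obtain C where C: "\<And>s h I J. 0 \<le> s \<Longrightarrow> 0 \<le> h \<Longrightarrow> h \<le> 1 \<Longrightarrow> I \<in> words (n + m) \<Longrightarrow> J \<in> words (n + m) \<Longrightarrow>
    integrable M (\<lambda>w. mixed n m ((1 - h / 2) *\<^sub>R mat 1 + incr s (s + h) w) I J)"
    using one_step_moments[of n m] by metis
  have kh: "0 \<le> real k * h" "real k * h \<le> real k * h + h" for k using h by auto
  have fint: "integrable M (\<lambda>w. mixed n m (euler_factor h k w) I J)"
    if "I \<in> words (n + m)" "J \<in> words (n + m)" for k I J
    unfolding euler_factor_shift using C kh(1) h that by blast
  have split: "integrable M (\<lambda>w. mixed n m (euler h k w) I L * mixed n m (euler_factor h k w) L J)"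
    "(\<integral>w. mixed n m (euler h k w) I L * mixed n m (euler_factor h k w) L J \<partial>M) =
       (\<integral>w. mixed n m (euler h k w) I L \<partial>M) * (\<integral>w. mixed n m (euler_factor h k w) L J \<partial>M)"
    if int: "integrable M (\<lambda>w. mixed n m (euler h k w) I L)" and L: "L \<in> words (n + m)"
      "J \<in> words (n + m)" for k I L J
  proof -
    have f: "(\<lambda>w. mixed n m (euler h k w) I L) \<in> borel_measurable (F (real k * h))"
      by (rule borel_measurable_mixed[OF euler_measurable_F[OF h(1)]])
    have g: "(\<lambda>x. mixed n m ((1 - h / 2) *\<^sub>R mat 1 + x) L J) \<in> borel_measurable borel"
      by (rule borel_measurable_mixed) simp
    note ind = indep_incr[OF kh(1) kh(2) f g int fint[OF L, unfolded euler_factor_shift]]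
    show "integrable M (\<lambda>w. mixed n m (euler h k w) I L * mixed n m (euler_factor h k w) L J)"
      "(\<integral>w. mixed n m (euler h k w) I L * mixed n m (euler_factor h k w) L J \<partial>M) =
       (\<integral>w. mixed n m (euler h k w) I L \<partial>M) * (\<integral>w. mixed n m (euler_factor h k w) L J \<partial>M)"
      unfolding euler_factor_shift by (rule ind)+
  qed
  have eq: "mixed n m (euler h (Suc k) w) I J = (\<Sum>L\<in>words (n + m). mixed n m (euler h k w) I L
    * mixed n m (euler_factor h k w) L J)" for k w I J
    by (simp add: mixed_mult op_mult_def)
  have int: "integrable M (\<lambda>w. mixed n m (euler h k w) I J)" if "I \<in> words (n + m)"
    "J \<in> words (n + m)" for k I J
    using that
  proof (induction k arbitrary: I J)
    case (Suc k)
    then show ?case unfolding eq by (intro Bochner_Integration.integrable_sum split) auto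
  qed simp
  show "integrable M (\<lambda>w. mixed n m (euler h k w) I J)" by (rule int[OF IJ])
  show "(\<integral>w. mixed n m (euler h (Suc k) w) I J \<partial>M) =
      op_mult (n + m) (\<lambda>I J. \<integral>w. mixed n m (euler h k w) I J \<partial>M) (\<lambda>I J. \<integral>w. mixed n m (euler_factor
        h k w) I J \<partial>M) I J"
    unfolding eq op_mult_def using int IJ
    by (subst Bochner_Integration.integral_sum) (auto intro!: split sum.cong)
qed

text \<open>With N steps of length h = T/N the local errors \<open>C * sqrt h ^ 3\<close> add up to
  \<open>C * T * sqrt h\<close>, which tends to 0. The condition N \<ge> T ensures h \<le> 1. The
  second claim serves, for the doubled tensor, as the uniform second moment bound.\<close>

lemma euler_moments_limit:
  assumes T: "0 \<le> T" and IJ: "I \<in> words (n + m)" "J \<in> words (n + m)"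
  shows "(\<lambda>N. \<integral>w. mixed n m (euler (T / real N) N w) I J \<partial>M) \<longlonglongrightarrow> op_exp (n + m) (\<lambda>I J. of_real T
    * Delta_U n m I J) I J"
    and "\<exists>B. \<forall>N. real N \<ge> T \<longrightarrow> N > 0 \<longrightarrow> cmod (\<integral>w. mixed n m (euler (T / real N) N w) I J \<partial>M) \<le> B"
proof -
  let ?A = "Delta_U n m :: 'n tensor_op"
  define d where "d = n + m"
  define D where "D = real (card (words d :: (nat \<Rightarrow> 'n) set))"
  define W where "W = op_norm d ?A"
  obtain C where C: "C \<ge> 0" "\<And>s h I J. 0 \<le> s \<Longrightarrow> 0 \<le> h \<Longrightarrow> h \<le> 1 \<Longrightarrow> I \<in> words (n + m) \<Longrightarrow> J \<in> words (n + m) \<Longrightarrow>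
    cmod ((\<integral>w. mixed n m ((1 - h / 2) *\<^sub>R mat 1 + incr s (s + h) w) I J \<partial>M)
      - (op_id (n + m) I J + of_real h * ?A I J)) \<le> C * sqrt h ^ 3"
    using one_step_moments[of n m] by metis
  \<comment> \<open>The stability bound with \<open>sqrt h\<close> replaced by 1, hence independent
    of N.\<close>
  define B where "B = D\<^sup>2 * exp (T * W + D\<^sup>2 * (C * T))"
  define e where "e h k I J = (\<integral>w. mixed n m (euler h k w) I J \<partial>M)" for h k I J
  have bounds: "op_norm d (e h N) \<le> B \<and>
      op_norm d (\<lambda>I J. e h N I J - op_binomial d ?A h N I J) \<le> D\<^sup>2 * (C * T * sqrt h) * B * exp (T * W)"
    if N: "real N \<ge> T" "N > 0" and hdef: "h = T / real N" for N h
  proof -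
    have h: "0 \<le> h" "h \<le> 1" "real N * h = T" using N T by (auto simp: hdef divide_le_eq)
    have sq: "sqrt h ^ 3 = h * sqrt h" using h by (simp add: numeral_3_eq_3)
    let ?\<epsilon> = "C * sqrt h ^ 3"
    have \<epsilon>: "0 \<le> ?\<epsilon>" using C(1) h by simp
    have e0: "e h 0 I J = op_id d I J" for I J
      by (simp add: e_def d_def mixed_one prob_space)
    have eS: "e h (Suc k) I J = op_mult d (e h k) (\<lambda>I J. \<integral>w. mixed n m (euler_factor h k w) I J \<partial>M) I J"
      if "I \<in> words d" "J \<in> words d" for k I J
      using euler_moments(2)[OF h(1,2) that[unfolded d_def]] unfolding e_def d_def .
    have S: "cmod ((\<integral>w. mixed n m (euler_factor h k w) I J \<partial>M) - (op_id d I J + of_real h * ?A I J)) \<le> ?\<epsilon>"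
      if "I \<in> words d" "J \<in> words d" for k I J
      unfolding euler_factor_shift d_def using that h by (intro C(2)) (auto simp: d_def)
    note pp = perturbed_powers[OF h(1) \<epsilon> e0 eS S D_def, of N]
    have p: "op_norm d (e h N) \<le> D\<^sup>2 * exp (real N * (h * W + D\<^sup>2 * ?\<epsilon>))"
      "op_norm d (\<lambda>I J. e h N I J - op_binomial d ?A h N I J) \<le>
      real N * (D\<^sup>2 * ?\<epsilon>) * (D\<^sup>2 * exp (real N * (h * W + D\<^sup>2 * ?\<epsilon>))) * exp (real N * (h * W))"
      unfolding W_def by (rule pp; assumption)+
    have N\<epsilon>: "real N * (D\<^sup>2 * ?\<epsilon>) = D\<^sup>2 * (C * T * sqrt h)"
      unfolding sq h(3)[symmetric] by (simp add: mult_ac)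
    have "real N * (h * W + D\<^sup>2 * ?\<epsilon>) = T * W + D\<^sup>2 * (C * T * sqrt h)"
      unfolding distrib_left N\<epsilon> by (simp flip: h(3))
    also have "\<dots> \<le> T * W + D\<^sup>2 * (C * T)"
      using C(1) T h by (intro add_left_mono mult_left_mono mult_right_le_one_le) auto
    finally have le: "D\<^sup>2 * exp (real N * (h * W + D\<^sup>2 * ?\<epsilon>)) \<le> B"
      unfolding B_def by (intro mult_left_mono) auto
    have NW: "real N * (h * W) = T * W" by (simp flip: h(3))
    show ?thesis
    proof
      show "op_norm d (e h N) \<le> B" using p(1) le by simp
      have "op_norm d (\<lambda>I J. e h N I J - op_binomial d ?A h N I J) \<le>
        D\<^sup>2 * (C * T * sqrt h) * (D\<^sup>2 * exp (real N * (h * W + D\<^sup>2 * ?\<epsilon>))) * exp (T * W)"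
        using p(2) unfolding N\<epsilon> NW .
      also have "\<dots> \<le> D\<^sup>2 * (C * T * sqrt h) * B * exp (T * W)"
        using C(1) T h by (intro mult_right_mono mult_left_mono le) auto
      finally show "op_norm d (\<lambda>I J. e h N I J - op_binomial d ?A h N I J)
        \<le> D\<^sup>2 * (C * T * sqrt h) * B * exp (T * W)" .
    qed
  qed
  have IJ': "I \<in> words d" "J \<in> words d" using IJ by (simp_all add: d_def)
  show "\<exists>B. \<forall>N. real N \<ge> T \<longrightarrow> N > 0 \<longrightarrow> cmod (\<integral>w. mixed n m (euler (T / real N) N w) I J \<partial>M) \<le> B"
  proof (intro exI[of _ B] allI impI)
    fix N assume "T \<le> real N" "0 < N"
    then have "op_norm d (e (T / real N) N) \<le> B" using bounds by blast
    then have "cmod (e (T / real N) N I J) \<le> B" using entry_le_op_norm[OF IJ'] order_trans by blast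
    then show "cmod (\<integral>w. mixed n m (euler (T / real N) N w) I J \<partial>M) \<le> B" by (simp add: e_def)
  qed
  have "(\<lambda>N. e (T / real N) N I J - op_binomial d ?A (T / real N) N I J) \<longlonglongrightarrow> 0"
  proof (rule Lim_null_comparison)
    show "\<forall>\<^sub>F N in sequentially. norm (e (T / real N) N I J - op_binomial d ?A (T / real N) N I J)
      \<le> D\<^sup>2 * (C * T * sqrt (T / real N)) * B * exp (T * W)"
      using eventually_gt_at_top[of 0] eventually_ge_at_top[of "nat \<lceil>T\<rceil>"]
    proof eventually_elim
      case (elim N)
      then have "T \<le> real N" by linarith
      then have "op_norm d (\<lambda>I J. e (T / real N) N I J - op_binomial d ?A (T / real N) N I J)
        \<le> D\<^sup>2 * (C * T * sqrt (T / real N)) * B * exp (T * W)"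
        using bounds elim by blast
      then show ?case using entry_le_op_norm[OF IJ', of "\<lambda>I J. e (T / real N) N I J
        - op_binomial d ?A (T / real N) N I J"] by linarith
    qed
    have "(\<lambda>N. sqrt (T / real N)) \<longlonglongrightarrow> sqrt 0"
      by (intro tendsto_real_sqrt lim_const_over_n)
    then have "(\<lambda>N. D\<^sup>2 * (C * T * sqrt (T / real N)) * B * exp (T * W))
      \<longlonglongrightarrow> D\<^sup>2 * (C * T * sqrt 0) * B * exp (T * W)"
      by (intro tendsto_mult tendsto_const)
    then show "(\<lambda>N. D\<^sup>2 * (C * T * sqrt (T / real N)) * B * exp (T * W)) \<longlonglongrightarrow> 0" by simp
  qed
  from tendsto_add[OF this op_binomial_tendsto_exp[OF IJ' T, of ?A]]
  show "(\<lambda>N. \<integral>w. mixed n m (euler (T / real N) N w) I J \<partial>M) \<longlonglongrightarrow> op_exp (n + m) (\<lambda>I J. of_real T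
    * Delta_U n m I J) I J"
    by (simp add: e_def d_def)
qed

end

section \<open>Transfer from the scheme to the solution\<close>

context unitary_bm
begin

text \<open>Tensor entries are polynomials in the matrix entries, so almost sure convergence passes
  to them by continuity. The shift by \<open>N0\<close> discards the step counts with T/N > 1 or
  with a mean square error that is not yet below 1.\<close>

lemma euler_subsequence:
  assumes T: "0 \<le> T"
  obtains \<rho> :: "nat \<Rightarrow> nat" where "strict_mono \<rho>" "\<And>k. \<rho> k > 0" "\<And>k. real (\<rho> k) \<ge> T"
    "AE w in M. (\<lambda>k. euler (T / real (\<rho> k)) (\<rho> k) w) \<longlonglongrightarrow> Gc T w"
proof -
  define v where "v N w = (norm (Gc T w - euler (T / real N) N w))\<^sup>2" for N w
  note [measurable] = Gc(2)
  have [measurable]: "v N \<in> borel_measurable M" for N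
  proof -
    have "0 \<le> T / real N" using T by simp
    note [measurable] = euler_measurable[OF this, of N]
    show ?thesis unfolding v_def[abs_def] by measurable
  qed
  have lim: "(\<lambda>N. \<integral>\<^sup>+w. ennreal (v N w) \<partial>M) \<longlonglongrightarrow> 0"
    unfolding v_def by (rule euler_converges[OF T])
  have "\<forall>\<^sub>F N in sequentially. (\<integral>\<^sup>+w. ennreal (v N w) \<partial>M) < 1"
    by (rule order_tendstoD(2)[OF lim]) simp
  with eventually_gt_at_top[of 0] eventually_ge_at_top[of "nat \<lceil>T\<rceil>"]
  have "\<forall>\<^sub>F N in sequentially. N > 0 \<and> real N \<ge> T \<and> (\<integral>\<^sup>+w. ennreal (v N w) \<partial>M) < 1"
    by eventually_elim linarith
  then obtain N0 where N0: "\<And>N. N \<ge> N0 \<Longrightarrow> N > 0 \<and> real N \<ge> T \<and> (\<integral>\<^sup>+w. ennreal (v N w) \<partial>M) < 1"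
    by (auto simp: eventually_sequentially)
  have int: "integrable M (v (N + N0))" for N
  proof (rule integrableI_bounded)
    have "(\<integral>\<^sup>+w. ennreal (norm (v (N + N0) w)) \<partial>M) = (\<integral>\<^sup>+w. ennreal (v (N + N0) w) \<partial>M)"
      by (simp add: v_def)
    also have "\<dots> < 1" using N0[of "N + N0"] by simp
    finally show "(\<integral>\<^sup>+w. ennreal (norm (v (N + N0) w)) \<partial>M) < \<infinity>"
      by (rule less_trans) simp
  qed simp
  have "(\<lambda>N. \<integral>w. norm (v (N + N0) w) \<partial>M) \<longlonglongrightarrow> 0"
  proof -
    have "(\<lambda>N. ennreal (\<integral>w. norm (v (N + N0) w) \<partial>M)) \<longlonglongrightarrow> ennreal 0"
    proof -
      have "ennreal (\<integral>w. norm (v (N + N0) w) \<partial>M) = (\<integral>\<^sup>+w. ennreal (v (N + N0) w) \<partial>M)" for N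
        using nn_integral_eq_integral[OF integrable_norm[OF int]] by (simp add: v_def)
      then show ?thesis using LIMSEQ_ignore_initial_segment[OF lim, of N0] by simp
    qed
    then show ?thesis by (subst (asm) tendsto_ennreal_iff) (auto intro!: always_eventually
      integral_nonneg_AE)
  qed
  from tendsto_L1_AE_subseq[OF int this] obtain r where r: "strict_mono r"
    "AE w in M. (\<lambda>k. v (r k + N0) w) \<longlonglongrightarrow> 0" by auto
  show ?thesis
  proof (rule that[of "\<lambda>k. r k + N0"])
    show "strict_mono (\<lambda>k. r k + N0)" using r(1) by (auto simp: strict_mono_def)
    show "r k + N0 > 0" "real (r k + N0) \<ge> T" for k using N0[of "r k + N0"] by auto
    show "AE w in M. (\<lambda>k. euler (T / real (r k + N0)) (r k + N0) w) \<longlonglongrightarrow> Gc T w"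
      using r(2)
    proof eventually_elim
      case (elim w)
      then have "(\<lambda>k. sqrt (v (r k + N0) w)) \<longlonglongrightarrow> sqrt 0" by (rule tendsto_real_sqrt)
      then have "(\<lambda>k. norm (euler (T / real (r k + N0)) (r k + N0) w - Gc T w)) \<longlonglongrightarrow> 0"
        by (simp add: v_def norm_minus_commute)
      then show ?case by (simp only: tendsto_norm_zero_iff LIM_zero_iff)
    qed
  qed
qed

lemma tendsto_mixed: "(X \<longlongrightarrow> x) F' \<Longrightarrow> ((\<lambda>k. mixed n m (X k) I J) \<longlongrightarrow> mixed n m x I J) F'"
proof -
  assume "(X \<longlongrightarrow> x) F'"
  then have "((\<lambda>k. mixed_entry n I J (X k) i) \<longlongrightarrow> mixed_entry n I J x i) F'" for i
    unfolding mixed_entry_def by (cases "i \<le> n") (auto intro!: tendsto_vec_nth tendsto_cnj)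
  then show ?thesis unfolding mixed_eq_prod by (intro tendsto_prod)
qed

text \<open>Along the subsequence the tensors converge almost surely and are bounded in L2, their
  squared moduli being entries of the doubled tensor. Their expectations thus converge both to that
  of \<open>Gc\<close> and to the exponential.\<close>

lemma mixed_expectation:
  assumes T: "0 \<le> T" and IJ: "I \<in> words (n + m)" "J \<in> words (n + m)"
  shows "integrable M (\<lambda>w. mixed n m (G T w) I J)"
    and "(\<integral>w. mixed n m (G T w) I J \<partial>M) = op_exp (n + m) (\<lambda>I J. of_real T * Delta_U n m I J) I J"
proof -
  obtain \<rho> where \<rho>: "strict_mono \<rho>" "\<And>k. \<rho> k > 0" "\<And>k. real (\<rho> k) \<ge> T"
    "AE w in M. (\<lambda>k. euler (T / real (\<rho> k)) (\<rho> k) w) \<longlonglongrightarrow> Gc T w"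
    using euler_subsequence[OF T] by blast
  let ?X = "\<lambda>k. euler (T / real (\<rho> k)) (\<rho> k)"
  have h: "0 \<le> T / real (\<rho> k)" "T / real (\<rho> k) \<le> 1" for k
    using T \<rho>(2)[of k] \<rho>(3)[of k] by (auto simp: divide_le_eq)
  note D = double_word_in_words[OF IJ(1)] double_word_in_words[OF IJ(2)]
  obtain B where B: "\<And>N. real N \<ge> T \<Longrightarrow> N > 0 \<Longrightarrow> cmod (\<integral>w. mixed (n + m) (n
    + m) (euler (T / real N) N w) (double_word (n + m) I) (double_word (n + m) J) \<partial>M) \<le> B"
    using euler_moments_limit(2)[OF T D] by blast
  have sq: "integrable M (\<lambda>w. complex_of_real ((cmod (mixed n m (?X k w) I J))\<^sup>2))" for k
    unfolding cmod_mixed_sq by (rule euler_moments(1)[OF h D])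
  then have sq': "square_integrable M (\<lambda>w. mixed n m (?X k w) I J)" for k
    by (subst (asm) complex_of_real_integrable_eq)
  have bound: "(\<integral>w. (cmod (mixed n m (?X k w) I J))\<^sup>2 \<partial>M) \<le> B" for k
  proof -
    have "(\<integral>w. (cmod (mixed n m (?X k w) I J))\<^sup>2 \<partial>M) \<le> cmod (complex_of_real (\<integral>w. (cmod (mixed n m
      (?X k w) I J))\<^sup>2 \<partial>M))"
      by simp
    also have "complex_of_real (\<integral>w. (cmod (mixed n m (?X k w) I J))\<^sup>2 \<partial>M)
      = (\<integral>w. complex_of_real ((cmod (mixed n m (?X k w) I J))\<^sup>2) \<partial>M)"
      by (rule integral_complex_of_real[symmetric])
    also have "cmod \<dots> \<le> B"
      unfolding cmod_mixed_sq by (rule B[OF \<rho>(3,2)])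
    finally show ?thesis .
  qed
  have mZ: "(\<lambda>w. mixed n m (?X k w) I J) \<in> borel_measurable M" for k
    by (rule borel_measurable_mixed[OF euler_measurable[OF h(1)]])
  have mG: "(\<lambda>w. mixed n m (Gc T w) I J) \<in> borel_measurable M"
    by (rule borel_measurable_mixed[OF Gc(2)])
  have ae: "AE w in M. (\<lambda>k. mixed n m (?X k w) I J) \<longlonglongrightarrow> mixed n m (Gc T w) I J"
    using \<rho>(4) by eventually_elim (rule tendsto_mixed)
  note lim = bounded_L2_expectation_tendsto[OF mZ mG sq' bound ae]
  have "(\<lambda>k. \<integral>w. mixed n m (?X k w) I J \<partial>M) \<longlonglongrightarrow> op_exp (n + m) (\<lambda>I J. of_real T * Delta_U n m I J) I J"
    using LIMSEQ_subseq_LIMSEQ[OF euler_moments_limit(1)[OF T IJ] \<rho>(1)] by (simp add: o_def)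
  with lim(2) have val: "(\<integral>w. mixed n m (Gc T w) I J \<partial>M) = op_exp (n + m) (\<lambda>I J. of_real T
    * Delta_U n m I J) I J"
    by (rule LIMSEQ_unique)
  have GT: "G T \<in> borel_measurable M"
    using ubm T by (intro measurable_F_M[OF T]) (auto simp: unitary_brownian_motion_def)
  have eq: "AE w in M. mixed n m (Gc T w) I J = mixed n m (G T w) I J"
    using Gc(3) by eventually_elim (use T in simp)
  note mGT = borel_measurable_mixed[OF GT, of n m I J]
  show "integrable M (\<lambda>w. mixed n m (G T w) I J)"
    using lim(1) integrable_cong_AE[OF mG mGT eq] by simp
  show "(\<integral>w. mixed n m (G T w) I J \<partial>M) = op_exp (n + m) (\<lambda>I J. of_real T * Delta_U n m I J) I J"
    using val integral_cong_AE[OF mG mGT eq] by simp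
qed

end

theorem lemma4p2:
  fixes M :: "'w measure"
    and F :: "real \<Rightarrow> 'w measure"
    and K G :: "real \<Rightarrow> 'w \<Rightarrow> complex^'n::finite^'n"
    and n m :: nat
    and t :: real
  assumes "prob_space M"
    and "nonneg_filtration M F"
    and "u_brownian_motion M F K"
    and "unitary_brownian_motion M F K G"
    and "n \<ge> 1" and "m \<ge> 1" and "t \<ge> 0"
  shows "\<forall>I\<in>words (n + m). \<forall>J\<in>words (n + m).
      integrable M (\<lambda>\<omega>. tensor (n + m) (\<lambda>i. if i \<le> n then G t \<omega> else mat_cnj (G t \<omega>)) I J) \<and>
      (\<integral>\<omega>. tensor (n + m) (\<lambda>i. if i \<le> n then G t \<omega> else mat_cnj (G t \<omega>)) I J \<partial>M)
        = op_exp (n + m) (\<lambda>I J. of_real t * Delta_U n m I J) I J"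
proof -
  interpret prob_space M by fact
  interpret unitary_bm M F K G
    by unfold_locales (fact assms)+
  show ?thesis
    using mixed_expectation[OF \<open>t \<ge> 0\<close>, of _ n m] unfolding mixed_def by blast
qed

end
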